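(* Assume that for both $b_1=1$ and $b_1=-1$ one has $$\dim\mathfrak{B}\big(M\langle(xy,x)\rangle\oplus W^{b_1,-1}\big)=\infty=\dim\mathfrak{B}\big(M\langle(y,xy)\rangle\oplus W^{b_1,-1}\big).$$ If $M$ is a nonzero object of ${}^{H_8}_{H_8}\mathcal{YD}$ with $\dim\mathfrak{B}(M)<\infty$, then $M$ is isomorphic to one of the following Yetter–Drinfeld modules, whose braidings are of diagonal type of the indicated Cartan types: (1) $\Omega_1(n_1,n_2,n_3,n_4)$ with $n_1+n_2+n_3+n_4\ge 1$, of type $A_1\times\cdots\times A_1$ ($n_1+n_2+n_3+n_4$ factors); (2) $\Omega_2(n_1,n_2)$, $n_1,n_2\ge0$, of type $A_1\times\cdots\times A_1\times A_2$ ($n_1+n_2$ factors $A_1$); (3) $\Omega_3(n_1,n_2)$, $n_1,n_2\ge 0$, of type $A_1\times\cdots\times A_1\times A_2$ ($n_1+n_2$ factors $A_1$); (4) $\Omega_4(n_1,n_2)$, $n_1,n_2\ge 0$, of type $A_1\times\cdots\times A_1\times A_2$ ($n_1+n_2$ factors $A_1$); (5) $\Omega_5(n_1,n_2)$, $n_1,n_2\ge 0$, of type $A_1\times\cdots\times A_1\times A_2$ ($n_1+n_2$ factors $A_1$); (6) $\Omega_6$, of type $A_2\times A_2$; (7) $\Omega_7$, of type $A_2\times A_2$.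
   Context: $\mathbb{K}$ is an algebraically closed field of characteristic $0$ and $\mathrm{i}\in\mathbb{K}$ is a fixed square root of $-1$. $H_8$ (the Kac–Paljutkin algebra) is the $8$-dimensional Hopf algebra over $\mathbb{K}$ generated as an algebra by $x,y,z$ subject to $x^2=y^2=1$, $z^2=\frac12(1+x+y-xy)$, $xy=yx$, $zx=yz$, $zy=xz$, with $\Delta(x)=x\otimes x$, $\Delta(y)=y\otimes y$, $\Delta(z)=\frac12(1\otimes1+1\otimes x+y\otimes1-y\otimes x)(z\otimes z)$, $\varepsilon(x)=\varepsilon(y)=\varepsilon(z)=1$, $S(x)=x$, $S(y)=y$, $S(z)=z$. For $j,k\in\{0,1\}$ put $f_{jk}=\frac14(1+(-1)^jx)(1+(-1)^ky)$. ${}^{H_8}_{H_8}\mathcal{YD}$ is the category of left Yetter–Drinfeld modules over $H_8$: left $H_8$-modules and left $H_8$-comodules $\rho(m)=m_{(-1)}\otimes m_{(0)}$ with $\rho(h\cdot m)=h_{(1)}m_{(-1)}S(h_{(3)})\otimes h_{(2)}\cdot m_{(0)}$; it is braided with $c(v\otimes w)=v_{(-1)}\cdot w\otimes v_{(0)}$. For $M$ in this category, $\mathfrak{B}(M)=\bigoplus_{n\ge0}\mathfrak{B}^n(M)$ is its Nichols algebra: the $\mathbb N$-graded braided Hopf algebra in ${}^{H_8}_{H_8}\mathcal{YD}$ with $\mathfrak{B}^0=\mathbb{K}$, $\mathfrak{B}^1\cong M$, generated by $\mathfrak{B}^1$, whose primitive elements are exactly $\mathfrak{B}^1$ (equivalently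 $T(M)$ modulo the kernels of the quantum symmetrizers built from $c$). A braided vector space $(V,c)$ is of diagonal type if it has a basis $v_1,\dots,v_\theta$ with $c(v_i\otimes v_j)=q_{ij}v_j\otimes v_i$; it is of Cartan type with generalized Cartan matrix $(a_{ij})$ if moreover $q_{ii}\ne1$ and $q_{ij}q_{ji}=q_{ii}^{a_{ij}}$ for $i\ne j$; $A_1\times\cdots\times A_1$, $A_2$, etc. name the corresponding Cartan matrices (disjoint unions of Dynkin diagrams). Yetter–Drinfeld modules (action and coaction given on a basis): - For $(b,g)\in\{(\pm1,1),(\pm1,xy),(\pm\mathrm{i},x),(\pm\mathrm{i},y)\}$: $M\langle b,g\rangle=\mathbb{K}p$ with $x\cdot p=b^2p$, $y\cdot p=b^2p$, $z\cdot p=bp$, $\rho(p)=g\otimes p$. - For $(g_1,g_2)\in\{(xy,x),(y,xy)\}$: $M\langle(g_1,g_2)\rangle$ has basis $p_1,p_2$ with $x\cdot p_1=p_1$, $x\cdot p_2=-p_2$, $y\cdot p_1=-p_1$, $y\cdot p_2=p_2$, $z\cdot p_1=p_2$, $z\cdot p_2=p_1$, $\rho(p_1)=g_1\otimes p_1$, $\rho(p_2)=g_2\otimes p_2$. - For $b_1,b_2\in\{\pm1\}$: $W^{b_1,b_2}$ has basis $p_1,p_2$ with $x\cdot p_1=y\cdot p_1=p_1$, $x\cdot p_2=y\cdot p_2=-p_2$, $z\cdot p_1=b_2p_1$, $z\cdot p_2=-\mathrm{i}b_1b_2p_2$, $\rho(p_1)=(f_{00}-\mathrm{i}b_1f_{11})z\otimes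 p_1+(f_{10}+\mathrm{i}b_1f_{01})z\otimes p_2$, $\rho(p_2)=(f_{00}+\mathrm{i}b_1f_{11})z\otimes p_2+(f_{10}-\mathrm{i}b_1f_{01})z\otimes p_1$. Direct sums: $\Omega_1(n_1,n_2,n_3,n_4)=M\langle\mathrm{i},x\rangle^{\oplus n_1}\oplus M\langle-\mathrm{i},x\rangle^{\oplus n_2}\oplus M\langle\mathrm{i},y\rangle^{\oplus n_3}\oplus M\langle-\mathrm{i},y\rangle^{\oplus n_4}$; $\Omega_2(n_1,n_2)=M\langle\mathrm{i},x\rangle^{\oplus n_1}\oplus M\langle-\mathrm{i},x\rangle^{\oplus n_2}\oplus M\langle(xy,x)\rangle$; $\Omega_3(n_1,n_2)=M\langle\mathrm{i},y\rangle^{\oplus n_1}\oplus M\langle-\mathrm{i},y\rangle^{\oplus n_2}\oplus M\langle(y,xy)\rangle$; $\Omega_4(n_1,n_2)=M\langle\mathrm{i},x\rangle^{\oplus n_1}\oplus M\langle\mathrm{i},y\rangle^{\oplus n_2}\oplus W^{1,-1}$; $\Omega_5(n_1,n_2)=M\langle-\mathrm{i},x\rangle^{\oplus n_1}\oplus M\langle-\mathrm{i},y\rangle^{\oplus n_2}\oplus W^{-1,-1}$; $\Omega_6=M\langle(xy,x)\rangle\oplus M\langle(y,xy)\rangle$; $\Omega_7=W^{1,-1}\oplus W^{-1,-1}$. *)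

theory Defs
  imports "HOL-Computational_Algebra.Polynomial"
begin

text \<open>Basis of H8: (a,b,c) stands for x^a y^b z^c. Elements of H8 are coefficient
functions on this basis; elements of H8 tensor H8 (resp. triple tensor) are coefficient
functions on pairs (resp. triples) of basis indices.\<close>

type_synonym hb = "bool \<times> bool \<times> bool"

definition hbas :: "hb \<Rightarrow> hb \<Rightarrow> 'a::field" where
  "hbas u = (\<lambda>v. if v = u then 1 else 0)"

definition e1 :: hb where "e1 = (False, False, False)"
definition ex :: hb where "ex = (True, False, False)"
definition ey :: hb where "ey = (False, True, False)"
definition exy :: hb where "exy = (True, True, False)"
definition ez :: hb where "ez = (False, False, True)"

text \<open>Product of two basis elements, using zx = yz, zy = xz, z^2 = (1+x+y-xy)/2.\<close>
definition bmul :: "hb \<Rightarrow> hb \<Rightarrow> hb \<Rightarrow> 'a::field_char_0" where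
  "bmul u v = (case u of (a, b, c) \<Rightarrow> case v of (d, e, f) \<Rightarrow>
     if \<not> c then hbas (a \<noteq> d, b \<noteq> e, f)
     else if \<not> f then hbas (a \<noteq> e, b \<noteq> d, True)
     else (\<lambda>w. (hbas (a \<noteq> e, b \<noteq> d, False) w + hbas (\<not> (a \<noteq> e), b \<noteq> d, False) w
               + hbas (a \<noteq> e, \<not> (b \<noteq> d), False) w
               - hbas (\<not> (a \<noteq> e), \<not> (b \<noteq> d), False) w) / 2))"

definition hmul :: "(hb \<Rightarrow> 'a::field_char_0) \<Rightarrow> (hb \<Rightarrow> 'a) \<Rightarrow> hb \<Rightarrow> 'a" where
  "hmul h k = (\<lambda>w. \<Sum>u\<in>UNIV. \<Sum>v\<in>UNIV. h u * k v * bmul u v w)"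

definition hmul2 :: "(hb \<times> hb \<Rightarrow> 'a::field_char_0) \<Rightarrow> (hb \<times> hb \<Rightarrow> 'a) \<Rightarrow> hb \<times> hb \<Rightarrow> 'a" where
  "hmul2 h k = (\<lambda>(w1, w2). \<Sum>p\<in>UNIV. \<Sum>q\<in>UNIV.
      h p * k q * bmul (fst p) (fst q) w1 * bmul (snd p) (snd q) w2)"

definition tens :: "(hb \<Rightarrow> 'a::field) \<Rightarrow> (hb \<Rightarrow> 'a) \<Rightarrow> hb \<times> hb \<Rightarrow> 'a" where
  "tens h k = (\<lambda>(p, q). h p * k q)"

definition cop_x :: "hb \<times> hb \<Rightarrow> 'a::field_char_0" where "cop_x = tens (hbas ex) (hbas ex)"
definition cop_y :: "hb \<times> hb \<Rightarrow> 'a::field_char_0" where "cop_y = tens (hbas ey) (hbas ey)"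
definition cop_one :: "hb \<times> hb \<Rightarrow> 'a::field_char_0" where "cop_one = tens (hbas e1) (hbas e1)"
definition cop_z :: "hb \<times> hb \<Rightarrow> 'a::field_char_0" where
  "cop_z = hmul2 (\<lambda>pq. (tens (hbas e1) (hbas e1) pq + tens (hbas e1) (hbas ex) pq
                        + tens (hbas ey) (hbas e1) pq - tens (hbas ey) (hbas ex) pq) / 2)
                 (tens (hbas ez) (hbas ez))"

definition cop :: "hb \<Rightarrow> hb \<times> hb \<Rightarrow> 'a::field_char_0" where
  "cop t = (case t of (a, b, c) \<Rightarrow>
     hmul2 (hmul2 (if a then cop_x else cop_one) (if b then cop_y else cop_one))
           (if c then cop_z else cop_one))"

definition cop2 :: "hb \<Rightarrow> hb \<times> hb \<times> hb \<Rightarrow> 'a::field_char_0" where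
  "cop2 t = (\<lambda>(p, q, r). \<Sum>u\<in>UNIV. cop t (u, r) * cop u (p, q))"

text \<open>Antipode: S(x^a y^b z^c) = z^c y^b x^a (S(x)=x, S(y)=y, S(z)=z, S anti-multiplicative).\<close>
definition anti :: "hb \<Rightarrow> hb \<Rightarrow> 'a::field_char_0" where
  "anti t = (case t of (a, b, c) \<Rightarrow>
     hmul (hmul (hbas (if c then ez else e1)) (hbas (if b then ey else e1)))
          (hbas (if a then ex else e1)))"

definition cou :: "hb \<Rightarrow> 'a::field" where "cou t = 1"

definition fjk :: "bool \<Rightarrow> bool \<Rightarrow> hb \<Rightarrow> 'a::field_char_0" where
  "fjk j k = (\<lambda>w. (hmul (\<lambda>u. hbas e1 u + (if j then -1 else 1) * hbas ex u)
                         (\<lambda>u. hbas e1 u + (if k then -1 else 1) * hbas ey u) w) / 4)"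

type_synonym 'a mat = "nat \<Rightarrow> nat \<Rightarrow> 'a"

definition mmul :: "nat \<Rightarrow> 'a::field mat \<Rightarrow> 'a mat \<Rightarrow> 'a mat" where
  "mmul d A B = (\<lambda>i j. \<Sum>k<d. A i k * B k j)"

definition ident :: "'a::field mat" where "ident = (\<lambda>i j. if i = j then 1 else 0)"

definition meq :: "nat \<Rightarrow> 'a mat \<Rightarrow> 'a mat \<Rightarrow> bool" where
  "meq d A B \<longleftrightarrow> (\<forall>i<d. \<forall>j<d. A i j = B i j)"

text \<open>A module structure on K^d: matrices of x, y, z. A comodule structure:
 rho(e_j) = sum_u sum_i  u @ (co u i j) e_i, u ranging over the basis of H8.\<close>

record 'a ydm =
  ydim :: nat
  ax :: "'a mat"
  ay :: "'a mat"
  az :: "'a mat"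
  co :: "hb \<Rightarrow> 'a mat"

definition act :: "'a::field ydm \<Rightarrow> hb \<Rightarrow> 'a mat" where
  "act M t = (case t of (a, b, c) \<Rightarrow>
     mmul (ydim M) (mmul (ydim M) (if a then ax M else ident) (if b then ay M else ident))
          (if c then az M else ident))"

definition is_yd :: "'a::field_char_0 ydm \<Rightarrow> bool" where
  "is_yd M \<longleftrightarrow> (let d = ydim M; X = ax M; Y = ay M; Z = az M in
     meq d (mmul d X X) ident \<and> meq d (mmul d Y Y) ident \<and>
     meq d (mmul d Z Z) (\<lambda>i j. (ident i j + X i j + Y i j - mmul d X Y i j) / 2) \<and>
     meq d (mmul d X Y) (mmul d Y X) \<and>
     meq d (mmul d Z X) (mmul d Y Z) \<and>
     meq d (mmul d Z Y) (mmul d X Z) \<and>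
     \<comment> \<open>counit axiom\<close>
     meq d (\<lambda>i j. \<Sum>u\<in>UNIV. cou u * co M u i j) ident \<and>
     \<comment> \<open>coassociativity\<close>
     (\<forall>p q. meq d (\<lambda>i j. \<Sum>u\<in>UNIV. cop u (p, q) * co M u i j) (mmul d (co M q) (co M p))) \<and>
     \<comment> \<open>Yetter-Drinfeld compatibility, for every basis element t of H8\<close>
     (\<forall>t w. meq d (mmul d (co M w) (act M t))
        (\<lambda>i j. \<Sum>p\<in>UNIV. \<Sum>q\<in>UNIV. \<Sum>r\<in>UNIV. \<Sum>u\<in>UNIV.
            cop2 t (p, q, r) * hmul (hmul (hbas p) (hbas u)) (anti r) w
            * mmul d (act M q) (co M u) i j)))"

text \<open>Braiding c(v@w) = v_(-1).w @ v_(0):  c(e_i@e_j) = sum_{l,k} cb i j l k  e_l@e_k.\<close>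
definition cb :: "'a::field ydm \<Rightarrow> nat \<Rightarrow> nat \<Rightarrow> nat \<Rightarrow> nat \<Rightarrow> 'a" where
  "cb M i j l k = (\<Sum>u\<in>UNIV. co M u k i * act M u l j)"

definition yd_iso :: "'a::field ydm \<Rightarrow> 'a ydm \<Rightarrow> bool" where
  "yd_iso M N \<longleftrightarrow> ydim M = ydim N \<and> (let d = ydim M in \<exists>P Q.
     meq d (mmul d P Q) ident \<and> meq d (mmul d Q P) ident \<and>
     meq d (mmul d P (ax M)) (mmul d (ax N) P) \<and>
     meq d (mmul d P (ay M)) (mmul d (ay N) P) \<and>
     meq d (mmul d P (az M)) (mmul d (az N) P) \<and>
     (\<forall>u. meq d (mmul d P (co M u)) (mmul d (co N u) P)))"

text \<open>A tensor in V^{@n} (V = K^d) is a coefficient function on words of length n over {..<d}.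
 cstep d c k is the braiding c acting on tensor positions k, k+1 (0-based).\<close>

definition cstep :: "nat \<Rightarrow> (nat \<Rightarrow> nat \<Rightarrow> nat \<Rightarrow> nat \<Rightarrow> 'a::field) \<Rightarrow> nat
                     \<Rightarrow> (nat list \<Rightarrow> 'a) \<Rightarrow> nat list \<Rightarrow> 'a" where
  "cstep d c k T = (\<lambda>w. \<Sum>i<d. \<Sum>j<d. T (w[k := i, Suc k := j]) * c i j (w ! k) (w ! Suc k))"

fun cchain :: "nat \<Rightarrow> (nat \<Rightarrow> nat \<Rightarrow> nat \<Rightarrow> nat \<Rightarrow> 'a::field) \<Rightarrow> nat \<Rightarrow> nat
               \<Rightarrow> (nat list \<Rightarrow> 'a) \<Rightarrow> nat list \<Rightarrow> 'a" where
  "cchain d c n 0 = id"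
| "cchain d c n (Suc j) = cchain d c n j \<circ> cstep d c (n - Suc j)"

definition tsum :: "nat \<Rightarrow> (nat \<Rightarrow> nat \<Rightarrow> nat \<Rightarrow> nat \<Rightarrow> 'a::field) \<Rightarrow> nat
                    \<Rightarrow> (nat list \<Rightarrow> 'a) \<Rightarrow> nat list \<Rightarrow> 'a" where
  "tsum d c n T = (\<lambda>w. \<Sum>j\<le>n. cchain d c n j T w)"

text \<open>Quantum symmetrizer: Omega_0 = Omega_1 = id,
 Omega_{n+1} = (Omega_n @ id) o (1 + c_n + c_n c_{n-1} + ... + c_n ... c_1) (1-based).\<close>
fun qsym :: "nat \<Rightarrow> (nat \<Rightarrow> nat \<Rightarrow> nat \<Rightarrow> nat \<Rightarrow> 'a::field) \<Rightarrow> nat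
             \<Rightarrow> (nat list \<Rightarrow> 'a) \<Rightarrow> nat list \<Rightarrow> 'a" where
  "qsym d c 0 = id"
| "qsym d c (Suc n) = qsym d c n \<circ> tsum d c n"

definition words :: "nat \<Rightarrow> nat \<Rightarrow> nat list set" where
  "words n d = {w. length w = n \<and> set w \<subseteq> {..<d}}"

text \<open>B(V) = direct sum of T^n(V)/ker Omega_n; for finite-dim V it is finite-dimensional
 iff Omega_n = 0 for all sufficiently large n.\<close>
definition nichols_fin :: "nat \<Rightarrow> (nat \<Rightarrow> nat \<Rightarrow> nat \<Rightarrow> nat \<Rightarrow> 'a::field) \<Rightarrow> bool" where
  "nichols_fin d c \<longleftrightarrow> (\<exists>N. \<forall>n\<ge>N. \<forall>w\<in>words n d. \<forall>v\<in>words n d.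
      qsym d c n (\<lambda>u. if u = w then 1 else 0) v = 0)"

definition nfin :: "'a::field ydm \<Rightarrow> bool" where
  "nfin M \<longleftrightarrow> nichols_fin (ydim M) (cb M)"

text \<open>Cartan matrix of A1 x ... x A1 (m factors) x A2 x ... x A2 (k factors):
 indices < m are the A1 vertices, then pairs (m+2t, m+2t+1) form the A2 components.\<close>
definition cartanAA :: "nat \<Rightarrow> nat \<Rightarrow> nat \<Rightarrow> int" where
  "cartanAA m i j = (if i = j then 2
      else if m \<le> i \<and> m \<le> j \<and> (i - m) div 2 = (j - m) div 2 then -1 else 0)"

definition diag_cartan :: "nat \<Rightarrow> (nat \<Rightarrow> nat \<Rightarrow> nat \<Rightarrow> nat \<Rightarrow> 'a::field) \<Rightarrow> (nat \<Rightarrow> nat \<Rightarrow> int) \<Rightarrow> bool" where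
  "diag_cartan d c A \<longleftrightarrow> (\<exists>V W q.
     meq d (mmul d V W) ident \<and> meq d (mmul d W V) ident \<and>
     \<comment> \<open>v_i = sum_a V a i e_a is a basis with c(v_i@v_j) = q i j v_j@v_i\<close>
     (\<forall>i<d. \<forall>j<d. \<forall>l<d. \<forall>k<d.
        (\<Sum>a<d. \<Sum>b<d. V a i * V b j * c a b l k) = q i j * V l j * V k i) \<and>
     (\<forall>i<d. q i i \<noteq> 1) \<and>
     (\<forall>i<d. \<forall>j<d. i \<noteq> j \<longrightarrow> q i j * q j i = q i i powi A i j))"

definition cartan_type :: "'a::field ydm \<Rightarrow> nat \<Rightarrow> nat \<Rightarrow> bool" where
  "cartan_type M m k \<longleftrightarrow> ydim M = m + 2 * k \<and> diag_cartan (ydim M) (cb M) (cartanAA m)"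

definition Mb :: "'a::field \<Rightarrow> hb \<Rightarrow> 'a ydm" where
  "Mb b g = \<lparr>ydim = 1, ax = (\<lambda>_ _. b * b), ay = (\<lambda>_ _. b * b), az = (\<lambda>_ _. b),
             co = (\<lambda>u _ _. if u = g then 1 else 0)\<rparr>"

definition Mpair :: "hb \<Rightarrow> hb \<Rightarrow> 'a::field ydm" where
  "Mpair g1 g2 = \<lparr>ydim = 2,
     ax = (\<lambda>i j. if i = j then (if i = 0 then 1 else -1) else 0),
     ay = (\<lambda>i j. if i = j then (if i = 0 then -1 else 1) else 0),
     az = (\<lambda>i j. if i \<noteq> j then 1 else 0),
     co = (\<lambda>u i j. if i = 0 \<and> j = 0 \<and> u = g1 then 1
                  else if i = 1 \<and> j = 1 \<and> u = g2 then 1 else 0)\<rparr>"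

text \<open>W^{b1,b2} (im is the fixed square root of -1); rho(p_j) = sum_i h_ij @ p_i.\<close>
definition Wm :: "'a::field_char_0 \<Rightarrow> 'a \<Rightarrow> 'a \<Rightarrow> 'a ydm" where
  "Wm im b1 b2 = \<lparr>ydim = 2,
     ax = (\<lambda>i j. if i = j then (if i = 0 then 1 else -1) else 0),
     ay = (\<lambda>i j. if i = j then (if i = 0 then 1 else -1) else 0),
     az = (\<lambda>i j. if i = j then (if i = 0 then b2 else - im * b1 * b2) else 0),
     co = (\<lambda>u i j.
        let h = (\<lambda>s. hmul (\<lambda>v. fjk False False v + s * fjk True True v) (hbas ez) u);
            g = (\<lambda>s. hmul (\<lambda>v. fjk True False v + s * fjk False True v) (hbas ez) u) in
        if i = 0 \<and> j = 0 then h (- im * b1)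
        else if i = 1 \<and> j = 1 then h (im * b1)
        else if i = 1 \<and> j = 0 then g (im * b1)
        else if i = 0 \<and> j = 1 then g (- im * b1) else 0)\<rparr>"

definition blk :: "nat \<Rightarrow> 'a::zero mat \<Rightarrow> 'a mat \<Rightarrow> 'a mat" where
  "blk d1 A B = (\<lambda>i j. if i < d1 \<and> j < d1 then A i j
                    else if d1 \<le> i \<and> d1 \<le> j then B (i - d1) (j - d1) else 0)"

definition dsum :: "'a::field ydm \<Rightarrow> 'a ydm \<Rightarrow> 'a ydm" where
  "dsum M N = \<lparr>ydim = ydim M + ydim N,
     ax = blk (ydim M) (ax M) (ax N), ay = blk (ydim M) (ay M) (ay N),
     az = blk (ydim M) (az M) (az N), co = (\<lambda>u. blk (ydim M) (co M u) (co N u))\<rparr>"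

definition yd0 :: "'a::field ydm" where
  "yd0 = \<lparr>ydim = 0, ax = (\<lambda>_ _. 0), ay = (\<lambda>_ _. 0), az = (\<lambda>_ _. 0), co = (\<lambda>_ _ _. 0)\<rparr>"

fun dpow :: "'a::field ydm \<Rightarrow> nat \<Rightarrow> 'a ydm" where
  "dpow M 0 = yd0"
| "dpow M (Suc n) = dsum (dpow M n) M"

definition Omega1 :: "'a::field_char_0 \<Rightarrow> nat \<Rightarrow> nat \<Rightarrow> nat \<Rightarrow> nat \<Rightarrow> 'a ydm" where
  "Omega1 im n1 n2 n3 n4 = dsum (dsum (dsum (dpow (Mb im ex) n1) (dpow (Mb (- im) ex) n2))
                                        (dpow (Mb im ey) n3)) (dpow (Mb (- im) ey) n4)"
definition Omega2 :: "'a::field_char_0 \<Rightarrow> nat \<Rightarrow> nat \<Rightarrow> 'a ydm" where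
  "Omega2 im n1 n2 = dsum (dsum (dpow (Mb im ex) n1) (dpow (Mb (- im) ex) n2)) (Mpair exy ex)"
definition Omega3 :: "'a::field_char_0 \<Rightarrow> nat \<Rightarrow> nat \<Rightarrow> 'a ydm" where
  "Omega3 im n1 n2 = dsum (dsum (dpow (Mb im ey) n1) (dpow (Mb (- im) ey) n2)) (Mpair ey exy)"
definition Omega4 :: "'a::field_char_0 \<Rightarrow> nat \<Rightarrow> nat \<Rightarrow> 'a ydm" where
  "Omega4 im n1 n2 = dsum (dsum (dpow (Mb im ex) n1) (dpow (Mb im ey) n2)) (Wm im 1 (-1))"
definition Omega5 :: "'a::field_char_0 \<Rightarrow> nat \<Rightarrow> nat \<Rightarrow> 'a ydm" where
  "Omega5 im n1 n2 = dsum (dsum (dpow (Mb (- im) ex) n1) (dpow (Mb (- im) ey) n2)) (Wm im (-1) (-1))"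
definition Omega6 :: "'a::field_char_0 ydm" where
  "Omega6 = dsum (Mpair exy ex) (Mpair ey exy)"
definition Omega7 :: "'a::field_char_0 \<Rightarrow> 'a ydm" where
  "Omega7 im = dsum (Wm im 1 (-1)) (Wm im (-1) (-1))"

end

(*
  An infinite-dimensionality criterion drives everything. For a diagonal braiding, let X be a
  homogeneous tensor on which its own degree acts trivially. If a word of skew derivations kills X
  except when applied in full, where it gives a constant c, then this word acts on powers of X as
  c d/dX, so in characteristic 0 no power of X vanishes in the Nichols algebra. Suitable X are a
  vector v with c(v @ v) = v @ v and iterated braided commutators of imaginary degree in types
  affine A1, A2 and A3. Comparing quantum symmetrizers along linear maps that may depend on the
  tensor position also covers a two-dimensional simple module of non-diagonal type.

  A Yetter-Drinfeld module over H8 is a module over the Drinfeld double, which is a sum of matrix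
  algebras. Splitting the identity into the corresponding idempotents, the criterion annihilates all
  of them except those of eight simple modules, and excludes most pairs of these.
*)

theory Submission
  imports Defs
begin

section \<open>Naturality of quantum symmetrizers\<close>

text \<open>The matrices of a \<open>ydm\<close> carry meaning only below \<open>ydim\<close>. All
  operators are therefore moved into one ring of finitely supported matrices, where maps between
  modules of different dimension compose freely and direct summands become idempotents. The
  idempotents are the products of two commuting families: the projections \<open>G a b\<close> to
  the group-like degrees together with the unit \<open>K\<close> of the remaining matrix block, and
  the projections \<open>fb a b\<close> to the joint eigenspaces of x and y. Of these twenty
  products most vanish because a vector in their image would braid trivially with itself. Two
  products with \<open>K\<close> have no such vector and need the position-dependent comparison. In
  the surviving modules every basis vector has self-braiding -1, and any two distinct ones satisfy
  q_ij q_ji = -1 or 1. A forbidden pair of modules thus shows up as a closed diagram, a triangle or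
  a 4-cycle, and the commutator running once around it has imaginary degree. Pairs of an
  \<open>Mpair\<close> and a \<open>Wm\<close> are not of diagonal type in this way; they are the
  ones covered by the assumption.\<close>

lemma qsym_rel:
  assumes add: "\<And>(f::nat \<Rightarrow> nat list \<Rightarrow> 'a::field) (g::nat \<Rightarrow> nat list \<Rightarrow> 'a) n. (\<And>j. j \<le> n \<Longrightarrow> R (f j) (g j)) \<Longrightarrow>
      R (\<lambda>w. \<Sum>j\<le>n. f j w) (\<lambda>w. \<Sum>j\<le>n. g j w)"
    and step: "\<And>k T T'. Suc k < N \<Longrightarrow> R T T' \<Longrightarrow> R (cstep d c k T) (cstep d' c' k T')"
  shows "n \<le> N \<Longrightarrow> R T T' \<Longrightarrow> R (qsym d c n T) (qsym d' c' n T')"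
proof (induction n arbitrary: T T')
  case 0
  then show ?case by simp
next
  case (Suc n)
  \<comment> \<open>\<open>R\<close> will be agreement on words, naturality under
    \<open>tmap\<close>, or the fixing of a last letter. The braidings in the chains of level
    \<open>n\<close> sit at positions \<open>k\<close> with \<open>Suc k \<le> n < N\<close>, so
    \<open>step\<close> is applicable.\<close>
  have chain: "j \<le> n \<Longrightarrow> R T T' \<Longrightarrow> R (cchain d c n j T) (cchain d' c' n j T')" for j T T'
  proof (induction j arbitrary: T T')
    case (Suc j)
    have "R (cstep d c (n - Suc j) T) (cstep d' c' (n - Suc j) T')"
      by (rule step) (use Suc.prems \<open>Suc n \<le> N\<close> in auto)
    then show ?case using Suc by simp
  qed simp
  have "R (tsum d c n T) (tsum d' c' n T')"
    unfolding tsum_def by (rule add) (use chain Suc.prems in auto)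
  then show ?case using Suc by simp
qed

lemma cstep_0_Cons [simp]:
  "cstep d c 0 T (x # y # w) = (\<Sum>i<d. \<Sum>j<d. T (i # j # w) * c i j x y)"
  by (simp add: cstep_def)

lemma cstep_Suc_Cons [simp]:
  "cstep d c (Suc k) T (x # w) = cstep d c k (\<lambda>u. T (x # u)) w"
  by (simp add: cstep_def)

lemma words_iff: "w \<in> words n d \<longleftrightarrow> length w = n \<and> set w \<subseteq> {..<d}"
  by (simp add: words_def)

lemma finite_words: "finite (words n d)"
  unfolding words_def using finite_lists_length_eq[of "{..<d}" n] by (simp add: conj_commute)

lemma cstep_words_cong:
  assumes "\<And>w. w \<in> words n d \<Longrightarrow> T w = T' w" "w \<in> words n d" "Suc k < n"
  shows "cstep d c k T w = cstep d c k T' w"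
  unfolding cstep_def
proof (intro sum.cong refl arg_cong2[where f = times])
  fix i j assume "i \<in> {..<d}" "j \<in> {..<d}"
  then have "w[k := i, Suc k := j] \<in> words n d"
    using assms(2) set_update_subset_insert[of w k i]
      set_update_subset_insert[of "w[k := i]" "Suc k" j]
    by (auto simp: words_iff)
  then show "T (w[k := i, Suc k := j]) = T' (w[k := i, Suc k := j])" by (rule assms(1))
qed

text \<open>Braiding steps only overwrite letters by indices below \<open>d\<close> and keep the
  length, so values of a coefficient function outside \<open>words n d\<close> never enter.\<close>

lemma qsym_words_cong:
  assumes "\<And>w. w \<in> words n d \<Longrightarrow> T w = T' w" "w \<in> words n d"
  shows "qsym d c n T w = qsym d c n T' w"
  using qsym_rel[where R = "\<lambda>T T'. \<forall>w\<in>words n d. T w = T' w" and N = n and n = n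
      and d = d and d' = d and c = c and c' = c and T = T and T' = T'] assms
  by (auto intro!: sum.cong cstep_words_cong[where n = n])

lemma qsym_sum_scale:
  assumes "finite I"
  shows "qsym d c n (\<lambda>v. \<Sum>w\<in>I. a w * f w v) = (\<lambda>v. \<Sum>w\<in>I. a w * qsym d c n (f w) v)"
proof -
  define R where "R = (\<lambda>F T. T = (\<lambda>v. \<Sum>w\<in>I. a w * F w v))"
  have tl: "cstep d c k (\<lambda>v. \<Sum>w\<in>I. a w * f w v) = (\<lambda>v. \<Sum>w\<in>I. a w * cstep d c k (f w) v)" for k f
  proof
    fix v
    have "cstep d c k (\<lambda>v. \<Sum>w\<in>I. a w * f w v) v
        = (\<Sum>i<d. \<Sum>j<d. \<Sum>w\<in>I. a w * (f w (v[k := i, Suc k := j]) * c i j (v ! k) (v ! Suc k)))"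
      by (simp add: cstep_def sum_distrib_right mult.assoc)
    also have "\<dots> = (\<Sum>w\<in>I. \<Sum>i<d. \<Sum>j<d. a w * (f w (v[k := i, Suc k := j]) * c i j (v ! k) (v ! Suc k)))"
      by (subst sum.swap[of _ I], subst sum.swap[of _ I]) simp
    finally show "cstep d c k (\<lambda>v. \<Sum>w\<in>I. a w * f w v) v = (\<Sum>w\<in>I. a w * cstep d c k (f w) v)"
      by (simp add: cstep_def sum_distrib_left)
  qed
  have chain: "cchain d c m j (\<lambda>v. \<Sum>w\<in>I. a w * f w v) = (\<lambda>v. \<Sum>w\<in>I. a w * cchain d c m j (f w) v)" for m j f
    by (induction j arbitrary: f) (simp_all add: tl)
  have ts: "tsum d c m (\<lambda>v. \<Sum>w\<in>I. a w * f w v) = (\<lambda>v. \<Sum>w\<in>I. a w * tsum d c m (f w) v)" for m f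
    unfolding tsum_def chain by (subst sum.swap) (simp add: sum_distrib_left)
  show ?thesis
    by (induction n arbitrary: f) (simp_all add: ts)
qed

lemma qsym_scale: "qsym d c n (\<lambda>v. a * T v) = (\<lambda>v. a * qsym d c n T v)"
  using qsym_sum_scale[of "{()}" d c n "\<lambda>_. a" "\<lambda>_. T"] by simp

text \<open>By linearity the basis tensors of the definition can be replaced by arbitrary
  coefficient functions, the form in which finiteness is transferred and refuted.\<close>

lemma nichols_fin_qsym:
  "nichols_fin d c \<longleftrightarrow> (\<exists>N. \<forall>n\<ge>N. \<forall>T. \<forall>v\<in>words n d. qsym d c n T v = 0)"
proof -
  have "qsym d c n T v = 0"
    if "\<forall>w\<in>words n d. \<forall>v\<in>words n d. qsym d c n (\<lambda>u. if u = w then 1 else 0) v = 0" "v \<in> words n d" for n T v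
  proof -
    have "qsym d c n T v = qsym d c n (\<lambda>v. \<Sum>w\<in>words n d. T w * (if v = w then 1 else 0)) v"
      by (rule qsym_words_cong) (use that finite_words in \<open>auto simp: if_distrib cong: if_cong\<close>)
    also have "\<dots> = 0"
      using that by (simp add: qsym_sum_scale[OF finite_words])
    finally show ?thesis .
  qed
  then show ?thesis unfolding nichols_fin_def by blast
qed

text \<open>The tensor product of linear maps, the \<open>t\<close>-th factor having matrix \<open>P t\<close>. Allowing
  the map to depend on the position makes the comparison of braidings below cover twists.\<close>

fun tmap :: "nat \<Rightarrow> (nat \<Rightarrow> nat \<Rightarrow> nat \<Rightarrow> 'a::field) \<Rightarrow> (nat list \<Rightarrow> 'a) \<Rightarrow> nat list \<Rightarrow> 'a" where
  "tmap d P T [] = T []"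
| "tmap d P T (x # w) = (\<Sum>i<d. P 0 x i * tmap d (\<lambda>t. P (Suc t)) (\<lambda>u. T (i # u)) w)"

lemma tmap_sum_scale:
  "finite I \<Longrightarrow> tmap d P (\<lambda>v. \<Sum>i\<in>I. f i v * a i) w = (\<Sum>i\<in>I. tmap d P (f i) w * a i)"
proof (induction w arbitrary: P f)
  case (Cons x w)
  have "tmap d P (\<lambda>v. \<Sum>i\<in>I. f i v * a i) (x # w)
     = (\<Sum>j<d. \<Sum>i\<in>I. P 0 x j * tmap d (\<lambda>t. P (Suc t)) (\<lambda>u. f i (j # u)) w * a i)"
    using Cons by (simp add: sum_distrib_left mult.assoc)
  also have "\<dots> = (\<Sum>i\<in>I. tmap d P (f i) (x # w) * a i)"
    by (subst sum.swap) (simp add: sum_distrib_right)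
  finally show ?case .
qed simp

lemma tmap_sum: "finite I \<Longrightarrow> tmap d P (\<lambda>v. \<Sum>i\<in>I. f i v) w = (\<Sum>i\<in>I. tmap d P (f i) w)"
  using tmap_sum_scale[of I d P f "\<lambda>_. 1"] by simp

lemma tmap_scale: "tmap d P (\<lambda>v. f v * a) w = tmap d P f w * a"
  using tmap_sum_scale[of "{()}" d P "\<lambda>_. f" "\<lambda>_. a"] by simp

lemma tmap_cong:
  "(\<And>u. u \<in> words (length w) d \<Longrightarrow> T u = T' u) \<Longrightarrow> tmap d P T w = tmap d P T' w"
proof (induction w arbitrary: P T T')
  case (Cons x w)
  have "tmap d (\<lambda>t. P (Suc t)) (\<lambda>u. T (i # u)) w = tmap d (\<lambda>t. P (Suc t)) (\<lambda>u. T' (i # u)) w" if "i < d" for i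
    by (rule Cons.IH) (use that Cons.prems in \<open>auto simp: words_iff\<close>)
  then show ?case by simp
qed (simp add: words_iff)

text \<open>\<open>compat\<close> says that the maps at two neighbouring positions together
  intertwine \<open>c\<close> with \<open>c'\<close>. It is required at every \<open>t\<close>
  because the induction shifts \<open>P\<close> along with the word.\<close>

lemma tmap_cstep:
  assumes compat: "\<And>t a b x y. a < d \<Longrightarrow> b < d \<Longrightarrow> x < d' \<Longrightarrow> y < d' \<Longrightarrow>
     (\<Sum>i<d. \<Sum>j<d. P t x i * P (Suc t) y j * c a b i j)
      = (\<Sum>i<d'. \<Sum>j<d'. P t i a * P (Suc t) j b * c' i j x y)"
  shows "w \<in> words n d' \<Longrightarrow> Suc k < n \<Longrightarrow> tmap d P (cstep d c k T) w = cstep d' c' k (tmap d P T) w"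
  using compat
proof (induction k arbitrary: w n P T)
  case 0
  then obtain x y u where w: "w = x # y # u"
    by (cases w; cases "tl w") (auto simp: words_iff)
  then have xy: "x < d'" "y < d'" using 0 by (auto simp: words_iff)
  let ?P = "\<lambda>t. P (Suc (Suc t))"
  have "tmap d P (cstep d c 0 T) w = (\<Sum>i<d. \<Sum>j<d. \<Sum>a<d. \<Sum>b<d.
          P 0 x i * P (Suc 0) y j * c a b i j * tmap d ?P (\<lambda>u. T (a # b # u)) u)"
    by (simp add: w tmap_sum tmap_scale) (simp add: sum_distrib_left mult_ac)
  also have "\<dots> = (\<Sum>i<d. \<Sum>a<d. \<Sum>j<d. \<Sum>b<d.
          P 0 x i * P (Suc 0) y j * c a b i j * tmap d ?P (\<lambda>u. T (a # b # u)) u)"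
    by (intro sum.cong refl sum.swap)
  also have "\<dots> = (\<Sum>a<d. \<Sum>i<d. \<Sum>b<d. \<Sum>j<d.
          P 0 x i * P (Suc 0) y j * c a b i j * tmap d ?P (\<lambda>u. T (a # b # u)) u)"
    by (subst sum.swap) (intro sum.cong refl sum.swap)
  also have "\<dots> = (\<Sum>a<d. \<Sum>b<d. (\<Sum>i<d. \<Sum>j<d. P 0 x i * P (Suc 0) y j * c a b i j)
         * tmap d ?P (\<lambda>u. T (a # b # u)) u)"
    by (subst (2) sum.swap) (simp add: sum_distrib_right)
  also have "\<dots> = (\<Sum>a<d. \<Sum>b<d. (\<Sum>i<d'. \<Sum>j<d'. P 0 i a * P (Suc 0) j b * c' i j x y)
         * tmap d ?P (\<lambda>u. T (a # b # u)) u)"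
    using 0(3)[of _ _ x y 0] xy by (intro sum.cong[OF refl]) simp
  also have "\<dots> = (\<Sum>a<d. \<Sum>b<d. \<Sum>i<d'. \<Sum>j<d'. P 0 i a * P (Suc 0) j b * c' i j x y
         * tmap d ?P (\<lambda>u. T (a # b # u)) u)"
    by (simp add: sum_distrib_right)
  also have "\<dots> = (\<Sum>a<d. \<Sum>i<d'. \<Sum>b<d. \<Sum>j<d'. P 0 i a * P (Suc 0) j b * c' i j x y
         * tmap d ?P (\<lambda>u. T (a # b # u)) u)"
    by (intro sum.cong refl sum.swap)
  also have "\<dots> = (\<Sum>i<d'. \<Sum>a<d. \<Sum>j<d'. \<Sum>b<d. P 0 i a * P (Suc 0) j b * c' i j x y
         * tmap d ?P (\<lambda>u. T (a # b # u)) u)"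
    by (subst sum.swap) (intro sum.cong refl sum.swap)
  also have "\<dots> = (\<Sum>i<d'. \<Sum>j<d'. \<Sum>a<d. \<Sum>b<d. P 0 i a * P (Suc 0) j b * c' i j x y
         * tmap d ?P (\<lambda>u. T (a # b # u)) u)"
    by (intro sum.cong refl sum.swap)
  also have "\<dots> = cstep d' c' 0 (tmap d P T) w"
    by (simp add: w sum_distrib_left sum_distrib_right mult_ac)
  finally show ?case .
next
  case (Suc k)
  then obtain x u where w: "w = x # u" by (cases w) (auto simp: words_iff)
  have "tmap d (\<lambda>t. P (Suc t)) (cstep d c k (\<lambda>u. T (i # u))) u
      = cstep d' c' k (tmap d (\<lambda>t. P (Suc t)) (\<lambda>u. T (i # u))) u" for i
    by (rule Suc.IH[where n = "n - 1"]) (use Suc w in \<open>auto simp: words_iff\<close>)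
  moreover have "cstep d' c' k (\<lambda>v. \<Sum>i<d. P 0 x i * f i v) u
      = (\<Sum>i<d. P 0 x i * cstep d' c' k (f i) u)" for f :: "nat \<Rightarrow> nat list \<Rightarrow> 'a"
  proof -
    have "cstep d' c' k (\<lambda>v. \<Sum>i<d. P 0 x i * f i v) u = (\<Sum>a<d'. \<Sum>b<d'. \<Sum>i<d.
       P 0 x i * (f i (u[k := a, Suc k := b]) * c' a b (u ! k) (u ! Suc k)))"
      by (simp add: cstep_def sum_distrib_right mult.assoc)
    also have "\<dots> = (\<Sum>i<d. \<Sum>a<d'. \<Sum>b<d'.
       P 0 x i * (f i (u[k := a, Suc k := b]) * c' a b (u ! k) (u ! Suc k)))"
      by (subst sum.swap[of _ "{..<d}"], subst sum.swap[of _ "{..<d}"]) simp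
    finally show ?thesis by (simp add: cstep_def sum_distrib_left)
  qed
  ultimately show ?case by (simp add: w)
qed

lemma qsym_tmap:
  assumes compat: "\<And>t a b x y. a < d \<Longrightarrow> b < d \<Longrightarrow> x < d' \<Longrightarrow> y < d' \<Longrightarrow>
     (\<Sum>i<d. \<Sum>j<d. P t x i * P (Suc t) y j * c a b i j)
      = (\<Sum>i<d'. \<Sum>j<d'. P t i a * P (Suc t) j b * c' i j x y)"
    and w: "w \<in> words n d'"
  shows "tmap d P (qsym d c n T) w = qsym d' c' n (tmap d P T) w"
proof -
  have "\<forall>w\<in>words n d'. qsym d' c' n (tmap d P T) w = tmap d P (qsym d c n T) w"
  proof (rule qsym_rel[where R = "\<lambda>T' T. \<forall>w\<in>words n d'. T' w = tmap d P T w" and N = n])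
    show "\<forall>w\<in>words n d'. cstep d' c' k T' w = tmap d P (cstep d c k T) w"
      if "Suc k < n" "\<forall>w\<in>words n d'. T' w = tmap d P T w" for k T T'
    proof
      fix w assume w: "w \<in> words n d'"
      have "cstep d' c' k T' w = cstep d' c' k (tmap d P T) w"
        using that w by (intro cstep_words_cong) auto
      then show "cstep d' c' k T' w = tmap d P (cstep d c k T) w"
        using tmap_cstep[where P = P and c = c and c' = c', OF _ w that(1)] compat by simp
    qed
    show "\<forall>w\<in>words n d'. (\<Sum>j\<le>m. f j w) = tmap d P (\<lambda>w. \<Sum>j\<le>m. g j w) w"
      if "\<And>j. j \<le> m \<Longrightarrow> \<forall>w\<in>words n d'. f j w = tmap d P (g j) w" for f g and m :: nat
      using that by (simp add: tmap_sum)
  qed auto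
  then show ?thesis using w by simp
qed

lemma tmap_left_inverse:
  assumes "\<And>t i j. i < d \<Longrightarrow> j < d \<Longrightarrow> (\<Sum>x<d'. Q t i x * P t x j) = (if i = j then 1 else 0)"
  shows "w \<in> words n d \<Longrightarrow> tmap d' Q (tmap d P T) w = T w"
  using assms
proof (induction w arbitrary: n P Q T)
  case (Cons i w)
  let ?P = "\<lambda>t. P (Suc t)" and ?Q = "\<lambda>t. Q (Suc t)"
  have i: "i < d" and w: "w \<in> words (n - 1) d" using Cons.prems by (auto simp: words_iff)
  have IH: "tmap d' ?Q (tmap d ?P (\<lambda>u. T (j # u))) w = T (j # w)" for j
    by (rule Cons.IH[OF w]) (use Cons.prems in auto)
  have lin: "tmap d' ?Q (\<lambda>v. \<Sum>j<d. P 0 x j * f j v) w = (\<Sum>j<d. P 0 x j * tmap d' ?Q (f j) w)" for x f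
    using tmap_sum_scale[of "{..<d}" d' ?Q f "P 0 x"] by (simp add: mult.commute)
  have "tmap d' Q (tmap d P T) (i # w) = (\<Sum>x<d'. \<Sum>j<d. Q 0 i x * P 0 x j * T (j # w))"
    by (simp add: lin IH sum_distrib_left mult.assoc)
  also have "\<dots> = (\<Sum>j<d. (\<Sum>x<d'. Q 0 i x * P 0 x j) * T (j # w))"
    by (subst sum.swap) (simp add: sum_distrib_right)
  also have "\<dots> = (\<Sum>j<d. if i = j then T (j # w) else 0)"
    using Cons.prems(2)[of i _ 0] i by (intro sum.cong) auto
  finally show ?case using i by simp
qed simp

text \<open>Left inverses at all positions make the tensor map injective, so vanishing symmetrizers
  of \<open>c'\<close> force those of \<open>c\<close> to vanish. For constant \<open>P\<close> this
  is the passage to a braided subspace.\<close>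

lemma nichols_fin_embed:
  assumes fin: "nichols_fin d' c'"
    and compat: "\<And>t a b x y. a < d \<Longrightarrow> b < d \<Longrightarrow> x < d' \<Longrightarrow> y < d' \<Longrightarrow>
     (\<Sum>i<d. \<Sum>j<d. P t x i * P (Suc t) y j * c a b i j)
      = (\<Sum>i<d'. \<Sum>j<d'. P t i a * P (Suc t) j b * c' i j x y)"
    and inv: "\<And>t i j. i < d \<Longrightarrow> j < d \<Longrightarrow> (\<Sum>x<d'. Q t i x * P t x j) = (if i = j then 1 else 0)"
  shows "nichols_fin d c"
proof -
  obtain N where N: "\<And>n T v. n \<ge> N \<Longrightarrow> v \<in> words n d' \<Longrightarrow> qsym d' c' n T v = 0"
    using fin by (auto simp: nichols_fin_qsym)
  have "qsym d c n T v = 0" if "n \<ge> N" "v \<in> words n d" for n T v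
  proof -
    have z: "tmap d P (qsym d c n T) w = 0" if "w \<in> words n d'" for w
      using qsym_tmap[where P = P and c = c and c' = c' and T = T, OF _ that] compat
        N[OF \<open>n \<ge> N\<close> that] by simp
    have "qsym d c n T v = tmap d' Q (tmap d P (qsym d c n T)) v"
      using tmap_left_inverse[OF inv that(2)] by simp
    also have "\<dots> = tmap d' Q (\<lambda>_. 0) v"
      by (rule tmap_cong) (use that z in \<open>auto simp: words_iff\<close>)
    also have "\<dots> = 0" using tmap_sum[of "{}" d' Q "\<lambda>_ _. 0"] by simp
    finally show ?thesis .
  qed
  then show ?thesis by (auto simp: nichols_fin_qsym)
qed

section \<open>Diagonal braidings with infinite-dimensional Nichols algebra\<close>

definition diagc :: "(nat \<Rightarrow> nat \<Rightarrow> 'a::field) \<Rightarrow> nat \<Rightarrow> nat \<Rightarrow> nat \<Rightarrow> nat \<Rightarrow> 'a" where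
  "diagc q = (\<lambda>i j l k. if l = j \<and> k = i then q i j else 0)"

text \<open>\<open>skew q a\<close> is the skew derivation that removes a letter \<open>a\<close> after moving it to the right end.\<close>

fun skew :: "(nat \<Rightarrow> nat \<Rightarrow> 'a::field) \<Rightarrow> nat \<Rightarrow> (nat list \<Rightarrow> 'a) \<Rightarrow> nat list \<Rightarrow> 'a" where
  "skew q a T [] = T [a]"
| "skew q a T (x # v) = T (a # x # v) * prod_list (map (q a) (x # v)) + skew q a (\<lambda>w. T (x # w)) v"

lemma cstep_diag_0:
  assumes "x < d" "y < d"
  shows "cstep d (diagc q) 0 T (x # y # w) = T (y # x # w) * q y x"
proof -
  have "cstep d (diagc q) 0 T (x # y # w) = (\<Sum>i<d. \<Sum>j<d. T (i # j # w) * diagc q i j x y)" by simp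
  also have "\<dots> = (\<Sum>i<d. if i = y then T (y # x # w) * q y x else 0)"
  proof (rule sum.cong[OF refl])
    fix i
    have "(\<Sum>j<d. T (i # j # w) * diagc q i j x y)
        = (\<Sum>j<d. if j = x then (if i = y then T (y # x # w) * q y x else 0) else 0)"
      by (rule sum.cong) (auto simp: diagc_def)
    then show "(\<Sum>j<d. T (i # j # w) * diagc q i j x y) = (if i = y then T (y # x # w) * q y x else 0)"
      using assms by simp
  qed
  finally show ?thesis using assms by simp
qed

lemma cchain_Suc_Cons:
  "j \<le> n \<Longrightarrow> cchain d c (Suc n) j T (x # w) = cchain d c n j (\<lambda>u. T (x # u)) w"
proof (induction j arbitrary: T)
  case (Suc j)
  then have "Suc n - Suc j = Suc (n - Suc j)" by simp
  then show ?case using Suc by simp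
qed simp

text \<open>In the full chain the first letter travels to the very end and collects
  \<open>q a y\<close> for each letter \<open>y\<close> that it passes.\<close>

lemma cchain_diag_full:
  "a < d \<Longrightarrow> set v \<subseteq> {..<d} \<Longrightarrow>
    cchain d (diagc q) (length v) (length v) T (v @ [a]) = T (a # v) * prod_list (map (q a) v)"
proof (induction v arbitrary: T)
  case (Cons y v)
  have "cchain d (diagc q) (length (y # v)) (length (y # v)) T (y # v @ [a])
      = cchain d (diagc q) (length v) (length v) (\<lambda>u. cstep d (diagc q) 0 T (y # u)) (v @ [a])"
    by (simp add: cchain_Suc_Cons del: cchain.simps(2) add: cchain.simps(2)[of _ _ "Suc (length v)" "length v"])
  also have "\<dots> = cstep d (diagc q) 0 T (y # a # v) * prod_list (map (q a) v)"
    using Cons by simp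
  finally show ?case using Cons.prems by (simp add: cstep_diag_0 mult_ac del: cstep_0_Cons)
qed simp

text \<open>The \<open>j\<close>-th summand drags a letter over the last \<open>j\<close> letters.
  At a word ending in \<open>a\<close> the sum therefore runs over all places from which an
  \<open>a\<close> can be removed, which is the skew derivation.\<close>

lemma tsum_diag:
  "a < d \<Longrightarrow> set v \<subseteq> {..<d} \<Longrightarrow> tsum d (diagc q) (length v) T (v @ [a]) = skew q a T v"
proof (induction v arbitrary: T)
  case (Cons y v)
  have "tsum d (diagc q) (length (y # v)) T ((y # v) @ [a])
     = (\<Sum>j\<le>length v. cchain d (diagc q) (length v) j (\<lambda>u. T (y # u)) (v @ [a]))
       + cchain d (diagc q) (length (y # v)) (length (y # v)) T ((y # v) @ [a])"
    by (simp add: tsum_def cchain_Suc_Cons del: cchain.simps(2))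
  also have "\<dots> = skew q a (\<lambda>u. T (y # u)) v + T (a # y # v) * prod_list (map (q a) (y # v))"
    using Cons cchain_diag_full[of a d "y # v" q T] by (simp add: tsum_def del: cchain.simps(2))
  finally show ?case by simp
qed (simp add: tsum_def)

section \<open>Symmetrizers as iterated skew derivations\<close>

lemma cstep_append:
  "Suc k < length w \<Longrightarrow> cstep d c k T (w @ [a]) = cstep d c k (\<lambda>u. T (u @ [a])) w"
  by (simp add: cstep_def nth_append list_update_append)

lemma qsym_append:
  assumes "length w = n"
  shows "qsym d c n T (w @ [a]) = qsym d c n (\<lambda>u. T (u @ [a])) w"
proof -
  have "\<forall>w. length w = n \<longrightarrow> qsym d c n T (w @ [a]) = qsym d c n (\<lambda>u. T (u @ [a])) w"
  proof (rule qsym_rel[where R = "\<lambda>T T'. \<forall>w. length w = n \<longrightarrow> T (w @ [a]) = T' w" and N = n])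
    show "\<forall>w. length w = n \<longrightarrow> cstep d c k T (w @ [a]) = cstep d c k T' w"
      if "Suc k < n" "\<forall>w. length w = n \<longrightarrow> T (w @ [a]) = T' w" for k T T'
      using that by (auto simp: cstep_append) (simp add: cstep_def)
  qed auto
  then show ?thesis using assms by blast
qed

text \<open>The inner symmetrizer never touches the last letter. Fixing that letter turns the
  recursion of \<open>qsym\<close> into a recursion along skew derivations.\<close>

lemma qsym_Suc_diag:
  assumes "v \<in> words n d" "a < d"
  shows "qsym d (diagc q) (Suc n) T (v @ [a]) = qsym d (diagc q) n (skew q a T) v"
proof -
  have "qsym d (diagc q) (Suc n) T (v @ [a]) = qsym d (diagc q) n (\<lambda>u. tsum d (diagc q) n T (u @ [a])) v"
    using assms by (simp add: qsym_append words_iff)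
  also have "\<dots> = qsym d (diagc q) n (skew q a T) v"
    by (rule qsym_words_cong) (use assms tsum_diag in \<open>auto simp: words_iff\<close>)
  finally show ?thesis .
qed

fun skews :: "(nat \<Rightarrow> nat \<Rightarrow> 'a::field) \<Rightarrow> nat list \<Rightarrow> (nat list \<Rightarrow> 'a) \<Rightarrow> nat list \<Rightarrow> 'a" where
  "skews q [] T = T"
| "skews q (a # r) T = skews q r (skew q a T)"

lemma qsym_skews:
  "set r \<subseteq> {..<d} \<Longrightarrow> v \<in> words n d \<Longrightarrow>
    qsym d (diagc q) (n + length r) T (v @ rev r) = qsym d (diagc q) n (skews q r T) v"
proof (induction r arbitrary: T)
  case (Cons a r)
  have "qsym d (diagc q) (Suc (n + length r)) T ((v @ rev r) @ [a])
      = qsym d (diagc q) (n + length r) (skew q a T) (v @ rev r)"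
    by (rule qsym_Suc_diag) (use Cons.prems in \<open>auto simp: words_iff\<close>)
  then show ?case using Cons by simp
qed simp

text \<open>The product in the tensor algebra when \<open>S\<close> is homogeneous of degree
  \<open>n\<close>. The splitting position is an argument because a coefficient function does not
  record its degree.\<close>

definition cat :: "nat \<Rightarrow> (nat list \<Rightarrow> 'a::field) \<Rightarrow> (nat list \<Rightarrow> 'a) \<Rightarrow> nat list \<Rightarrow> 'a" where
  "cat n S T = (\<lambda>w. S (take n w) * T (drop n w))"

lemma cat_simps [simp]:
  "cat 0 S T w = S [] * T w"
  "cat (Suc n) S T [] = S [] * T []"
  "cat (Suc n) S T (x # w) = cat n (\<lambda>u. S (x # u)) T w"
  by (simp_all add: cat_def)

text \<open>The twisted Leibniz rule: a letter taken out of the left factor must pass the whole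
  right factor. After losing that letter the left factor has degree \<open>n\<close>, whence
  \<open>drop n v\<close>.\<close>

lemma skew_cat:
  "(\<And>w. S w \<noteq> 0 \<Longrightarrow> length w = Suc n) \<Longrightarrow>
    skew q a (cat (Suc n) S T) v
     = prod_list (map (q a) (drop n v)) * cat n (skew q a S) T v + cat (Suc n) S (skew q a T) v"
proof (induction n arbitrary: S v)
  case 0
  have "S [] = 0" using 0[of "[]"] by auto
  have "skew q a (\<lambda>w. S [y] * T w) u = S [y] * skew q a T u" for y u
    by (induction u arbitrary: T) (simp_all add: algebra_simps)
  then show ?case using \<open>S [] = 0\<close> by (cases v) (simp_all add: mult_ac)
next
  case (Suc n)
  show ?case
  proof (cases v)
    case Nil
    have "S [a] = 0" "S [] = 0" using Suc.prems[of "[a]"] Suc.prems[of "[]"] by auto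
    with Nil show ?thesis by simp
  next
    case (Cons y u)
    have IH: "skew q a (cat (Suc n) (\<lambda>u. S (y # u)) T) u = prod_list (map (q a) (drop n u)) *
        cat n (skew q a (\<lambda>u. S (y # u))) T u + cat (Suc n) (\<lambda>u. S (y # u)) (skew q a T) u"
      by (rule Suc.IH) (use Suc.prems in force)
    have "prod_list (map (q a) u) = prod_list (map (q a) (take n u)) * prod_list (map (q a) (drop n u))"
      by (metis append_take_drop_id map_append prod_list.append)
    then show ?thesis using IH by (simp add: Cons cat_def algebra_simps)
  qed
qed

lemma skew_zero: "(\<And>w. length w = Suc (length v) \<Longrightarrow> T w = 0) \<Longrightarrow> skew q a T v = 0"
  by (induction v arbitrary: T) simp_all

lemma skew_linear:
  "skew q a (\<lambda>v. \<kappa> * f v + g v) = (\<lambda>v. \<kappa> * skew q a f v + skew q a g v)"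
proof
  show "skew q a (\<lambda>v. \<kappa> * f v + g v) v = \<kappa> * skew q a f v + skew q a g v" for v
    by (induction v arbitrary: f g) (simp_all add: algebra_simps)
qed

fun pw :: "nat \<Rightarrow> (nat list \<Rightarrow> 'a::field) \<Rightarrow> nat \<Rightarrow> nat list \<Rightarrow> 'a" where
  "pw n X 0 = (\<lambda>w. if w = [] then 1 else 0)"
| "pw n X (Suc m) = cat n X (pw n X m)"

text \<open>Since the derivations in \<open>rs\<close> kill \<open>X\<close>, the ones in \<open>z # rs\<close> must all hit the same factor of a
  power of \<open>X\<close>; by \<open>one\<close> each factor contributes the same constant.\<close>

lemma not_nichols_fin_diag:
  fixes q :: "nat \<Rightarrow> nat \<Rightarrow> 'a::field_char_0" and X :: "nat list \<Rightarrow> 'a"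
  assumes hom: "\<And>w. X w \<noteq> 0 \<Longrightarrow> length w = Suc (length rs)"
    and r: "set (z # rs) \<subseteq> {..<d}"
    and chi: "\<And>a w. a \<in> set (z # rs) \<Longrightarrow> X w \<noteq> 0 \<Longrightarrow> prod_list (map (q a) w) = \<chi> a"
    and kill: "\<And>a v. a \<in> set rs \<Longrightarrow> skew q a X v = 0"
    and top: "skews q (z # rs) X [] \<noteq> 0"
    and one: "prod_list (map \<chi> (z # rs)) = 1"
  shows "\<not> nichols_fin d (diagc q)"
proof -
  let ?n = "Suc (length rs)"
  have chip: "prod_list (map (q a) w) = \<chi> a ^ m" if "a \<in> set (z # rs)" "pw ?n X m w \<noteq> 0" for a m w
    using that(2)
  proof (induction m arbitrary: w)
    case (Suc m)
    then have "X (take ?n w) \<noteq> 0" "pw ?n X m (drop ?n w) \<noteq> 0" by (auto simp: cat_def)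
    then have "prod_list (map (q a) (take ?n w)) * prod_list (map (q a) (drop ?n w)) = \<chi> a ^ Suc m"
      using Suc.IH chi that(1) by simp
    then show ?case by (metis append_take_drop_id map_append prod_list.append)
  qed (auto split: if_splits)
  have step1: "skew q a (cat (Suc k) Y (pw ?n X m)) = (\<lambda>v. \<chi> a ^ m * cat k (skew q a Y) (pw ?n X m) v
      + cat (Suc k) Y (skew q a (pw ?n X m)) v)"
    if "a \<in> set (z # rs)" "\<And>w. Y w \<noteq> 0 \<Longrightarrow> length w = Suc k" for a k m Y
  proof
    fix v
    show "skew q a (cat (Suc k) Y (pw ?n X m)) v = \<chi> a ^ m * cat k (skew q a Y) (pw ?n X m) v
      + cat (Suc k) Y (skew q a (pw ?n X m)) v"
      using skew_cat[of Y k q a "pw ?n X m" v] chip[OF that(1), of m "drop k v"] that(2)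
      by (cases "pw ?n X m (drop k v) = 0") (auto simp: cat_def)
  qed
  have step2: "skew q a (cat ?n X T) = cat ?n X (skew q a T)" if "a \<in> set rs" for a T
    using skew_cat[of X "length rs" q a T] hom kill[OF that] by (auto simp: cat_def fun_eq_iff)
  have killp: "skew q a (pw ?n X m) v = 0" if "a \<in> set rs" for a m v
  proof (induction m arbitrary: v)
    case 0
    then show ?case by (intro skew_zero) auto
  next
    case (Suc m)
    then show ?case using step2[OF that, of "pw ?n X m"] by (simp add: cat_def)
  qed
  have hom_skew: "length w = k" if "\<And>w. Y w \<noteq> 0 \<Longrightarrow> length w = Suc k" "skew q a Y w \<noteq> 0" for a Y k w
    using that skew_zero[of w Y q a] by fastforce
  \<comment> \<open>Two summands are tracked: a partly differentiated factor \<open>Y\<close> in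
    front of a power of \<open>X\<close>, and an intact \<open>X\<close> in front of
    \<open>T\<close>. Derivations from \<open>rs\<close> kill \<open>X\<close> and its powers, so
    they can only act on \<open>Y\<close> in the first summand and on \<open>T\<close> in the
    second.\<close>
  have run: "skews q r (\<lambda>v. \<kappa> * cat (length r) Y (pw ?n X m) v + cat ?n X T v) v
       = \<kappa> * prod_list (map \<chi> r) ^ m * skews q r Y [] * pw ?n X m v + cat ?n X (skews q r T) v"
    if "set r \<subseteq> set rs" "\<And>w. Y w \<noteq> 0 \<Longrightarrow> length w = length r" for r \<kappa> Y T v m
    using that
  proof (induction r arbitrary: \<kappa> Y T v)
    case (Cons a r)
    have a: "a \<in> set (z # rs)" "a \<in> set rs" using Cons.prems by auto
    have "skew q a (\<lambda>v. \<kappa> * cat (length (a # r)) Y (pw ?n X m) v + cat ?n X T v)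
       = (\<lambda>v. (\<kappa> * \<chi> a ^ m) * cat (length r) (skew q a Y) (pw ?n X m) v + cat ?n X (skew q a T) v)"
      using step1[OF a(1), of Y "length r" m] Cons.prems(2) killp[OF a(2)]
      by (simp add: skew_linear step2[OF a(2)]) (simp add: cat_def mult_ac)
    moreover have "skews q r (\<lambda>v. (\<kappa> * \<chi> a ^ m) * cat (length r) (skew q a Y) (pw ?n X m) v + cat ?n X (skew q a T) v) v
       = (\<kappa> * \<chi> a ^ m) * prod_list (map \<chi> r) ^ m * skews q r (skew q a Y) [] * pw ?n X m v
         + cat ?n X (skews q r (skew q a T)) v"
    proof (rule Cons.IH)
      show "length w = length r" if "skew q a Y w \<noteq> 0" for w
        by (rule hom_skew[OF _ that]) (use Cons.prems(2) in simp)
    qed (use Cons.prems in simp)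
    ultimately show ?case by (simp add: power_mult_distrib mult_ac)
  qed (simp add: cat_def)
  define s where "s = skews q (z # rs) X []"
  \<comment> \<open>Only the first derivation \<open>z\<close> has a choice of the factor it hits.
    By \<open>one\<close> all choices contribute equally, so the coefficient \<open>Suc m\<close> of
    an ordinary derivative appears.\<close>
  have main: "skews q (z # rs) (pw ?n X (Suc m)) v = of_nat (Suc m) * s * pw ?n X m v" for m v
  proof (induction m arbitrary: v)
    case (Suc m)
    let ?m = "Suc m"
    have "skews q (z # rs) (pw ?n X (Suc ?m)) v = skews q rs (\<lambda>v. \<chi> z ^ ?m *
        cat (length rs) (skew q z X) (pw ?n X ?m) v + cat ?n X (skew q z (pw ?n X ?m)) v) v"
      using step1[of z X "length rs" ?m] hom by simp
    also have "\<dots> = \<chi> z ^ ?m * prod_list (map \<chi> rs) ^ ?m * skews q rs (skew q z X) [] * pw ?n X ?m v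
        + cat ?n X (skews q rs (skew q z (pw ?n X ?m))) v"
      by (rule run[OF order_refl hom_skew[OF hom]])
    also have "\<dots> = s * pw ?n X ?m v + cat ?n X (\<lambda>v. of_nat ?m * s * pw ?n X m v) v"
    proof -
      have "\<chi> z ^ ?m * prod_list (map \<chi> rs) ^ ?m = 1"
        using one power_mult_distrib[of "\<chi> z" "prod_list (map \<chi> rs)" ?m] by simp
      moreover have "skews q rs (skew q z (pw ?n X ?m)) = (\<lambda>v. of_nat ?m * s * pw ?n X m v)"
        using Suc unfolding skews.simps by (rule ext)
      moreover have "skews q rs (skew q z X) [] = s" unfolding s_def skews.simps ..
      ultimately show ?thesis by simp
    qed
    also have "\<dots> = of_nat (Suc ?m) * s * pw ?n X ?m v"
      by (simp add: cat_def algebra_simps)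
    finally show ?case .
  next
    case 0
    have "skews q (z # rs) (pw ?n X (Suc 0)) v = skews q rs (\<lambda>v. \<chi> z ^ 0 *
        cat (length rs) (skew q z X) (pw ?n X 0) v + cat ?n X (skew q z (pw ?n X 0)) v) v"
      using step1[of z X "length rs" 0] hom by simp
    also have "\<dots> = \<chi> z ^ 0 * prod_list (map \<chi> rs) ^ 0 * skews q rs (skew q z X) [] * pw ?n X 0 v
        + cat ?n X (skews q rs (skew q z (pw ?n X 0))) v"
      by (rule run[OF order_refl hom_skew[OF hom]])
    also have "skew q z (pw ?n X 0) = (\<lambda>_. 0)"
      by (rule ext, rule skew_zero) auto
    also have "skews q rs (\<lambda>_. 0) = (\<lambda>_. 0)"
    proof -
      have "skew q a (\<lambda>_. 0) = (\<lambda>_. 0)" for a by (rule ext, rule skew_zero) auto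
      then show ?thesis by (induction rs) auto
    qed
    finally show ?case by (simp add: s_def cat_def)
  qed
  \<comment> \<open>Derivations consume letters from the right end of the word, hence the
    reversal.\<close>
  define u where "u m = concat (replicate m (rev (z # rs)))" for m
  have u: "u m \<in> words (?n * m) d" for m
    using r by (induction m) (auto simp: u_def words_iff)
  have u_Suc: "u (Suc m) = u m @ rev (z # rs)" for m
    by (induction m) (simp_all add: u_def)
  have lin: "qsym d (diagc q) n (\<lambda>v. a * T v) w = a * qsym d (diagc q) n T w" for n a T w
    by (simp add: qsym_scale)
  \<comment> \<open>The value on this single word is nonzero because factorials are invertible in
    characteristic 0.\<close>
  have final: "qsym d (diagc q) (?n * m) (pw ?n X m) (u m) = fact m * s ^ m" for m
  proof (induction m)
    case (Suc m)
    have "qsym d (diagc q) (?n * Suc m) (pw ?n X (Suc m)) (u (Suc m))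
        = qsym d (diagc q) (?n * m + length (z # rs)) (pw ?n X (Suc m)) (u m @ rev (z # rs))"
      by (simp add: u_Suc algebra_simps)
    also have "\<dots> = qsym d (diagc q) (?n * m) (skews q (z # rs) (pw ?n X (Suc m))) (u m)"
      by (rule qsym_skews[OF r u])
    also have "\<dots> = qsym d (diagc q) (?n * m) (\<lambda>v. (of_nat (Suc m) * s) * pw ?n X m v) (u m)"
      by (subst ext[OF main]) (rule refl)
    also have "\<dots> = of_nat (Suc m) * s * (fact m * s ^ m)"
      unfolding lin Suc ..
    finally show ?case by (simp add: algebra_simps)
  qed (simp add: u_def)
  have "s \<noteq> 0" using top by (simp add: s_def)
  have "\<exists>n\<ge>N. \<exists>T. \<exists>v\<in>words n d. qsym d (diagc q) n T v \<noteq> 0" for N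
  proof -
    have "qsym d (diagc q) (?n * N) (pw ?n X N) (u N) \<noteq> 0" using final[of N] \<open>s \<noteq> 0\<close> by simp
    then show ?thesis using u[of N] by (intro exI[of _ "?n * N"]) auto
  qed
  then show ?thesis unfolding nichols_fin_qsym by blast
qed

text \<open>Sums of words as lists, so that iterated derivatives of a concrete tensor are evaluated
  by rewriting; coefficients of a repeated word add up.\<close>

definition tens_of :: "('a::field \<times> nat list) list \<Rightarrow> nat list \<Rightarrow> 'a" where
  "tens_of L = (\<lambda>w. \<Sum>(k, u)\<leftarrow>L. if u = w then k else 0)"

text \<open>The counterpart of \<open>skew\<close> on a single word, with one summand per occurrence
  of \<open>a\<close>, whereas \<open>skew\<close> acts on coefficient functions.\<close>

fun wder :: "(nat \<Rightarrow> nat \<Rightarrow> 'a::field) \<Rightarrow> nat \<Rightarrow> 'a \<Rightarrow> nat list \<Rightarrow> ('a \<times> nat list) list" where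
  "wder q a k [] = []"
| "wder q a k (x # u) = (if x = a then [(k * prod_list (map (q a) u), u)] else [])
     @ map (\<lambda>(k', u'). (k', x # u')) (wder q a k u)"

lemma tens_of_simps [simp]:
  "tens_of [] w = 0" "tens_of ((k, u) # L) w = (if u = w then k else 0) + tens_of L w"
  "tens_of (L @ L') w = tens_of L w + tens_of L' w"
  by (simp_all add: tens_of_def)

lemma tens_of_map_Cons:
  "tens_of (map (\<lambda>(k', u'). (k', x # u')) L) w = (case w of [] \<Rightarrow> 0 | y # v \<Rightarrow> if x = y then tens_of L v else 0)"
  by (induction L) (auto split: list.split)

lemma skew_word: "skew q a (\<lambda>w. if u = w then k else 0) v = tens_of (wder q a k u) v"
proof (induction v arbitrary: u)
  case Nil
  then show ?case by (cases u) (auto simp: tens_of_map_Cons)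
next
  case (Cons y v)
  have z: "skew q a (\<lambda>_. 0) v = 0" for v by (rule skew_zero) simp
  show ?case
  proof (cases u)
    case Nil
    then show ?thesis by (simp add: z)
  next
    case (Cons x u')
    then show ?thesis using Cons.IH[of u'] by (cases "x = y") (auto simp: tens_of_map_Cons z)
  qed
qed

lemma skew_tens_of:
  "skew q a (tens_of L) = tens_of (concat (map (\<lambda>(k, u). wder q a k u) L))"
proof
  fix v show "skew q a (tens_of L) v = tens_of (concat (map (\<lambda>(k, u). wder q a k u) L)) v"
  proof (induction L)
    case Nil
    have "tens_of [] = (\<lambda>_. 0::'a)" by auto
    then show ?case by (simp add: skew_zero)
  next
    case (Cons p L)
    obtain k u where p: "p = (k, u)" by (cases p)
    have "tens_of (p # L) = (\<lambda>v. 1 * (if u = v then k else 0) + tens_of L v)" by (auto simp: p)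
    then show ?case using Cons by (simp only: skew_linear) (simp add: p skew_word)
  qed
qed

lemma tens_of_nonzero: "tens_of L w \<noteq> 0 \<Longrightarrow> w \<in> snd ` set L"
  by (induction L) (auto split: if_splits)

lemma not_nichols_fin_tens_of:
  fixes q :: "nat \<Rightarrow> nat \<Rightarrow> 'a::field_char_0"
  assumes "\<forall>(k, u)\<in>set L. length u = Suc (length rs)" "set (z # rs) \<subseteq> {..<d}"
    and "\<forall>a\<in>set (z # rs). \<forall>(k, u)\<in>set L. prod_list (map (q a) u) = \<chi> a"
    and "\<forall>a\<in>set rs. \<forall>v. skew q a (tens_of L) v = 0"
    and "skews q (z # rs) (tens_of L) [] \<noteq> 0" "prod_list (map \<chi> (z # rs)) = 1"
  shows "\<not> nichols_fin d (diagc q)"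
  by (rule not_nichols_fin_diag[where X = "tens_of L" and z = z and rs = rs and \<chi> = \<chi>])
    (use assms in \<open>fastforce dest!: tens_of_nonzero\<close>)+

section \<open>Braiding matrices excluded by an explicit tensor\<close>

lemma not_fin_unit:
  assumes "(q::nat \<Rightarrow> nat \<Rightarrow> 'a::field_char_0) 0 0 = 1"
  shows "\<not> nichols_fin 1 (diagc q)"
  by (rule not_nichols_fin_tens_of[where L = "[(1, [0])]" and z = 0 and rs = "[]" and \<chi> = "\<lambda>_. 1"])
    (use assms in \<open>auto simp: skew_tens_of\<close>)

text \<open>Let X = x_0 x_1 - q_01 x_1 x_0. The derivation at 0 kills X, the one at 1 gives (1 -
  q_01 q_10) x_0, and the first hypothesis says that the degree of X acts trivially on X.\<close>

lemma not_fin_affine_A1: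
  fixes q :: "nat \<Rightarrow> nat \<Rightarrow> 'a::field_char_0"
  assumes "q 0 0 * q 0 1 * (q 1 0 * q 1 1) = 1" "q 0 1 * q 1 0 \<noteq> 1"
  shows "\<not> nichols_fin 2 (diagc q)"
  by (rule not_nichols_fin_tens_of[where L = "[(1, [0, 1]), (- q 0 1, [1, 0])]" and z = 1
      and rs = "[0]" and \<chi> = "\<lambda>a. q a 0 * q a 1"])
    (use assms in \<open>auto simp: skew_tens_of algebra_simps\<close>)

text \<open>Affine type \<open>A\<^sub>2\<close> at \<open>-1\<close>; the tensor is \<open>[x\<^sub>2, [x\<^sub>1, x\<^sub>0]]\<close>.\<close>

lemma not_fin_triangle:
  fixes q :: "nat \<Rightarrow> nat \<Rightarrow> 'a::field_char_0"
  assumes q: "q 0 0 = -1" "q 1 1 = -1" "q 2 2 = -1"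
    and q01: "q 0 1 * q 1 0 = -1" and q02: "q 0 2 * q 2 0 = -1" and q12: "q 1 2 * q 2 1 = -1"
  shows "\<not> nichols_fin 3 (diagc q)"
proof -
  let ?L = "[(1, [2, 1, 0]), (- q 1 0, [2, 0, 1]), (- (q 2 0 * q 2 1), [1, 0, 2]),
     (q 2 0 * q 2 1 * q 1 0, [0, 1, 2])]"
  let ?\<chi> = "\<lambda>a. q a 0 * q a 1 * q a 2"
  show ?thesis
  proof (rule not_nichols_fin_tens_of[where L = ?L and z = 0 and rs = "[2, 1]" and \<chi> = ?\<chi>])
    have "prod_list (map ?\<chi> [0, 2, 1])
         = q 0 0 * q 1 1 * q 2 2 * (q 0 1 * q 1 0) * (q 0 2 * q 2 0) * (q 1 2 * q 2 1)"
      by (simp add: mult_ac)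
    then show "prod_list (map ?\<chi> [0, 2, 1]) = 1"
      unfolding q q01 q02 q12 by simp
    \<comment> \<open>Here 4 is (1 - q_01 q_10)(1 - q_02 q_20): the derivations at 0 and at 2
      contribute one factor each.\<close>
    have "skews q [0, 2, 1] (tens_of ?L) [] = 4 * q 2 1"
      using q01 q02 by (simp add: skew_tens_of) algebra
    moreover have "q 2 1 \<noteq> 0" using q12 by auto
    ultimately show "skews q [0, 2, 1] (tens_of ?L) [] \<noteq> 0" by simp
    show "\<forall>a\<in>set [2, 1]. \<forall>v. skew q a (tens_of ?L) v = 0"
      by (auto simp: skew_tens_of q algebra_simps)
  qed (auto simp: mult_ac)
qed

text \<open>Affine type \<open>A\<^sub>3\<close> at \<open>-1\<close>, with vertices 0, 1, 2, 3 in cyclic order; the tensor is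
  \<open>[x\<^sub>3, [x\<^sub>2, [x\<^sub>1, x\<^sub>0]]]\<close>.\<close>

lemma not_fin_square:
  fixes q :: "nat \<Rightarrow> nat \<Rightarrow> 'a::field_char_0"
  assumes q: "q 0 0 = -1" "q 1 1 = -1" "q 2 2 = -1" "q 3 3 = -1"
    and q01: "q 0 1 * q 1 0 = -1" and q12: "q 1 2 * q 2 1 = -1"
    and q23: "q 2 3 * q 3 2 = -1" and q03: "q 0 3 * q 3 0 = -1"
    and q02: "q 0 2 * q 2 0 = 1" and q13: "q 1 3 * q 3 1 = 1"
  shows "\<not> nichols_fin 4 (diagc q)"
proof -
  let ?k = "q 2 0 * q 2 1" and ?l = "q 3 0 * q 3 1 * q 3 2"
  let ?L = "[(1, [3, 2, 1, 0]), (- q 1 0, [3, 2, 0, 1]), (- ?k, [3, 1, 0, 2]), (?k * q 1 0, [3, 0, 1, 2]),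
     (- ?l, [2, 1, 0, 3]), (?l * q 1 0, [2, 0, 1, 3]), (?l * ?k, [1, 0, 2, 3]), (- (?l * ?k * q 1 0), [0, 1, 2, 3])]"
  let ?\<chi> = "\<lambda>a. q a 0 * q a 1 * q a 2 * q a 3"
  show ?thesis
  proof (rule not_nichols_fin_tens_of[where L = ?L and z = 0 and rs = "[3, 1, 2]" and \<chi> = ?\<chi>])
    have "prod_list (map ?\<chi> [0, 3, 1, 2]) = q 0 0 * q 1 1 * q 2 2 * q 3 3 * (q 0 1 * q 1 0) * (q 1 2 * q 2 1)
        * (q 2 3 * q 3 2) * (q 0 3 * q 3 0) * (q 0 2 * q 2 0) * (q 1 3 * q 3 1)"
      by (simp add: mult_ac)
    then show "prod_list (map ?\<chi> [0, 3, 1, 2]) = 1"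
      unfolding q q01 q02 q12 q23 q03 q13 by simp
    \<comment> \<open>The derivations at 0 and 3 leave a multiple of the commutator of x_2 and x_1.
      It is killed by the derivation at 2, so 1 has to precede 2. The factor 8 is (1 - q_01 q_10)(1
      - q_03 q_30)(1 - q_12 q_21).\<close>
    have "skews q [0, 3, 1, 2] (tens_of ?L) [] = 8 * q 3 2 * q 3 1"
      using q01 q02 q12 q03 q13 by (simp add: skew_tens_of) algebra
    moreover have "q 3 2 \<noteq> 0" "q 3 1 \<noteq> 0" using q23 q13 by auto
    ultimately show "skews q [0, 3, 1, 2] (tens_of ?L) [] \<noteq> 0" by simp
    show "\<forall>a\<in>set [3, 1, 2]. \<forall>v. skew q a (tens_of ?L) v = 0"
      by (auto simp: skew_tens_of q algebra_simps)
  qed (auto simp: mult_ac)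
qed

section \<open>The ring of finitely supported matrices\<close>

text \<open>Matrices of all formats live in this one ring (without unit), with \<open>idm d\<close> as identity of size \<open>d\<close>.\<close>

typedef (overloaded) 'a fmat =
  "{A :: nat \<Rightarrow> nat \<Rightarrow> 'a::field. \<exists>n. \<forall>i j. n \<le> i \<or> n \<le> j \<longrightarrow> A i j = 0}"
  morphisms ent Fmat
  by (rule exI[of _ "\<lambda>_ _. 0"]) simp

lemma fmat_eqI: "(\<And>i j. ent A i j = ent B i j) \<Longrightarrow> A = B"
  by (metis ent_inject ext)

lemma fmat_bound: obtains n where "\<And>i j. n \<le> i \<or> n \<le> j \<Longrightarrow> ent A i j = 0"
  using ent[of A] by blast

lemma fmat_bound2:
  obtains n where "\<And>i j. n \<le> i \<or> n \<le> j \<Longrightarrow> ent A i j = 0" "\<And>i j. n \<le> i \<or> n \<le> j \<Longrightarrow> ent B i j = 0"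
proof -
  obtain a b where "\<And>i j. a \<le> i \<or> a \<le> j \<Longrightarrow> ent A i j = 0" "\<And>i j. b \<le> i \<or> b \<le> j \<Longrightarrow> ent B i j = 0"
    using fmat_bound[of A] fmat_bound[of B] by metis
  then show ?thesis by (intro that[of "max a b"]) auto
qed

lemma ent_Fmat:
  assumes "\<And>i j. n \<le> i \<or> n \<le> j \<Longrightarrow> A i j = 0"
  shows "ent (Fmat A) = A"
  using assms by (subst Fmat_inverse) auto

instantiation fmat :: (field) ring
begin

definition "0 = Fmat (\<lambda>_ _. 0 :: 'a)"
definition "A + B = Fmat (\<lambda>i j. ent A i j + ent B i j :: 'a)"
definition "A - B = Fmat (\<lambda>i j. ent A i j - ent B i j :: 'a)"
definition "- A = Fmat (\<lambda>i j. - ent A i j :: 'a)"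
text \<open>Summation over the support of a row needs no choice of size; \<open>ent_mult\<close>
  later admits any limit beyond which the terms vanish.\<close>

definition "A * B = Fmat (\<lambda>i j. \<Sum>k | ent A i k \<noteq> 0. ent A i k * ent B k j :: 'a)"

lemma ent_ring [simp]:
  "ent 0 i j = (0::'a)" "ent (A + B) i j = (ent A i j + ent B i j :: 'a)"
  "ent (A - B) i j = (ent A i j - ent B i j :: 'a)" "ent (- A) i j = (- ent A i j :: 'a)"
proof -
  obtain n where n: "\<And>i j. n \<le> i \<or> n \<le> j \<Longrightarrow> ent A i j = 0" "\<And>i j. n \<le> i \<or> n \<le> j \<Longrightarrow> ent B i j = 0"
    using fmat_bound2[of A B] by blast
  show "ent 0 i j = (0::'a)" unfolding zero_fmat_def by (subst ent_Fmat[of 0]) auto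
  show "ent (A + B) i j = ent A i j + ent B i j" unfolding plus_fmat_def by (subst ent_Fmat[of n]) (auto simp: n)
  show "ent (A - B) i j = ent A i j - ent B i j" unfolding minus_fmat_def by (subst ent_Fmat[of n]) (auto simp: n)
  show "ent (- A) i j = - ent A i j" unfolding uminus_fmat_def by (subst ent_Fmat[of n]) (auto simp: n)
qed

lemma ent_mult':
  "ent (A * B) i j = (\<Sum>k | ent A i k \<noteq> 0. ent A i k * ent B k j :: 'a)"
proof -
  obtain n where n: "\<And>i j. n \<le> i \<or> n \<le> j \<Longrightarrow> ent A i j = 0" "\<And>i j. n \<le> i \<or> n \<le> j \<Longrightarrow> ent B i j = 0"
    using fmat_bound2[of A B] by blast
  then show ?thesis unfolding times_fmat_def by (subst ent_Fmat[of n]) auto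
qed

lemma ent_mult:
  assumes "\<And>k. n \<le> k \<Longrightarrow> ent A i k * ent B k j = (0::'a)"
  shows "ent (A * B) i j = (\<Sum>k<n. ent A i k * ent B k j)"
proof -
  obtain m where m: "\<And>i j. m \<le> i \<or> m \<le> j \<Longrightarrow> ent A i j = 0" using fmat_bound[of A] by blast
  have "finite {k. ent A i k \<noteq> 0}"
    by (rule finite_subset[of _ "{..<m}"]) (use m in \<open>auto simp: not_le[symmetric]\<close>)
  then have "ent (A * B) i j = (\<Sum>k\<in>{k. ent A i k \<noteq> 0} \<union> {..<n}. ent A i k * ent B k j)"
    unfolding ent_mult' by (intro sum.mono_neutral_left) auto
  also have "\<dots> = (\<Sum>k<n. ent A i k * ent B k j)"
    using assms \<open>finite _\<close> by (intro sum.mono_neutral_right) (auto simp: not_less)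
  finally show ?thesis .
qed

instance
proof
  fix A B C :: "'a fmat"
  show "A * B * C = A * (B * C)"
  proof (rule fmat_eqI)
    fix i j
    obtain n where n: "\<And>i j. n \<le> i \<or> n \<le> j \<Longrightarrow> ent A i j = 0" "\<And>i j. n \<le> i \<or> n \<le> j \<Longrightarrow> ent B i j = 0"
      using fmat_bound2[of A B] by blast
    have AB: "ent (A * B) i k = (\<Sum>l<n. ent A i l * ent B l k)" for i k
      by (rule ent_mult) (auto simp: n)
    have BC: "ent (B * C) i k = (\<Sum>l<n. ent B i l * ent C l k)" for i k
      by (rule ent_mult) (auto simp: n)
    have "ent (A * B * C) i j = (\<Sum>k<n. ent (A * B) i k * ent C k j)"
      by (rule ent_mult) (auto simp: AB n)
    also have "\<dots> = (\<Sum>k<n. \<Sum>l<n. ent A i l * ent B l k * ent C k j)"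
      by (simp add: AB sum_distrib_right)
    also have "\<dots> = (\<Sum>l<n. ent A i l * ent (B * C) l j)"
      by (subst sum.swap) (simp add: BC sum_distrib_left mult.assoc)
    also have "\<dots> = ent (A * (B * C)) i j"
      by (rule ent_mult[symmetric]) (auto simp: n)
    finally show "ent (A * B * C) i j = ent (A * (B * C)) i j" .
  qed
  show "(A + B) * C = A * C + B * C"
  proof (rule fmat_eqI)
    fix i j
    obtain n where n: "\<And>i j. n \<le> i \<or> n \<le> j \<Longrightarrow> ent A i j = 0" "\<And>i j. n \<le> i \<or> n \<le> j \<Longrightarrow> ent B i j = 0"
      using fmat_bound2[of A B] by blast
    show "ent ((A + B) * C) i j = ent (A * C + B * C) i j"
      by (simp add: ent_mult[of n] n sum.distrib algebra_simps)
  qed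
  show "A * (B + C) = A * B + A * C"
  proof (rule fmat_eqI)
    fix i j
    obtain n where n: "\<And>i j. n \<le> i \<or> n \<le> j \<Longrightarrow> ent A i j = 0"
      using fmat_bound[of A] by blast
    show "ent (A * (B + C)) i j = ent (A * B + A * C) i j"
      by (simp add: ent_mult[of n] n sum.distrib algebra_simps)
  qed
qed (auto intro!: fmat_eqI)

end

lemma ent_sum: "ent (\<Sum>x\<in>I. f x) i j = (\<Sum>x\<in>I. ent (f x) i j)"
  by (induction I rule: infinite_finite_induct) auto

definition sc :: "'a::field \<Rightarrow> 'a fmat \<Rightarrow> 'a fmat" where
  "sc c A = Fmat (\<lambda>i j. c * ent A i j)"

lemma ent_sc [simp]: "ent (sc c A) i j = c * ent A i j"
proof -
  obtain n where n: "\<And>i j. n \<le> i \<or> n \<le> j \<Longrightarrow> ent A i j = 0" using fmat_bound[of A] by blast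
  show ?thesis unfolding sc_def by (subst ent_Fmat[of n]) (auto simp: n)
qed

lemma sc_mult_left [simp]: "sc c A * B = sc c (A * B)"
proof (rule fmat_eqI)
  fix i j
  obtain n where n: "\<And>i j. n \<le> i \<or> n \<le> j \<Longrightarrow> ent A i j = 0" using fmat_bound[of A] by blast
  show "ent (sc c A * B) i j = ent (sc c (A * B)) i j"
    by (simp add: ent_mult[of n] n sum_distrib_left mult.assoc)
qed

lemma sc_mult_right [simp]: "A * sc c B = sc c (A * B)"
proof (rule fmat_eqI)
  fix i j
  obtain n where n: "\<And>i j. n \<le> i \<or> n \<le> j \<Longrightarrow> ent A i j = 0" using fmat_bound[of A] by blast
  show "ent (A * sc c B) i j = ent (sc c (A * B)) i j"
    by (simp add: ent_mult[of n] n sum_distrib_left mult_ac)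
qed

text \<open>Gives access to independence and span for the dimension count in
  \<open>rank_bound\<close>.\<close>

interpretation fmat: vector_space sc
  by standard (auto intro!: fmat_eqI simp: algebra_simps)

lemmas sc_simps = fmat.scale_right_distrib fmat.scale_right_diff_distrib fmat.scale_minus_right

definition tr :: "nat \<Rightarrow> nat \<Rightarrow> (nat \<Rightarrow> nat \<Rightarrow> 'a::field) \<Rightarrow> 'a fmat" where
  "tr d e A = Fmat (\<lambda>i j. if i < d \<and> j < e then A i j else 0)"

lemma ent_tr [simp]: "ent (tr d e A) i j = (if i < d \<and> j < e then A i j else 0)"
  unfolding tr_def by (subst ent_Fmat[of "max d e"]) auto

definition idm :: "nat \<Rightarrow> 'a::field fmat" where "idm d = tr d d ident"

lemma ent_idm [simp]: "ent (idm d) i j = (if i < d \<and> i = j then 1 else 0)"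
  by (auto simp: idm_def ident_def)

text \<open>Matrix units. Vectors are encoded as matrices supported in column 0:
  \<open>A * eu p 0\<close> is column \<open>p\<close> of \<open>A\<close> as a vector, and
  \<open>eu 0 p * A\<close> is row \<open>p\<close> as a functional.\<close>

definition eu :: "nat \<Rightarrow> nat \<Rightarrow> 'a::field fmat" where
  "eu a b = Fmat (\<lambda>i j. if i = a \<and> j = b then 1 else 0)"

lemma ent_eu [simp]: "ent (eu a b) i j = (if i = a \<and> j = b then 1 else 0)"
  unfolding eu_def by (subst ent_Fmat[of "Suc (max a b)"]) auto

lemma ent_eu_mult [simp]: "ent (eu a b * A) i j = (if i = a then ent A b j else 0)"
  by (subst ent_mult[of "Suc b"]) auto

lemma ent_mult_eu [simp]: "ent (A * eu a b) i j = (if j = b then ent A i a else 0)"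
  by (subst ent_mult[of "Suc a"]) auto

lemma eu_mult_eu [simp]: "eu a b * eu c e = (if b = c then eu a e else (0 :: 'a::field fmat))"
  by (rule fmat_eqI) auto

lemma idm_mult: "ent (idm d * A) i j = (if i < d then ent A i j else 0)"
  by (subst ent_mult[of d]) (auto simp: if_distrib[of "\<lambda>z. z * _"] cong: if_cong)

lemma mult_idm: "ent (A * idm d) i j = (if j < d then ent A i j else 0)"
  by (subst ent_mult[of d]) (auto simp: if_distrib cong: if_cong)

lemma idm_idm [simp]: "idm m * idm n = (idm (min m n) :: 'a::field fmat)"
  by (rule fmat_eqI) (auto simp: idm_mult)

lemma idm_tr [simp]: "idm d * tr d e A = tr d e A" "tr d e A * idm e = tr d e A"
  by (auto intro!: fmat_eqI simp: idm_mult mult_idm)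

lemma tr_mult: "tr d e A * tr e f B = tr d f (\<lambda>i j. \<Sum>k<e. A i k * B k j)"
  by (rule fmat_eqI, subst ent_mult[of e]) auto

lemma tr_mmul: "tr d d (mmul d A B) = tr d d A * tr d d B"
  by (simp add: tr_mult mmul_def)

lemma meq_iff_tr: "meq d A B \<longleftrightarrow> tr d d A = tr d d B"
proof
  assume "tr d d A = tr d d B"
  then have e: "ent (tr d d A) i j = ent (tr d d B) i j" for i j by simp
  show "meq d A B" unfolding meq_def
  proof (intro allI impI)
    show "A i j = B i j" if "i < d" "j < d" for i j using e[of i j] that by simp
  qed
qed (auto simp: meq_def intro!: fmat_eqI)

lemma tr_sum: "tr d e (\<lambda>i j. \<Sum>x\<in>I. f x i j) = (\<Sum>x\<in>I. tr d e (f x))"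
  by (rule fmat_eqI) (auto simp: ent_sum)

lemma tr_lin:
  "tr d e (\<lambda>i j. A i j + B i j) = tr d e A + tr d e B"
  "tr d e (\<lambda>i j. A i j - B i j) = tr d e A - tr d e B"
  "tr d e (\<lambda>i j. c * A i j) = sc c (tr d e A)"
  "tr d e (\<lambda>i j. A i j / c) = sc (1 / c) (tr d e A)"
  by (auto intro!: fmat_eqI)

lemma tr_ent: "idm d * A = A \<Longrightarrow> A * idm e = A \<Longrightarrow> tr d e (ent A) = A"
proof (rule fmat_eqI)
  fix i j assume "idm d * A = A" "A * idm e = A"
  then have "ent A i j = (if i < d \<and> j < e then ent A i j else 0)"
    by (metis idm_mult mult_idm)
  then show "ent (tr d e (ent A)) i j = ent A i j" by simp
qed

text \<open>\<open>R\<close> sends the first \<open>n\<close> columns of \<open>P\<close> to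
  distinct unit vectors, so these columns are independent; having only \<open>d\<close> rows, they
  lie in the span of \<open>d\<close> vectors.\<close>

lemma rank_bound:
  assumes RP: "R * P = (idm n :: 'a::field fmat)" and P: "idm d * P = P"
  shows "n \<le> d"
proof -
  define v where "v j = P * eu j 0" for j
  have Rv: "R * v j = eu j 0" if "j < n" for j
    using RP that by (simp add: v_def flip: mult.assoc) (auto intro!: fmat_eqI simp: idm_mult)
  have eu_inj: "eu i 0 = (eu j 0 :: 'a fmat) \<Longrightarrow> i = j" for i j
    by (metis ent_eu zero_neq_one)
  have inj: "inj_on v {..<n}"
    by (rule inj_onI) (metis Rv eu_inj lessThan_iff)
  have indep: "fmat.independent (v ` {..<n})"
  proof (rule fmat.independent_if_scalars_zero)
    fix f w assume sum0: "(\<Sum>x\<in>v ` {..<n}. sc (f x) x) = 0" and "w \<in> v ` {..<n}"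
    then obtain k where k: "w = v k" "k < n" by auto
    have "0 = R * (\<Sum>x\<in>v ` {..<n}. sc (f x) x)" using sum0 by simp
    also have "\<dots> = (\<Sum>j<n. sc (f (v j)) (eu j 0))"
      by (simp add: sum.reindex[OF inj] sum_distrib_left Rv)
    finally have "ent (\<Sum>j<n. sc (f (v j)) (eu j 0)) k 0 = 0" by simp
    then show "f w = 0" using k by (simp add: ent_sum if_distrib cong: if_cong)
  qed simp
  have "v j \<in> fmat.span ((\<lambda>i. eu i 0) ` {..<d})" for j
  proof -
    have "v j = idm d * v j" using P by (simp add: v_def flip: mult.assoc)
    also have "\<dots> = (\<Sum>i<d. sc (ent (v j) i 0) (eu i 0))"
      by (rule fmat_eqI) (auto simp: idm_mult ent_sum v_def if_distrib cong: if_cong)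
    finally show ?thesis
      by (metis (no_types, lifting) fmat.span_base fmat.span_scale fmat.span_sum imageI)
  qed
  then have "card (v ` {..<n}) \<le> card ((\<lambda>i. eu i 0 :: 'a fmat) ` {..<d})"
    using fmat.independent_span_bound[OF _ indep] by auto
  also have "\<dots> \<le> d" using card_image_le[of "{..<d}" "\<lambda>i. eu i 0 :: 'a fmat"] by simp
  finally show ?thesis by (simp add: card_image[OF inj])
qed

section \<open>Direct summands of Yetter-Drinfeld modules\<close>

lemma sum_single:
  fixes n :: nat
  assumes "\<And>k. k < n \<Longrightarrow> f k = (if k = m then c else 0)"
  shows "(\<Sum>k<n. f k) = (if m < n then c else (0::'a::comm_monoid_add))"
proof -
  have "(\<Sum>k<n. f k) = (\<Sum>k<n. if k = m then c else 0)" by (rule sum.cong) (auto simp: assms)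
  then show ?thesis by simp
qed

text \<open>One index set for the action of the generators and for all coefficients of the coaction.
  A Yetter-Drinfeld module becomes a family of operators, and its morphisms are the intertwiners of
  that family.\<close>

datatype gen = GX | GY | GZ | GC hb

fun gmat :: "'a::field ydm \<Rightarrow> gen \<Rightarrow> 'a mat" where
  "gmat M GX = ax M" | "gmat M GY = ay M" | "gmat M GZ = az M" | "gmat M (GC u) = co M u"

definition opr :: "'a::field ydm \<Rightarrow> gen \<Rightarrow> 'a fmat" where
  "opr M g = tr (ydim M) (ydim M) (gmat M g)"

definition idn :: "'a::field ydm \<Rightarrow> 'a fmat" where "idn M = idm (ydim M)"

definition opa :: "'a::field ydm \<Rightarrow> hb \<Rightarrow> 'a fmat" where
  "opa M u = (case u of (a, b, c) \<Rightarrow> (if a then opr M GX else idn M)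
     * (if b then opr M GY else idn M) * (if c then opr M GZ else idn M))"

lemma idn_opr [simp]: "idn M * opr M g = opr M g" "opr M g * idn M = opr M g"
  by (simp_all add: idn_def opr_def)

lemma idn_idn [simp]: "idn M * idn M = idn M"
  by (simp add: idn_def)

lemma tr_act: "tr (ydim M) (ydim M) (act M u) = opa M u"
  by (cases u) (simp add: act_def opa_def tr_mmul opr_def idn_def idm_def)

definition morph :: "'a::field ydm \<Rightarrow> 'a ydm \<Rightarrow> 'a fmat \<Rightarrow> bool" where
  "morph N M P \<longleftrightarrow> idn M * P = P \<and> P * idn N = P \<and> (\<forall>g. opr M g * P = P * opr N g)"

lemma morph_opa:
  assumes "morph N M P"
  shows "opa M u * P = P * opa N u"
proof -
  have *: "(if c then opr M g else idn M) * P = P * (if c then opr N g else idn N)" for c g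
    using assms by (simp add: morph_def)
  show ?thesis unfolding opa_def
    by (cases u) (simp only: prod.case mult.assoc *, simp only: mult.assoc[symmetric] *)
qed

lemma cb_ent:
  assumes "i < ydim M" "j < ydim M" "l < ydim M" "k < ydim M"
  shows "cb M i j l k = (\<Sum>u\<in>UNIV. ent (opr M (GC u)) k i * ent (opa M u) l j)"
  using assms by (simp add: cb_def opr_def flip: tr_act)

text \<open>Column \<open>a\<close> of \<open>V t\<close> is the \<open>a\<close>-th basis vector in
  use at tensor position \<open>t\<close>. The braiding exchanges labels rather than vectors:
  afterwards position \<open>t\<close> carries the vector with label \<open>b\<close> of its own
  basis.\<close>

lemma nfin_embed_diag:
  assumes "nfin M"
    and V: "\<And>t. idn M * V t = V t" and WV: "\<And>t. W t * V t = idm r"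
    and br: "\<And>t a b x y. a < r \<Longrightarrow> b < r \<Longrightarrow>
      (\<Sum>u\<in>UNIV. ent (opa M u * V (Suc t)) x b * ent (opr M (GC u) * V t) y a)
        = q a b * ent (V t) x b * ent (V (Suc t)) y a"
  shows "nichols_fin r (diagc q)"
proof (rule nichols_fin_embed[where P = "\<lambda>t. ent (V t)" and Q = "\<lambda>t. ent (W t)"])
  show "nichols_fin (ydim M) (cb M)" using assms by (simp add: nfin_def)
  fix t
  have Vz: "ent (V t) i j = 0" if "i \<ge> ydim M" for i j t
    using that V[of t] by (metis idm_mult idn_def not_le)
  show "(\<Sum>x<ydim M. ent (W t) i x * ent (V t) x j) = (if i = j then 1 else 0)" if "i < r" "j < r" for i j
  proof -
    have "(\<Sum>x<ydim M. ent (W t) i x * ent (V t) x j) = ent (W t * V t) i j"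
      by (rule ent_mult[symmetric]) (simp add: Vz)
    then show ?thesis using that WV[of t] by simp
  qed
  fix a b x y assume ab: "a < r" "b < r" and xy: "x < ydim M" "y < ydim M"
  let ?d = "ydim M"
  have "(\<Sum>i<?d. \<Sum>j<?d. ent (V t) i a * ent (V (Suc t)) j b * cb M i j x y)
     = (\<Sum>i<?d. \<Sum>j<?d. \<Sum>u\<in>UNIV. (ent (opr M (GC u)) y i * ent (V t) i a) * (ent (opa M u) x j * ent (V (Suc t)) j b))"
    using xy by (simp add: cb_ent sum_distrib_left mult_ac)
  also have "\<dots> = (\<Sum>u\<in>UNIV. \<Sum>i<?d. \<Sum>j<?d. (ent (opr M (GC u)) y i * ent (V t) i a) * (ent (opa M u) x j * ent (V (Suc t)) j b))"
    by (subst sum.swap[of _ UNIV], subst sum.swap[of _ UNIV]) simp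
  also have "\<dots> = (\<Sum>u\<in>UNIV. ent (opr M (GC u) * V t) y a * ent (opa M u * V (Suc t)) x b)"
    by (simp add: ent_mult[of ?d] Vz flip: sum_product)
  also have "\<dots> = q a b * ent (V t) x b * ent (V (Suc t)) y a"
    using br[OF ab] by (simp add: mult.commute)
  also have "\<dots> = (\<Sum>i<r. \<Sum>j<r. ent (V t) x i * ent (V (Suc t)) y j * diagc q a b i j)"
  proof -
    have "(\<Sum>j<r. ent (V t) x i * ent (V (Suc t)) y j * diagc q a b i j)
      = (if a < r then (if i = b then q a b * ent (V t) x b * ent (V (Suc t)) y a else 0) else 0)" for i
      by (rule sum_single) (auto simp: diagc_def)
    then show ?thesis using ab by simp
  qed
  finally show "(\<Sum>i<r. \<Sum>j<r. ent (V t) x i * ent (V (Suc t)) y j * diagc q a b i j)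
     = (\<Sum>i<?d. \<Sum>j<?d. ent (V t) i a * ent (V (Suc t)) j b * cb M i j x y)" by simp
qed

text \<open>\<open>e\<close> projects \<open>M\<close> onto a direct summand isomorphic to
  \<open>N\<close>. Recording the projection lets complementary summands be handled as orthogonal
  idempotents.\<close>

definition split :: "'a::field ydm \<Rightarrow> 'a fmat \<Rightarrow> 'a ydm \<Rightarrow> bool" where
  "split M e N \<longleftrightarrow> (\<exists>P R. morph N M P \<and> morph M N R \<and> R * P = idn N \<and> P * R = e)"

text \<open>The inclusion of a summand intertwines action and coaction, hence the braidings, and the
  projection is a left inverse of it.\<close>

lemma nfin_split:
  assumes "split M e N" "nfin M"
  shows "nfin N"
proof -
  obtain P R where P: "morph N M P" and RP: "R * P = idn N" using assms by (auto simp: split_def)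
  let ?m = "ydim M" and ?n = "ydim N"
  have Pz: "ent P i j = 0" if "i \<ge> ?m \<or> j \<ge> ?n" for i j
    using that P unfolding morph_def idn_def by (metis idm_mult mult_idm not_le)
  show ?thesis unfolding nfin_def
  proof (rule nichols_fin_embed[where P = "\<lambda>_. ent P" and Q = "\<lambda>_. ent R"])
    show "nichols_fin ?m (cb M)" using assms by (simp add: nfin_def)
    show "(\<Sum>x<?m. ent R i x * ent P x j) = (if i = j then 1 else 0)" if "i < ?n" "j < ?n" for i j
    proof -
      have "(\<Sum>x<?m. ent R i x * ent P x j) = ent (R * P) i j"
        by (rule ent_mult[symmetric]) (simp add: Pz)
      then show ?thesis using that RP by (simp add: idn_def)
    qed
    fix a b x y assume ab: "a < ?n" "b < ?n" and xy: "x < ?m" "y < ?m"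
    have "(\<Sum>i<?m. \<Sum>j<?m. ent P i a * ent P j b * cb M i j x y)
       = (\<Sum>i<?m. \<Sum>j<?m. \<Sum>u\<in>UNIV. (ent (opr M (GC u)) y i * ent P i a) * (ent (opa M u) x j * ent P j b))"
      using xy by (simp add: cb_ent sum_distrib_left mult_ac)
    also have "\<dots> = (\<Sum>u\<in>UNIV. \<Sum>i<?m. \<Sum>j<?m. (ent (opr M (GC u)) y i * ent P i a) * (ent (opa M u) x j * ent P j b))"
      by (subst sum.swap[of _ UNIV], subst sum.swap[of _ UNIV]) simp
    also have "\<dots> = (\<Sum>u\<in>UNIV. ent (opr M (GC u) * P) y a * ent (opa M u * P) x b)"
      by (simp add: ent_mult[of ?m] Pz flip: sum_product)
    also have "\<dots> = (\<Sum>u\<in>UNIV. ent (P * opr N (GC u)) y a * ent (P * opa N u) x b)"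
      using P morph_opa[OF P] by (simp add: morph_def)
    also have "\<dots> = (\<Sum>u\<in>UNIV. \<Sum>j<?n. \<Sum>i<?n. (ent P y j * ent (opr N (GC u)) j a) * (ent P x i * ent (opa N u) i b))"
      by (simp add: ent_mult[of ?n] Pz flip: sum_product)
    also have "\<dots> = (\<Sum>u\<in>UNIV. \<Sum>i<?n. \<Sum>j<?n. (ent P y j * ent (opr N (GC u)) j a) * (ent P x i * ent (opa N u) i b))"
      by (rule sum.cong[OF refl sum.swap])
    also have "\<dots> = (\<Sum>i<?n. \<Sum>j<?n. \<Sum>u\<in>UNIV. (ent P y j * ent (opr N (GC u)) j a) * (ent P x i * ent (opa N u) i b))"
      by (subst sum.swap, subst (2) sum.swap) simp
    also have "\<dots> = (\<Sum>i<?n. \<Sum>j<?n. ent P x i * ent P y j * cb N a b i j)"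
      using ab by (simp add: cb_ent sum_distrib_left mult_ac)
    finally show "(\<Sum>i<?n. \<Sum>j<?n. ent P x i * ent P y j * cb N a b i j)
      = (\<Sum>i<?m. \<Sum>j<?m. ent P i a * ent P j b * cb M i j x y)" by simp
  qed
qed

lemma split_iso:
  assumes "split M (idn M) N"
  shows "yd_iso M N"
proof -
  obtain P R where P: "morph N M P" and R: "morph M N R" and RP: "R * P = idn N" and PR: "P * R = idn M"
    using assms by (auto simp: split_def)
  have "ydim N \<le> ydim M" using rank_bound[of R P] RP P by (simp add: morph_def idn_def)
  moreover have "ydim M \<le> ydim N" using rank_bound[of P R] PR R by (simp add: morph_def idn_def)
  ultimately have d: "ydim N = ydim M" by simp
  let ?d = "ydim M"
  have tP: "tr ?d ?d (ent P) = P" and tR: "tr ?d ?d (ent R) = R"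
    using P R d by (auto simp: morph_def idn_def intro!: tr_ent)
  have g: "meq ?d (mmul ?d (ent R) (gmat M g)) (mmul ?d (gmat N g) (ent R))" for g
    using R d unfolding meq_iff_tr tr_mmul tR morph_def opr_def by metis
  have 1: "meq ?d (mmul ?d (ent R) (ent P)) ident" and 2: "meq ?d (mmul ?d (ent P) (ent R)) ident"
    using RP PR d unfolding meq_iff_tr tr_mmul tR tP idn_def idm_def by auto
  show ?thesis unfolding yd_iso_def Let_def
    by (rule conjI, rule d[symmetric], rule exI[of _ "ent R"], rule exI[of _ "ent P"])
      (use 1 2 g[of GX] g[of GY] g[of GZ] g[of "GC _"] in auto)
qed

section \<open>Blocks of direct sums\<close>

definition sh :: "nat \<Rightarrow> nat \<Rightarrow> 'a::field fmat" where
  "sh s n = tr (s + n) n (\<lambda>i j. if i = s + j then 1 else 0)"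

definition shT :: "nat \<Rightarrow> nat \<Rightarrow> 'a::field fmat" where
  "shT s n = tr n (s + n) (\<lambda>i j. if j = s + i then 1 else 0)"

lemma shT_sh: "shT s n * sh s n = (idm n :: 'a::field fmat)"
proof (rule fmat_eqI)
  fix i j
  have "ent (shT s n * sh s n :: 'a fmat) i j = (\<Sum>k<s+n. ent (shT s n) i k * ent (sh s n) k j)"
    by (rule ent_mult) (simp add: shT_def)
  also have "\<dots> = (if s + i < s + n then (if i < n \<and> i = j then 1 else 0) else 0)"
    by (rule sum_single) (auto simp: sh_def shT_def)
  finally show "ent (shT s n * sh s n) i j = ent (idm n :: 'a fmat) i j" by auto
qed

lemma sh_shT: "sh s n * shT s n = (idm (s + n) - idm s :: 'a::field fmat)"
proof (rule fmat_eqI)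
  fix i j
  have "ent (sh s n * shT s n :: 'a fmat) i j = (\<Sum>k<n. ent (sh s n) i k * ent (shT s n) k j)"
    by (rule ent_mult) (simp add: sh_def)
  also have "\<dots> = (if i - s < n then (if s \<le> i \<and> i = j then 1 else 0) else 0)"
    by (rule sum_single) (auto simp: sh_def shT_def)
  finally show "ent (sh s n * shT s n) i j = ent (idm (s + n) - idm s :: 'a fmat) i j" by auto
qed

lemma sh_idm: "idm s * sh s n = 0" "shT s n * idm s = 0" "idm (s + n) * sh s n = sh s n"
  "shT s n * idm (s + n) = shT s n" "sh s n * idm n = sh s n" "idm n * shT s n = shT s n"
  by (auto intro!: fmat_eqI simp: idm_mult mult_idm sh_def shT_def)

lemma tr_blk: "tr (s + n) (s + n) (blk s A B) = tr s s A + sh s n * tr n n B * shT s n"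
proof (rule fmat_eqI)
  fix i j
  have 1: "ent (sh s n * tr n n B) i k = (if i - s < n then (if s \<le> i then ent (tr n n B) (i - s) k else 0) else 0)" for k
  proof -
    have "ent (sh s n * tr n n B) i k = (\<Sum>l<n. ent (sh s n) i l * ent (tr n n B) l k)"
      by (rule ent_mult) simp
    then show ?thesis by (subst (asm) sum_single) (auto simp: sh_def)
  qed
  have "ent (sh s n * tr n n B * shT s n) i j = (\<Sum>l<n. ent (sh s n * tr n n B) i l * ent (shT s n) l j)"
    by (rule ent_mult) (simp add: shT_def)
  also have "\<dots> = (if j - s < n then (if s \<le> i \<and> s \<le> j then ent (tr n n B) (i - s) (j - s) else 0) else 0)"
    by (rule sum_single) (auto simp: 1 shT_def)
  finally show "ent (tr (s + n) (s + n) (blk s A B)) i j = ent (tr s s A + sh s n * tr n n B * shT s n) i j"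
    by (auto simp: blk_def)
qed

lemma opr_dsum:
  "opr (dsum N1 N2) g = opr N1 g + sh (ydim N1) (ydim N2) * opr N2 g * shT (ydim N1) (ydim N2)"
  by (cases g) (simp_all add: opr_def dsum_def tr_blk)

lemma ydim_dsum [simp]: "ydim (dsum N1 N2) = ydim N1 + ydim N2"
  by (simp add: dsum_def)

lemma split_yd0: "split M 0 yd0"
proof -
  have "idn yd0 = (0::'a fmat)" by (auto intro!: fmat_eqI simp: idn_def yd0_def)
  moreover have "opr yd0 g = (0::'a fmat)" for g by (auto intro!: fmat_eqI simp: opr_def yd0_def)
  ultimately show ?thesis unfolding split_def morph_def by (intro exI[of _ 0]) simp
qed

text \<open>Orthogonality of \<open>e\<close> and \<open>e'\<close> annihilates the mixed products
  of inclusions and projections, so the two pairs can be placed side by side with the second one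
  shifted.\<close>

lemma split_dsum:
  assumes "split M e N1" "split M e' N2" and orth: "e * e' = 0" "e' * e = 0"
  shows "split M (e + e') (dsum N1 N2)"
proof -
  obtain P1 R1 P2 R2 where P1: "morph N1 M P1" and R1: "morph M N1 R1" and RP1: "R1 * P1 = idn N1" and e: "P1 * R1 = e"
    and P2: "morph N2 M P2" and R2: "morph M N2 R2" and RP2: "R2 * P2 = idn N2" and e': "P2 * R2 = e'"
    using assms unfolding split_def by metis
  let ?s = "ydim N1" and ?n = "ydim N2"
  let ?J = "sh ?s ?n :: 'a fmat" and ?K = "shT ?s ?n :: 'a fmat"
  have P1': "P1 = e * P1" "R1 = R1 * e" and P2': "P2 = e' * P2" "R2 = R2 * e'"
    using P1 R1 P2 R2 RP1 RP2 unfolding e[symmetric] e'[symmetric] morph_def by (metis mult.assoc)+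
  have cross: "R1 * P2 = 0" "R2 * P1 = 0"
    using P1' P2' orth by (metis mult.assoc mult_zero_left mult_zero_right)+
  have J: "A * ?J = 0" if "A * idn N1 = A" for A
    using that sh_idm(1) unfolding idn_def by (metis mult.assoc mult_zero_right)
  have K: "?K * A = 0" if "idn N1 * A = A" for A
    using that sh_idm(2) unfolding idn_def by (metis mult.assoc mult_zero_left)
  have JK: "?K * ?J = idn N2" by (simp add: shT_sh idn_def)
  have P1J: "P1 * ?J = 0" and KR1: "?K * R1 = 0" using P1 R1 by (auto simp: morph_def intro: J K)
  have oJ: "opr N1 g * ?J = 0" "?K * opr N1 g = 0" for g by (auto intro: J K)
  have KJA: "?K * (?J * A) = idn N2 * A" and P1JA: "P1 * (?J * A) = 0" and KR1A: "?K * (R1 * A) = 0"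
    and oJA: "opr N1 g * (?J * A) = 0" "?K * (opr N1 g * A) = 0"
    and R2A: "R2 * (P1 * A) = 0" "R1 * (P2 * A) = 0" "R1 * (P1 * A) = idn N1 * A" "R2 * (P2 * A) = idn N2 * A" for A g
    by (simp_all add: JK P1J KR1 oJ cross RP1 RP2 flip: mult.assoc)
  have i1: "idm (?s + ?n) * A = A" if "idn N1 * A = A" for A
    using that by (metis idn_def idm_idm mult.assoc min.absorb2 le_add1)
  have i2: "A * idm (?s + ?n) = A" if "A * idn N1 = A" for A
    using that by (metis idn_def idm_idm mult.assoc min.absorb1 le_add1)
  let ?P = "P1 + P2 * ?K" and ?R = "R1 + ?J * R2"
  have "morph (dsum N1 N2) M ?P"
    unfolding morph_def
  proof (intro conjI allI)
    show "idn M * ?P = ?P" using P1 P2 by (simp add: morph_def distrib_left flip: mult.assoc)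
    show "?P * idn (dsum N1 N2) = ?P"
    proof -
      have "P1 * idm (?s + ?n) = P1" using P1 by (intro i2) (simp add: morph_def)
      then show ?thesis by (simp add: idn_def distrib_right mult.assoc sh_idm)
    qed
    show "opr M g * ?P = ?P * opr (dsum N1 N2) g" for g
    proof -
      have "?P * opr (dsum N1 N2) g = P1 * opr N1 g + P2 * opr N2 g * ?K"
        by (simp add: opr_dsum distrib_left distrib_right mult.assoc KJA P1JA oJ oJA)
          (simp flip: mult.assoc)
      also have "\<dots> = opr M g * ?P" using P1 P2 by (simp add: morph_def distrib_left flip: mult.assoc)
      finally show ?thesis by simp
    qed
  qed
  moreover have "morph M (dsum N1 N2) ?R"
    unfolding morph_def
  proof (intro conjI allI)
    show "?R * idn M = ?R" using R1 R2 by (simp add: morph_def distrib_right mult.assoc)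
    show "idn (dsum N1 N2) * ?R = ?R"
    proof -
      have "idm (?s + ?n) * R1 = R1" using R1 by (intro i1) (simp add: morph_def)
      then show ?thesis by (simp add: idn_def distrib_left sh_idm flip: mult.assoc)
    qed
    show "opr (dsum N1 N2) g * ?R = ?R * opr M g" for g
    proof -
      have "opr (dsum N1 N2) g * ?R = opr N1 g * R1 + ?J * (opr N2 g * R2)"
        by (simp add: opr_dsum distrib_left distrib_right mult.assoc KJA KR1 oJA)
          (simp flip: mult.assoc)
      also have "\<dots> = ?R * opr M g" using R1 R2 by (simp add: morph_def distrib_right mult.assoc)
      finally show ?thesis by simp
    qed
  qed
  moreover have "?R * ?P = idn (dsum N1 N2)"
  proof -
    have "?R * ?P = idn N1 + ?J * ?K"
      by (simp add: distrib_left distrib_right mult.assoc cross RP1 RP2 R2A)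
        (simp add: idn_def sh_idm flip: mult.assoc)
    then show ?thesis by (simp add: sh_shT idn_def)
  qed
  moreover have "?P * ?R = e + e'"
    using P2 by (simp add: distrib_left distrib_right mult.assoc KR1 KJA P1JA e e')
       (simp add: morph_def e' flip: mult.assoc)
  ultimately show ?thesis unfolding split_def by blast
qed

text \<open>The identity of the sum is \<open>idm s\<close> plus the projection to the second block.
  Inserting each of them between inclusion and projection cuts \<open>e\<close> into two orthogonal
  pieces.\<close>

lemma split_dsumD:
  assumes "split M e (dsum N1 N2)"
  shows "\<exists>e1 e2. e = e1 + e2 \<and> split M e1 N1 \<and> split M e2 N2 \<and> e1 * e2 = 0 \<and> e2 * e1 = 0"
proof -
  obtain P R where P: "morph (dsum N1 N2) M P" and R: "morph M (dsum N1 N2) R"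
    and RP: "R * P = idn (dsum N1 N2)" and e: "P * R = e"
    using assms unfolding split_def by metis
  let ?s = "ydim N1" and ?n = "ydim N2"
  let ?J = "sh ?s ?n :: 'a fmat" and ?K = "shT ?s ?n :: 'a fmat"
  have RPA: "R * (P * A) = idm (?s + ?n) * A" for A by (simp add: RP idn_def flip: mult.assoc)
  have oJ: "opr N1 g * ?J = 0" "?K * opr N1 g = 0" for g
    using sh_idm(1,2)[of ?s ?n] idn_opr[of N1 g] unfolding idn_def
    by (metis mult.assoc mult_zero_right, metis mult.assoc mult_zero_left)
  have JKA: "?K * (?J * A) = idn N2 * A" for A by (simp add: shT_sh idn_def flip: mult.assoc)
  have opJ: "opr (dsum N1 N2) g * ?J = ?J * opr N2 g" for g
    by (simp add: opr_dsum distrib_right oJ mult.assoc shT_sh) (simp add: idn_def[symmetric])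
  have opK: "?K * opr (dsum N1 N2) g = opr N2 g * ?K" for g
    by (simp add: opr_dsum distrib_left oJ JKA mult.assoc) (simp flip: mult.assoc)
  have opI: "opr (dsum N1 N2) g * idm ?s = idm ?s * opr N1 g" for g
    by (simp add: opr_dsum distrib_right mult.assoc sh_idm) (simp add: idn_def[symmetric])
  have opI': "idm ?s * opr (dsum N1 N2) g = opr N1 g * idm ?s" for g
    by (simp add: opr_dsum distrib_left sh_idm flip: mult.assoc) (simp add: idn_def[symmetric])
  let ?e1 = "P * (idm ?s * R)" and ?e2 = "P * (?J * (?K * R))"
  have P': "idm (ydim M) * P = P" "opr M g * P = P * opr (dsum N1 N2) g"
    and R': "R * idm (ydim M) = R" "opr (dsum N1 N2) g * R = R * opr M g" for g
    using P R by (simp_all add: morph_def idn_def)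
  have m1: "morph N1 M (P * idm ?s)" unfolding morph_def
  proof (intro conjI allI)
    show "opr M g * (P * idm ?s) = P * idm ?s * opr N1 g" for g
      unfolding mult.assoc[symmetric] P' by (simp add: mult.assoc opI)
  qed (simp_all add: idn_def mult.assoc P' flip: mult.assoc[of _ P])
  have m2: "morph N2 M (P * ?J)" unfolding morph_def
  proof (intro conjI allI)
    show "opr M g * (P * ?J) = P * ?J * opr N2 g" for g
      unfolding mult.assoc[symmetric] P' by (simp add: mult.assoc opJ)
  qed (simp_all add: idn_def mult.assoc P' sh_idm flip: mult.assoc[of _ P])
  have m3: "morph M N1 (idm ?s * R)" unfolding morph_def
  proof (intro conjI allI)
    show "opr N1 g * (idm ?s * R) = idm ?s * R * opr M g" for g
      unfolding mult.assoc R'(2)[symmetric] unfolding mult.assoc[symmetric] opI' ..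
  qed (simp_all add: idn_def mult.assoc R' flip: mult.assoc[of _ _ R])
  have m4: "morph M N2 (?K * R)" unfolding morph_def
  proof (intro conjI allI)
    show "opr N2 g * (?K * R) = ?K * R * opr M g" for g
      unfolding mult.assoc R'(2)[symmetric] unfolding mult.assoc[symmetric] opK ..
  qed (simp_all add: idn_def mult.assoc R' sh_idm flip: mult.assoc[of _ _ R])
  note m = m1 m2 m3 m4
  have "split M ?e1 N1" unfolding split_def
    by (intro exI[of _ "P * idm ?s"] exI[of _ "idm ?s * R"] conjI m)
      (auto simp: mult.assoc RPA idn_def simp flip: mult.assoc[of "idm ?s" "idm ?s"])
  moreover have "split M ?e2 N2" unfolding split_def
    by (intro exI[of _ "P * ?J"] exI[of _ "?K * R"] conjI m)
      (auto simp: mult.assoc RPA idn_def sh_idm shT_sh)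
  moreover have "e = ?e1 + ?e2"
  proof -
    have "?e1 + ?e2 = P * ((idm ?s + ?J * ?K) * R)" by (simp add: distrib_left distrib_right mult.assoc)
    also have "\<dots> = P * (idm (?s + ?n) * R)" by (simp add: sh_shT)
    finally show ?thesis using R e by (simp add: morph_def idn_def)
  qed
  moreover have "?e1 * ?e2 = 0" "?e2 * ?e1 = 0"
  proof -
    have 1: "idm ?s * (?J * A) = 0" "?K * (idm ?s * A) = 0" for A
      by (simp_all add: sh_idm flip: mult.assoc)
    have 2: "idm (?s + ?n) * (?J * A) = ?J * A" "idm (?s + ?n) * (idm ?s * A) = idm ?s * A" for A
      by (simp_all add: sh_idm flip: mult.assoc)
    show "?e1 * ?e2 = 0" "?e2 * ?e1 = 0" by (simp_all add: mult.assoc RPA 1 2)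
  qed
  ultimately show ?thesis by blast
qed

text \<open>In \<open>split_simple\<close>, \<open>a i\<close> and \<open>b i\<close> are the first column and the first row of the matrix units of the
  block of \<open>S\<close> in the Drinfeld double, acting on \<open>M\<close>.\<close>

lemma split_simple:
  fixes S M :: "'a::field ydm"
  defines "s \<equiv> ydim S"
  assumes s: "0 < s"
    and D: "\<And>i. i < s \<Longrightarrow> idn M * a i = a i" "\<And>i. i < s \<Longrightarrow> b i * idn M = b i"
    and E: "\<And>i. i < s \<Longrightarrow> a i * E = a i" "\<And>i. i < s \<Longrightarrow> E * b i = b i"
    and ba: "\<And>i k. i < s \<Longrightarrow> k < s \<Longrightarrow> b i * a k = (if i = k then E else 0)"
    and op: "\<And>g i. i < s \<Longrightarrow> opr M g * a i = (\<Sum>k<s. sc (gmat S g k i) (a k))"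
    and op': "\<And>g i. i < s \<Longrightarrow> b i * opr M g = (\<Sum>k<s. sc (gmat S g i k) (b k))"
  shows "\<exists>n. split M (\<Sum>i<s. a i * b i) (dpow S n)"
proof -
  \<comment> \<open>\<open>E\<close> plays the role of the corner matrix unit; an idempotent
    \<open>f\<close> below it stands for the sub-module cut out by the displayed sum.
    \<open>G n f\<close> records that this sub-module consists of \<open>n\<close> copies of
    \<open>S\<close>.\<close>
  define G where "G n f \<longleftrightarrow> f * E = f \<and> E * f = f \<and> f * f = f \<and> split M (\<Sum>i<s. a i * f * b i) (dpow S n)" for n f
  have EE: "E * E = E"
    using ba[OF s s] E(1)[OF s] by (metis (full_types) mult.assoc)
  have G0: "G 0 0" by (simp add: G_def split_yd0)
  have bound: "n \<le> ydim M" if G: "G n f" for n f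
  proof -
    obtain P R where "morph (dpow S n) M P" "R * P = idn (dpow S n)"
      using G unfolding G_def split_def by blast
    then have "ydim (dpow S n) \<le> ydim M"
      by (intro rank_bound[of R P]) (auto simp: morph_def idn_def)
    moreover have "ydim (dpow S n) = n * s" by (induction n) (auto simp: s_def yd0_def)
    ultimately show ?thesis using s by (metis mult_le_mono2 nat_mult_1_right le_trans Suc_leI One_nat_def)
  qed
  \<comment> \<open>Every copy of \<open>S\<close> takes up dimension, so a maximal number exists;
    maximality will force \<open>f = E\<close>.\<close>
  define n where "n = (GREATEST n. \<exists>f. G n f)"
  have "\<exists>f. G n f" unfolding n_def
    by (rule GreatestI_nat[where b = "ydim M"]) (use G0 bound in auto)
  then obtain f where f: "G n f" by blast
  have "f = E"
  proof (rule ccontr)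
    assume "f \<noteq> E"
    define g where "g = E - f"
    have fE: "f * E = f" "E * f = f" "f * f = f" using f by (auto simp: G_def)
    have g: "g * g = g" "E * g = g" "g * E = g" "f * g = 0" "g * f = 0"
      by (simp_all add: g_def algebra_simps fE EE)
    have "g \<noteq> 0" using \<open>f \<noteq> E\<close> by (simp add: g_def)
    then obtain p r where pr: "ent g p r \<noteq> 0" by (metis fmat_eqI ent_ring(1))
    \<comment> \<open>A nonzero entry of the remaining idempotent \<open>g\<close> yields a column
      \<open>v\<close> and a rescaled row \<open>\<phi>\<close> whose product is 1. Then
      \<open>v * \<phi>\<close> is a rank-one idempotent below \<open>g\<close> and splits off one
      further copy of \<open>S\<close>.\<close>
    define v where "v = g * eu r 0"
    define \<phi> where "\<phi> = sc (1 / ent g p r) (eu 0 p * g)"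
    have "eu 0 p * (g * eu r 0) = sc (ent g p r) (eu 0 0)" by (rule fmat_eqI) auto
    then have \<phi>v: "\<phi> * v = eu 0 0" using pr
      by (simp add: \<phi>_def v_def mult.assoc) (simp add: g flip: mult.assoc[of g g])
    have Ev: "E * v = v" "\<phi> * E = \<phi>" using g by (simp_all add: v_def \<phi>_def mult.assoc) (simp flip: mult.assoc)
    have ve: "v * eu 0 0 = v" by (simp add: v_def mult.assoc)
    define h where "h = v * \<phi>"
    have h: "h * h = h" using ve by (simp add: h_def mult.assoc) (metis \<phi>v mult.assoc)
    have gh: "g * h = h" "h * g = h" by (simp_all add: h_def v_def \<phi>_def g mult.assoc) (simp add: g flip: mult.assoc)
    have Eh: "E * h = h" "h * E = h" using gh g by (metis mult.assoc)+
    have fh: "f * h = 0" "h * f = 0" using gh g by (metis mult.assoc mult_zero_left mult_zero_right)+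
    have bX: "b i * (a k * X) = (if i = k then E * X else 0)" if "i < s" "k < s" for i k X
      using ba[OF that] by (simp flip: mult.assoc)
    define P where "P = (\<Sum>i<s. a i * v * eu 0 i)"
    define R where "R = (\<Sum>i<s. eu i 0 * \<phi> * b i)"
    have RP: "R * P = idn S"
    proof -
      have "R * P = (\<Sum>i<s. \<Sum>k<s. eu i 0 * (\<phi> * (b i * (a k * (v * eu 0 k)))))"
        by (simp add: P_def R_def sum_product mult.assoc)
      also have "\<dots> = (\<Sum>i<s. \<Sum>k<s. if k = i then eu i 0 * (\<phi> * (E * (v * eu 0 i))) else 0)"
        by (intro sum.cong) (auto simp: bX)
      also have "\<dots> = (\<Sum>i<s. eu i 0 * (\<phi> * (v * eu 0 i)))"
        by (simp add: Ev flip: mult.assoc[of E])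
      also have "\<dots> = (\<Sum>i<s. eu i i)" by (simp add: \<phi>v flip: mult.assoc[of \<phi>])
      also have "\<dots> = idn S"
      proof (rule fmat_eqI)
        fix i j
        have "(\<Sum>k<s. ent (eu k k) i j) = (if i < s then (if i = j then 1 else 0) else 0 :: 'a)"
          by (rule sum_single) auto
        then show "ent (\<Sum>i<s. eu i i) i j = ent (idn S) i j"
          by (auto simp: ent_sum idn_def s_def)
      qed
      finally show ?thesis .
    qed
    have PR: "P * R = (\<Sum>i<s. a i * h * b i)"
    proof -
      have "P * R = (\<Sum>i<s. \<Sum>k<s. if k = i then a i * (v * (eu 0 0 * (\<phi> * b i))) else 0)"
        unfolding P_def R_def sum_product
        by (intro sum.cong) (auto simp: mult.assoc simp flip: mult.assoc[of "eu 0 _" "eu _ 0"])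
      also have "\<dots> = (\<Sum>i<s. a i * h * b i)"
        by (simp add: h_def mult.assoc) (metis ve mult.assoc)
      finally show ?thesis .
    qed
    have eus: "eu 0 k * opr S g = (\<Sum>i<s. sc (gmat S g k i) (eu 0 i))" if "k < s" for k g
      by (rule fmat_eqI) (use that in \<open>auto simp: ent_sum opr_def s_def[symmetric] if_distrib cong: if_cong\<close>)
    have eus': "opr S g * eu k 0 = (\<Sum>i<s. sc (gmat S g i k) (eu i 0))" if "k < s" for k g
      by (rule fmat_eqI) (use that in \<open>auto simp: ent_sum opr_def s_def[symmetric] if_distrib cong: if_cong\<close>)
    have mP: "morph S M P" unfolding morph_def
    proof (intro conjI allI)
      show "idn M * P = P" unfolding P_def sum_distrib_left
        by (rule sum.cong) (simp_all add: D flip: mult.assoc)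
      show "P * idn S = P" unfolding P_def sum_distrib_right
      proof (rule sum.cong)
        fix i assume "i \<in> {..<s}"
        then have "eu 0 i * idn S = (eu 0 i :: 'a fmat)" by (auto intro!: fmat_eqI simp: idn_def s_def mult_idm)
        then show "a i * v * eu 0 i * idn S = a i * v * eu 0 i" by (simp add: mult.assoc)
      qed simp
      show "opr M g * P = P * opr S g" for g
      proof -
        have "opr M g * P = (\<Sum>i<s. \<Sum>k<s. sc (gmat S g k i) (a k * (v * eu 0 i)))"
          unfolding P_def sum_distrib_left
          by (rule sum.cong) (simp_all add: op sum_distrib_right flip: mult.assoc)
        also have "\<dots> = (\<Sum>k<s. \<Sum>i<s. sc (gmat S g k i) (a k * (v * eu 0 i)))"
          by (rule sum.swap)
        also have "\<dots> = P * opr S g"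
          unfolding P_def sum_distrib_right
          by (rule sum.cong) (simp_all add: eus sum_distrib_left mult.assoc)
        finally show ?thesis .
      qed
    qed
    have mR: "morph M S R" unfolding morph_def
    proof (intro conjI allI)
      show "R * idn M = R" unfolding R_def sum_distrib_right
        by (rule sum.cong) (simp_all add: D mult.assoc)
      show "idn S * R = R" unfolding R_def sum_distrib_left
      proof (rule sum.cong)
        fix i assume "i \<in> {..<s}"
        then have "idn S * eu i 0 = (eu i 0 :: 'a fmat)" by (auto intro!: fmat_eqI simp: idn_def s_def idm_mult)
        then show "idn S * (eu i 0 * \<phi> * b i) = eu i 0 * \<phi> * b i" by (simp flip: mult.assoc)
      qed simp
      show "opr S g * R = R * opr M g" for g
      proof -
        have "R * opr M g = (\<Sum>i<s. \<Sum>k<s. sc (gmat S g i k) (eu i 0 * (\<phi> * b k)))"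
          unfolding R_def sum_distrib_right
          by (rule sum.cong) (simp_all add: op' sum_distrib_left mult.assoc)
        also have "\<dots> = (\<Sum>k<s. \<Sum>i<s. sc (gmat S g i k) (eu i 0 * (\<phi> * b k)))"
          by (rule sum.swap)
        also have "\<dots> = opr S g * R"
          unfolding R_def sum_distrib_left
          by (rule sum.cong) (simp_all add: eus' sum_distrib_right flip: mult.assoc)
        finally show ?thesis by simp
      qed
    qed
    have sS: "split M (\<Sum>i<s. a i * h * b i) S" using mP mR RP PR by (auto simp: split_def)
    have orth: "(\<Sum>i<s. a i * x * b i) * (\<Sum>i<s. a i * y * b i) = 0" if "x * (E * y) = 0" for x y
    proof -
      have "(\<Sum>i<s. a i * x * b i) * (\<Sum>i<s. a i * y * b i) = (\<Sum>i<s. \<Sum>k<s. a i * (x * (b i * (a k * (y * b k)))))"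
        by (simp add: sum_product mult.assoc)
      also have "\<dots> = 0"
      proof (intro sum.neutral ballI)
        fix i k assume "i \<in> {..<s}" "k \<in> {..<s}"
        moreover have "x * (E * (y * c)) = 0" for c
          using that by (metis mult.assoc mult_zero_left)
        ultimately show "a i * (x * (b i * (a k * (y * b k)))) = 0" by (simp add: bX)
      qed
      finally show ?thesis .
    qed
    have "split M ((\<Sum>i<s. a i * f * b i) + (\<Sum>i<s. a i * h * b i)) (dsum (dpow S n) S)"
      by (rule split_dsum) (use f sS orth Eh fE fh in \<open>auto simp: G_def\<close>)
    then have "G (Suc n) (f + h)"
      by (simp add: G_def distrib_left distrib_right sum.distrib fE fh h Eh)
    then have "Suc n \<le> n" unfolding n_def
      by (intro Greatest_le_nat[where b = "ydim M"]) (use bound in auto)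
    then show False by simp
  qed
  then have "split M (\<Sum>i<s. a i * b i) (dpow S n)" using f E by (simp add: G_def)
  then show ?thesis ..
qed

section \<open>The operators of a Yetter-Drinfeld module\<close>

lemma UNIV_hb: "(UNIV :: hb set) = {(False, False, False), (False, False, True), (False, True, False),
   (False, True, True), (True, False, False), (True, False, True), (True, True, False), (True, True, True)}"
  by auto

lemma sum_hb: "(\<Sum>u\<in>UNIV. f (u::hb)) = f (False, False, False) + f (False, False, True)
   + f (False, True, False) + f (False, True, True) + f (True, False, False) + f (True, False, True)
   + f (True, True, False) + f (True, True, True)"
  unfolding UNIV_hb by (simp add: add_ac)

lemma sum_hbas: "(\<Sum>v\<in>UNIV. hbas u v * f v) = (f u :: 'a::field)"
proof -
  have "(\<Sum>v\<in>UNIV. hbas u v * f v) = (\<Sum>v\<in>UNIV. if v = u then f v else 0)"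
    by (rule sum.cong) (auto simp: hbas_def)
  then show ?thesis by simp
qed

lemma sum_sc_hbas: "(\<Sum>v\<in>UNIV. sc (hbas u v) (f v)) = (f u :: 'a::field fmat)"
proof -
  have "(\<Sum>v\<in>UNIV. sc (hbas u v) (f v)) = (\<Sum>v\<in>UNIV. if v = u then f v else 0)"
    by (rule sum.cong) (auto simp: hbas_def)
  then show ?thesis by simp
qed

lemma sum_tens_hbas: "(\<Sum>p\<in>UNIV. tens (hbas a) (hbas b) p * f p) = (f (a, b) :: 'a::field)"
proof -
  have "(\<Sum>p\<in>UNIV. tens (hbas a) (hbas b) p * f p) = (\<Sum>p\<in>UNIV. if p = (a, b) then f p else 0)"
    by (rule sum.cong) (auto simp: hbas_def tens_def split: if_splits)
  then show ?thesis by simp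
qed

lemma hmul_hbas: "hmul (hbas u) (hbas v) = (bmul u v :: hb \<Rightarrow> 'a::field_char_0)"
  by (simp add: hmul_def mult.assoc sum_hbas flip: sum_distrib_left)

lemma hmul2_tens: "hmul2 (tens (hbas a) (hbas b)) (tens (hbas c) (hbas d))
   = (tens (bmul a c) (bmul b d) :: hb \<times> hb \<Rightarrow> 'a::field_char_0)"
  by (simp add: fun_eq_iff hmul2_def mult.assoc sum_tens_hbas flip: sum_distrib_left)
    (simp add: tens_def)

lemma hmul2_lin1: "hmul2 (\<lambda>p. (f1 p + f2 p + f3 p - f4 p) / 2) k
   = (\<lambda>w. (hmul2 f1 k w + hmul2 f2 k w + hmul2 f3 k w - hmul2 f4 k w) / 2)"
  by (auto simp: fun_eq_iff hmul2_def sum.distrib sum_subtractf sum_divide_distrib add_divide_distrib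
      diff_divide_distrib algebra_simps)

lemma hmul2_lin2: "hmul2 k (\<lambda>p. (f1 p + f2 p + f3 p - f4 p) / 2)
   = (\<lambda>w. (hmul2 k f1 w + hmul2 k f2 w + hmul2 k f3 w - hmul2 k f4 w) / 2)"
  by (auto simp: fun_eq_iff hmul2_def sum.distrib sum_subtractf sum_divide_distrib add_divide_distrib
      diff_divide_distrib algebra_simps)

lemma bmul_grp: "bmul (a, b, False) (d, e, f) = hbas (a \<noteq> d, b \<noteq> e, f)"
  "bmul (a, b, True) (d, e, False) = hbas (a \<noteq> e, b \<noteq> d, True)"
  by (simp_all add: bmul_def)

lemma cop_z: "cop_z = (\<lambda>w. (tens (hbas ez) (hbas ez) w + tens (hbas ez) (hbas (True, False, True)) w
   + tens (hbas (False, True, True)) (hbas ez) w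
   - tens (hbas (False, True, True)) (hbas (True, False, True)) w) / (2::'a::field_char_0))"
  unfolding cop_z_def hmul2_lin1 hmul2_tens by (simp add: e1_def ex_def ey_def ez_def bmul_grp)

lemma cop_grp: "cop (a, b, False) = tens (hbas (a, b, False)) (hbas (a, b, False))"
  unfolding cop_def by (simp add: cop_x_def cop_y_def cop_one_def hmul2_tens e1_def ex_def ey_def bmul_grp)

lemma cop_zb: "cop (a, b, True) = (\<lambda>w. (tens (hbas (a, b, True)) (hbas (a, b, True)) w
   + tens (hbas (a, b, True)) (hbas (\<not> a, b, True)) w + tens (hbas (a, \<not> b, True)) (hbas (a, b, True)) w
   - tens (hbas (a, \<not> b, True)) (hbas (\<not> a, b, True)) w) / (2::'a::field_char_0))"
proof -
  have 1: "hmul2 (if a then cop_x else cop_one) (if b then cop_y else cop_one)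
     = (tens (hbas (a, b, False)) (hbas (a, b, False)) :: _ \<Rightarrow> 'a)"
    by (simp add: cop_x_def cop_y_def cop_one_def hmul2_tens e1_def ex_def ey_def bmul_grp)
  show ?thesis unfolding cop_def
    by (simp add: 1) (simp add: cop_z hmul2_lin2 hmul2_tens bmul_grp ez_def)
qed

lemma sum_tens:
  "(\<Sum>p\<in>UNIV. \<Sum>q\<in>UNIV. sc (tens (hbas u) (hbas v) (p, q)) (H p q)) = (H u v :: 'a::field fmat)"
proof -
  have "sc (tens (hbas u) (hbas v) (p, q)) (H p q) = sc (hbas u p) (sc (hbas v q) (H p q))" for p q
    by (simp add: tens_def)
  then show ?thesis by (simp add: sum_sc_hbas del: fmat.scale_scale flip: fmat.scale_sum_right)
qed

lemma sum_cop_grp: "(\<Sum>p\<in>UNIV. \<Sum>q\<in>UNIV. sc (cop (a, b, False) (p, q)) (H p q)) = H (a, b, False) (a, b, False)"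
  by (simp add: cop_grp sum_tens)

lemma sum_cop_z: "(\<Sum>p\<in>UNIV. \<Sum>q\<in>UNIV. sc (cop (a, b, True) (p, q)) (H p q))
  = sc (1/2) (H (a, b, True) (a, b, True) + H (a, b, True) (\<not> a, b, True)
     + H (a, \<not> b, True) (a, b, True) - H (a, \<not> b, True) (\<not> a, b, True) :: 'a::field_char_0 fmat)"
proof -
  have sc_half: "sc ((x1 + x2 + x3 - x4) / 2) A = sc (1/2) (sc x1 A + sc x2 A + sc x3 A - sc x4 A)"
    for x1 x2 x3 x4 :: 'a and A by (rule fmat_eqI) (simp add: field_simps)
  show ?thesis
    unfolding cop_zb sc_half
    by (simp only: sum.distrib sum_subtractf sum_tens flip: fmat.scale_sum_right)
qed

text \<open>The iterated coproduct applies the coproduct again to the left leg, so the sums over two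
  legs can be evaluated twice in a row.\<close>

lemma sum_cop2:
  "(\<Sum>p\<in>UNIV. \<Sum>q\<in>UNIV. \<Sum>r\<in>UNIV. sc (cop2 t (p, q, r)) (H p q r))
   = (\<Sum>u\<in>UNIV. \<Sum>r\<in>UNIV. sc (cop t (u, r)) (\<Sum>p\<in>UNIV. \<Sum>q\<in>UNIV. sc (cop u (p, q)) (H p q r)))"
proof -
  let ?F = "\<lambda>p q r u. sc (cop t (u, r) * cop u (p, q)) (H p q r)"
  have "(\<Sum>p\<in>UNIV. \<Sum>q\<in>UNIV. \<Sum>r\<in>UNIV. sc (cop2 t (p, q, r)) (H p q r))
    = (\<Sum>p\<in>UNIV. \<Sum>q\<in>UNIV. \<Sum>r\<in>UNIV. \<Sum>u\<in>UNIV. ?F p q r u)"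
    by (simp only: cop2_def prod.case fmat.scale_sum_left)
  also have "\<dots> = (\<Sum>u\<in>UNIV. \<Sum>p\<in>UNIV. \<Sum>q\<in>UNIV. \<Sum>r\<in>UNIV. ?F p q r u)"
    by (subst (4) sum.swap, subst (3) sum.swap, subst sum.swap) simp
  also have "\<dots> = (\<Sum>u\<in>UNIV. \<Sum>r\<in>UNIV. \<Sum>p\<in>UNIV. \<Sum>q\<in>UNIV. ?F p q r u)"
    by (rule sum.cong[OF refl], subst (3) sum.swap, subst sum.swap) simp
  finally show ?thesis by (simp add: fmat.scale_sum_right)
qed

section \<open>Relations between the action and the coaction operators\<close>

locale yd_module =
  fixes M :: "'a::field_char_0 ydm"
  assumes yd: "is_yd M"
begin

abbreviation "I \<equiv> idn M"
abbreviation "X \<equiv> opr M GX"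
abbreviation "Y \<equiv> opr M GY"
abbreviation "Z \<equiv> opr M GZ"
abbreviation "C a b c \<equiv> opr M (GC (a, b, c))"

lemma XX: "X * X = I" and YY: "Y * Y = I" and XY: "X * Y = Y * X"
  and ZX: "Z * X = Y * Z" and ZY: "Z * Y = X * Z" and ZZ: "Z * Z = sc (1/2) (I + X + Y - X * Y)"
  using yd unfolding is_yd_def Let_def meq_iff_tr tr_mmul tr_lin
  by (auto simp: opr_def idn_def idm_def)

lemma counit: "(\<Sum>u\<in>UNIV. opr M (GC u)) = I"
  using yd unfolding is_yd_def Let_def meq_iff_tr tr_mmul tr_lin cou_def tr_sum
  by (simp add: opr_def idn_def idm_def)

text \<open>The coaction coefficients represent the opposite of the dual algebra of H8, whence the
  exchanged order of \<open>q\<close> and \<open>p\<close>.\<close>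

lemma coassoc: "opr M (GC q) * opr M (GC p) = (\<Sum>u\<in>UNIV. sc (cop u (p, q)) (opr M (GC u)))"
  using yd unfolding is_yd_def Let_def meq_iff_tr tr_mmul tr_lin tr_sum
  unfolding opr_def gmat.simps by (metis (no_types, lifting))

lemma yd_compat: "opr M (GC w) * opa M t = (\<Sum>p\<in>UNIV. \<Sum>q\<in>UNIV. \<Sum>r\<in>UNIV. sc (cop2 t (p, q, r))
    (\<Sum>u\<in>UNIV. sc (hmul (hmul (hbas p) (hbas u)) (anti r) w) (opa M q * opr M (GC u))))"
proof -
  have "opr M (GC w) * opa M t = (\<Sum>p\<in>UNIV. \<Sum>q\<in>UNIV. \<Sum>r\<in>UNIV. \<Sum>u\<in>UNIV.
     sc (cop2 t (p, q, r) * hmul (hmul (hbas p) (hbas u)) (anti r) w) (opa M q * opr M (GC u)))"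
    using yd unfolding is_yd_def Let_def meq_iff_tr tr_mmul tr_lin tr_sum tr_act
    unfolding opr_def gmat.simps by blast
  then show ?thesis by (simp add: fmat.scale_sum_right)
qed

lemma opa_simps: "opa M (False, False, False) = I" "opa M (True, False, False) = X" "opa M (False, True, False) = Y"
  "opa M (False, False, True) = Z" "opa M (True, False, True) = X * Z" "opa M (False, True, True) = Y * Z"
  "opa M (True, True, True) = X * Y * Z" "opa M (True, True, False) = X * Y"
  by (simp_all add: opa_def mult.assoc) (simp_all flip: mult.assoc)

lemma anti_simps: "anti (False, False, True) = hbas (False, False, True)"
  "anti (True, False, True) = hbas (False, True, True)"
  "anti (True, False, False) = hbas (True, False, False)" "anti (False, True, False) = hbas (False, True, False)"
  by (simp_all add: anti_def hmul_hbas e1_def ex_def ey_def ez_def bmul_grp)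

text \<open>Conjugation by x fixes the group-likes. Since zx = yz, it multiplies x^a y^b z by xy,
  which flips both indices.\<close>

lemma C_X: "C a b c * X = (if c then X * C (\<not> a) (\<not> b) c else X * C a b c)"
proof -
  have "C a b c * X = (\<Sum>u\<in>UNIV. sc (hmul (hmul (hbas (True, False, False)) (hbas u)) (hbas (True, False, False)) (a, b, c)) (X * opr M (GC u)))"
    using yd_compat[of "(a, b, c)" "(True, False, False)"]
    unfolding sum_cop2 sum_cop_grp opa_simps anti_simps by simp
  also have "\<dots> = (if c then X * C (\<not> a) (\<not> b) c else X * C a b c)"
    by (cases a; cases b; cases c)
      (simp_all add: sum_hb hmul_hbas bmul_grp, simp_all add: hbas_def)
  finally show ?thesis .
qed

lemma C_Y: "C a b c * Y = (if c then Y * C (\<not> a) (\<not> b) c else Y * C a b c)"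
proof -
  have "C a b c * Y = (\<Sum>u\<in>UNIV. sc (hmul (hmul (hbas (False, True, False)) (hbas u)) (hbas (False, True, False)) (a, b, c)) (Y * opr M (GC u)))"
    using yd_compat[of "(a, b, c)" "(False, True, False)"]
    unfolding sum_cop2 sum_cop_grp opa_simps anti_simps by simp
  also have "\<dots> = (if c then Y * C (\<not> a) (\<not> b) c else Y * C a b c)"
    by (cases a; cases b; cases c)
      (simp_all add: sum_hb hmul_hbas bmul_grp, simp_all add: hbas_def)
  finally show ?thesis .
qed

text \<open>Applying the four-term coproduct twice gives sixteen summands. The left leg is always z
  or yz and the right leg z or xz; \<open>C_Z_eval\<close> regroups the terms by the middle leg,
  which acts on the module.\<close>

lemma C_Z_raw: "opr M (GC w) * Z = (let H = \<lambda>p q r. \<Sum>u\<in>UNIV. sc (hmul (hmul (hbas p) (hbas u)) (anti r) w) (opa M q * opr M (GC u));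
     z = (False, False, True); xz = (True, False, True); yz = (False, True, True); xyz = (True, True, True) in
     sc (1/4) (H z z z + H z xz z + H yz z z - H yz xz z + H z z xz + H z xz xz + H yz z xz - H yz xz xz
      + H yz yz z + H yz xyz z + H z yz z - H z xyz z - H yz yz xz - H yz xyz xz - H z yz xz + H z xyz xz))"
proof -
  have "sc (1/2) (sc (1/2) (a1 + a2 + a3 - a4) + sc (1/2) (b1 + b2 + b3 - b4) + sc (1/2) (c1 + c2 + c3 - c4)
     - sc (1/2) (d1 + d2 + d3 - d4)) = sc (1/4) (a1 + a2 + a3 - a4 + b1 + b2 + b3 - b4 + c1 + c2 + c3 - c4 - d1 - d2 - d3 + d4)"
    for a1 a2 a3 a4 b1 b2 b3 b4 c1 c2 c3 c4 d1 d2 d3 d4 :: "'a fmat"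
    by (rule fmat_eqI) (simp add: field_simps)
  then show ?thesis
    using yd_compat[of w "(False, False, True)"]
    unfolding sum_cop2 sum_cop_z Let_def by (simp add: opa_simps)
qed

lemma hmul_lin1: "hmul (\<lambda>p. (f1 p + f2 p + f3 p - f4 p) / 2) k
   = (\<lambda>w. (hmul f1 k w + hmul f2 k w + hmul f3 k w - hmul f4 k w) / (2::'a))"
  by (auto simp: fun_eq_iff hmul_def sum.distrib sum_subtractf sum_divide_distrib add_divide_distrib
      diff_divide_distrib algebra_simps)

lemma bmul_zz: "bmul (a, b, True) (d, e, True) = (\<lambda>w. (hbas (a \<noteq> e, b \<noteq> d, False) w + hbas (\<not> (a \<noteq> e), b \<noteq> d, False) w
     + hbas (a \<noteq> e, \<not> (b \<noteq> d), False) w - hbas (\<not> (a \<noteq> e), \<not> (b \<noteq> d), False) w) / (2::'a))"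
  by (simp add: bmul_def)

lemma C_Z_eval:
  "opr M (GC w) * Z = (let z = (False, False, True); k = \<lambda>u p r. hmul (hmul (hbas p) (hbas u)) (anti r) w;
     yz = (False, True, True); xz = (True, False, True) in
     (\<Sum>u\<in>UNIV.
       sc ((k u z z + k u yz z + k u z xz + k u yz xz) / 4) (Z * opr M (GC u))
     + sc ((k u z z - k u yz z + k u z xz - k u yz xz) / 4) (X * Z * opr M (GC u))
     + sc ((k u yz z + k u z z - k u yz xz - k u z xz) / 4) (Y * Z * opr M (GC u))
     + sc ((k u yz z - k u z z - k u yz xz + k u z xz) / 4) (X * Y * Z * opr M (GC u))))"
  unfolding C_Z_raw Let_def opa_simps sum.distrib[symmetric] sum_subtractf[symmetric] fmat.scale_sum_right
  by (rule sum.cong[OF refl], rule fmat_eqI) (simp add: field_simps)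

lemmas k_eval = hmul_hbas bmul_grp bmul_zz hmul_lin1 anti_simps

lemma C_Z:
  "C False False False * Z = sc (1/4) (
      (Z + X * Z + Y * Z + X * Y * Z) * C False False False + (Z + X * Z - Y * Z - X * Y * Z) * C False True False
    + (Z - X * Z + Y * Z - X * Y * Z) * C True False False + (Z - X * Z - Y * Z + X * Y * Z) * C True True False)"
  "C False True False * Z = sc (1/4) (
      (Z - X * Z + Y * Z - X * Y * Z) * C False False False + (Z - X * Z - Y * Z + X * Y * Z) * C False True False
    + (Z + X * Z + Y * Z + X * Y * Z) * C True False False + (Z + X * Z - Y * Z - X * Y * Z) * C True True False)"
  "C True False False * Z = sc (1/4) (
      (Z + X * Z - Y * Z - X * Y * Z) * C False False False + (Z + X * Z + Y * Z + X * Y * Z) * C False True False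
    + (Z - X * Z - Y * Z + X * Y * Z) * C True False False + (Z - X * Z + Y * Z - X * Y * Z) * C True True False)"
  "C True True False * Z = sc (1/4) (
      (Z - X * Z - Y * Z + X * Y * Z) * C False False False + (Z - X * Z + Y * Z - X * Y * Z) * C False True False
    + (Z + X * Z - Y * Z - X * Y * Z) * C True False False + (Z + X * Z + Y * Z + X * Y * Z) * C True True False)"
  "C False False True * Z = sc (1/2) (Z * (C False False True + C True False True) + X * Y * Z * (C True True True - C False True True))"
  "C True False True * Z = sc (1/2) (Z * (C False True True + C True True True) + X * Y * Z * (C True False True - C False False True))"
  "C False True True * Z = sc (1/2) (Z * (C False False True + C True False True) - X * Y * Z * (C True True True - C False True True))"
  "C True True True * Z = sc (1/2) (Z * (C False True True + C True True True) - X * Y * Z * (C True False True - C False False True))"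
  unfolding C_Z_eval Let_def sum_hb k_eval
  by (simp_all add: k_eval, simp_all add: hbas_def) (auto intro!: fmat_eqI simp: field_simps)

lemma C_C_same: "C a b False * C a b False = C a b False"
  unfolding coassoc by (cases a; cases b) (simp_all add: sum_hb cop_grp cop_zb tens_def hbas_def)

lemma C_C_grp: "\<not> (a = c \<and> b = d \<and> \<not> e) \<Longrightarrow> C a b False * C c d e = 0"
  unfolding coassoc by (cases a; cases b; cases c; cases d; cases e) (simp_all add: sum_hb cop_grp cop_zb tens_def hbas_def)

lemma C_C_grp': "C c d True * C a b False = 0"
  unfolding coassoc by (cases a; cases b; cases c; cases d) (simp_all add: sum_hb cop_grp cop_zb tens_def hbas_def)

lemma C_C_z: "C c d True * C a b True
   = (if b = d then sc (1/2) (C a b True) else sc (if a = c then 1/2 else -1/2) (C a (\<not> b) True))"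
  unfolding coassoc by (cases a; cases b; cases c; cases d) (simp_all add: sum_hb cop_grp cop_zb tens_def hbas_def)

text \<open>\<open>K\<close>, \<open>P\<close>, \<open>Q\<close>, \<open>J\<close> are the Fourier transforms, over the group generated by \<open>x\<close> and \<open>y\<close>, of the
  coaction coefficients on the coalgebra spanned by \<open>z, xz, yz, xyz\<close>. They span its dual, a
  \<open>2 \<times> 2\<close> matrix algebra with unit \<open>K\<close>.\<close>

definition "G a b = C a b False"
definition "K = C False False True + C True False True + C False True True + C True True True"
definition "J = C False False True - C True False True - C False True True + C True True True"
definition "P = C False False True - C True False True + C False True True - C True True True"
definition "Q = C False False True + C True False True - C False True True - C True True True"

lemma G_G: "G a b * G c d = (if a = c \<and> b = d then G a b else 0)"
  by (auto simp: G_def C_C_same C_C_grp)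

lemma G_K: "G a b * K = 0" "K * G a b = 0" "G a b * J = 0" "J * G a b = 0" "G a b * P = 0" "P * G a b = 0"
   "G a b * Q = 0" "Q * G a b = 0"
  by (simp_all add: G_def K_def J_def P_def Q_def distrib_left distrib_right right_diff_distrib left_diff_distrib C_C_grp C_C_grp')

text \<open>The table of a 2 by 2 matrix algebra with unit \<open>K\<close>: \<open>J\<close> has
  square \<open>- K\<close>, \<open>P\<close> has square \<open>K\<close>, and they anticommute with
  product \<open>Q\<close>.\<close>

lemma KJPQ: "K * K = K" "K * J = J" "J * K = J" "K * P = P" "P * K = P" "J * J = - K" "P * P = K" "J * P = Q" "P * J = - Q"
  by (simp_all add: K_def J_def P_def Q_def distrib_left distrib_right right_diff_distrib left_diff_distrib C_C_z)
    (auto intro!: fmat_eqI simp: field_simps)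

lemma G_X: "G a b * X = X * G a b" and G_Y: "G a b * Y = Y * G a b"
  by (simp_all add: G_def C_X C_Y)

lemma KJPQ_X: "K * X = X * K" "J * X = X * J" "P * X = - (X * P)" "K * Y = Y * K" "J * Y = Y * J" "P * Y = - (Y * P)"
  by (simp_all add: K_def J_def P_def C_X C_Y algebra_simps)

lemma KJPQ_Z: "K * Z = Z * K" "J * Z = X * Y * Z * J" "P * Z = Z * Q"
  by (simp_all add: K_def J_def P_def Q_def distrib_right left_diff_distrib C_Z)
    (auto intro!: fmat_eqI simp: field_simps distrib_left right_diff_distrib)

lemma sum_G_K: "G False False + G True False + G False True + G True True + K = I"
  using counit unfolding sum_hb by (simp add: G_def K_def add_ac)

end

section \<open>Diagonal braidings of the simple modules\<close>

lemma nichols_fin_cong: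
  assumes "\<And>i j l k. i < d \<Longrightarrow> j < d \<Longrightarrow> l < d \<Longrightarrow> k < d \<Longrightarrow> c i j l k = c' i j l k" "nichols_fin d c"
  shows "nichols_fin d c'"
proof (rule nichols_fin_embed[where P = "\<lambda>_. ident" and Q = "\<lambda>_. ident", OF assms(2)])
  show "(\<Sum>x<d. ident i x * ident x j) = (if i = j then 1 else 0)" if "i < d" for i j
    by (subst sum_single[where m = i and c = "if i = j then 1 else 0"]) (use that in \<open>auto simp: ident_def\<close>)
  fix a b x y assume *: "a < d" "b < d" "x < d" "y < d"
  have 1: "(\<Sum>j<d. ident x i * ident y j * c' a b i j) = (if y < d then (if i = x then c' a b x y else 0) else 0)" for i
    by (rule sum_single) (auto simp: ident_def)
  have 2: "(\<Sum>j<d. ident i a * ident j b * c i j x y) = (if b < d then (if i = a then c a b x y else 0) else 0)" for i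
    by (rule sum_single) (auto simp: ident_def)
  show "(\<Sum>i<d. \<Sum>j<d. ident x i * ident y j * c' a b i j) = (\<Sum>i<d. \<Sum>j<d. ident i a * ident j b * c i j x y)"
    using * assms(1)[of a b x y] by (simp add: 1 2)
qed

text \<open>The braiding of \<open>M\<close> with a possibly different \<open>N\<close>;
  \<open>cb M\<close> is the case \<open>N = M\<close>. It allows the braiding matrix of a direct
  sum to be assembled from rectangular blocks.\<close>

definition cx :: "'a::field ydm \<Rightarrow> 'a ydm \<Rightarrow> nat \<Rightarrow> nat \<Rightarrow> nat \<Rightarrow> nat \<Rightarrow> 'a" where
  "cx M N i j l k = (\<Sum>u\<in>UNIV. co M u k i * act N u l j)"

definition dg :: "'a::field ydm \<Rightarrow> 'a ydm \<Rightarrow> (nat \<Rightarrow> nat \<Rightarrow> 'a) \<Rightarrow> bool" where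
  "dg M N q \<longleftrightarrow> (\<forall>i<ydim M. \<forall>k<ydim M. \<forall>j<ydim N. \<forall>l<ydim N. cx M N i j l k = diagc q i j l k)"

lemma not_nfin_dg:
  assumes "dg M M q" "\<not> nichols_fin (ydim M) (diagc q)"
  shows "\<not> nfin M"
  using assms nichols_fin_cong[of "ydim M" "cb M" "diagc q"]
  by (auto simp: nfin_def dg_def cx_def cb_def)

lemma opa_dsum:
  "opa (dsum N1 N2) u = opa N1 u + sh (ydim N1) (ydim N2) * opa N2 u * shT (ydim N1) (ydim N2)"
proof -
  let ?J = "sh (ydim N1) (ydim N2)" and ?K = "shT (ydim N1) (ydim N2)"
  have J: "A * ?J = 0" if "A * idn N1 = A" for A
    using that sh_idm(1) unfolding idn_def by (metis mult.assoc mult_zero_right)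
  have K: "?K * A = 0" if "idn N1 * A = A" for A
    using that sh_idm(2) unfolding idn_def by (metis mult.assoc mult_zero_left)
  have KJA: "?K * (?J * A) = idn N2 * A" for A by (simp add: shT_sh idn_def flip: mult.assoc)
  have m: "(A + ?J * A' * ?K) * (B + ?J * B' * ?K) = A * B + ?J * (A' * B') * ?K"
    if "A * idn N1 = A" "idn N1 * B = B" "idn N2 * B' = B'" for A A' B B'
  proof -
    have "A * (?J * C) = 0" "A' * (?K * B) = 0" for C using J[OF that(1)] K[OF that(2)]
      by (simp_all flip: mult.assoc)
    moreover have "idn N2 * (B' * C) = B' * C" for C using that(3) by (simp flip: mult.assoc)
    ultimately show ?thesis by (simp add: distrib_left distrib_right mult.assoc KJA)
  qed
  have o: "(if c then opr (dsum N1 N2) g else idn (dsum N1 N2))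
     = (if c then opr N1 g else idn N1) + ?J * (if c then opr N2 g else idn N2) * ?K" for c g
    by (simp add: opr_dsum) (simp add: idn_def sh_idm sh_shT)
  have i1: "(if c then opr N g else idn N) * idn N = (if c then opr N g else idn N)"
   "idn N * (if c then opr N g else idn N) = (if c then opr N g else idn N)" for c g and N :: "'a ydm" by auto
  obtain a b c where u: "u = (a, b, c)" by (cases u)
  show ?thesis unfolding u opa_def prod.case o
    by (subst m, simp only: i1, simp only: i1, simp only: i1, subst m)
      (simp only: mult.assoc i1, simp only: i1, simp only: i1, rule refl)
qed

lemma act_dsum:
  assumes "l < ydim N1 + ydim N2" "j < ydim N1 + ydim N2"
  shows "act (dsum N1 N2) u l j = blk (ydim N1) (act N1 u) (act N2 u) l j"
proof -
  have "meq (ydim N1 + ydim N2) (act (dsum N1 N2) u) (blk (ydim N1) (act N1 u) (act N2 u))"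
    unfolding meq_iff_tr tr_blk tr_act using opa_dsum[of N1 N2 u] tr_act[of "dsum N1 N2" u] by simp
  then show ?thesis using assms by (auto simp: meq_def)
qed

lemma dg_dsum_left:
  assumes "dg N1 N q1" "dg N2 N q2"
  shows "dg (dsum N1 N2) N (\<lambda>i j. if i < ydim N1 then q1 i j else q2 (i - ydim N1) j)"
  unfolding dg_def
proof (intro allI impI)
  fix i k j l assume *: "i < ydim (dsum N1 N2)" "k < ydim (dsum N1 N2)" "j < ydim N" "l < ydim N"
  let ?n = "ydim N1"
  have "cx (dsum N1 N2) N i j l k = (if k < ?n \<and> i < ?n then cx N1 N i j l k
     else if ?n \<le> k \<and> ?n \<le> i then cx N2 N (i - ?n) j l (k - ?n) else 0)"
    by (auto simp: cx_def dsum_def blk_def intro!: sum.neutral)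
  then show "cx (dsum N1 N2) N i j l k = diagc (\<lambda>i j. if i < ?n then q1 i j else q2 (i - ?n) j) i j l k"
    using * assms by (auto simp: dg_def diagc_def)
qed

lemma dg_dsum_right:
  assumes "dg N N1 q1" "dg N N2 q2"
  shows "dg N (dsum N1 N2) (\<lambda>i j. if j < ydim N1 then q1 i j else q2 i (j - ydim N1))"
  unfolding dg_def
proof (intro allI impI)
  fix i k j l assume *: "i < ydim N" "k < ydim N" "j < ydim (dsum N1 N2)" "l < ydim (dsum N1 N2)"
  let ?n = "ydim N1"
  have "cx N (dsum N1 N2) i j l k = (if l < ?n \<and> j < ?n then cx N N1 i j l k
     else if ?n \<le> l \<and> ?n \<le> j then cx N N2 i (j - ?n) (l - ?n) k else 0)"
    using * by (auto simp: cx_def act_dsum blk_def intro!: sum.neutral)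
  then show "cx N (dsum N1 N2) i j l k = diagc (\<lambda>i j. if j < ?n then q1 i j else q2 i (j - ?n)) i j l k"
    using * assms by (auto simp: dg_def diagc_def)
qed

lemma dg_cong:
  assumes "dg M N q" "\<And>i j. i < ydim M \<Longrightarrow> j < ydim N \<Longrightarrow> q i j = q' i j"
  shows "dg M N q'"
  using assms by (simp add: dg_def diagc_def)

lemma dg_dpow_left: "dg S N (\<lambda>i j. c j) \<Longrightarrow> dg (dpow S n) N (\<lambda>i j. c j)"
proof (induction n)
  case (Suc n)
  then show ?case using dg_dsum_left[of "dpow S n" N "\<lambda>i j. c j" S "\<lambda>i j. c j"] by simp
qed (simp add: dg_def yd0_def)

lemma dg_dpow_right: "dg N S (\<lambda>i j. c i) \<Longrightarrow> dg N (dpow S n) (\<lambda>i j. c i)"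
proof (induction n)
  case (Suc n)
  then show ?case using dg_dsum_right[of N "dpow S n" "\<lambda>i j. c i" S "\<lambda>i j. c i"] by simp
qed (simp add: dg_def yd0_def)

section \<open>Action and coaction tables of the simple modules\<close>

lemma ydim_simps [simp]: "ydim (Mb b g) = 1" "ydim (Mpair g1 g2) = 2" "ydim (Wm im b1 b2) = 2" "ydim yd0 = 0"
  by (simp_all add: Mb_def Mpair_def Wm_def yd0_def)

lemma ydim_dpow [simp]: "ydim (dpow S n) = n * ydim S"
  by (induction n) auto

lemma lessThan_2: "{..<2::nat} = {0, 1}" by auto

lemma act_Mb: "act (Mb b g) (c, d, e) 0 0 = (if c then b * b else 1) * (if d then b * b else 1) * (if e then b else 1)"
  by (simp add: act_def mmul_def Mb_def ident_def)

definition sg :: "bool \<Rightarrow> 'a::ring_1" where "sg a = (if a then -1 else 1)"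

lemma sg_simps [simp]: "sg True = -1" "sg False = 1" "sg a * sg a = 1" "sg (\<not> a) = - sg a"
  by (auto simp: sg_def)

lemma act_Mpair:
  "i < 2 \<Longrightarrow> j < 2 \<Longrightarrow> act (Mpair g1 g2) (c, d, False) i j = (if i = j then (if i = 0 then sg d else sg c) else 0)"
  by (auto simp: act_def mmul_def Mpair_def ident_def lessThan_2 less_2_cases_iff)

lemma act_Wm:
  "i < 2 \<Longrightarrow> j < 2 \<Longrightarrow> act (Wm im b1 b2) (c, d, e) i j = (if i = j then
     (if i = 0 then (if e then b2 else 1) else sg c * sg d * (if e then - im * b1 * b2 else 1)) else 0)"
  by (auto simp: act_def mmul_def Wm_def ident_def lessThan_2 less_2_cases_iff)

lemma fjk_eval: "fjk j k (a, b, c) = (if c then 0 else (if a then sg j else 1) * (if b then sg k else 1) / (4::'a::field_char_0))"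
proof -
  have e: "hmul (\<lambda>u. hbas e1 u + s * hbas ex u) (\<lambda>u. hbas e1 u + t * hbas ey u)
     = (\<lambda>w. hbas e1 w + t * hbas ey w + s * hbas ex w + s * t * hbas exy w)" for s t :: 'a
  proof
    fix w
    have "hmul (\<lambda>u. hbas e1 u + s * hbas ex u) (\<lambda>u. hbas e1 u + t * hbas ey u) w
      = hmul (hbas e1) (hbas e1) w + t * hmul (hbas e1) (hbas ey) w + s * hmul (hbas ex) (hbas e1) w + s * t * hmul (hbas ex) (hbas ey) w"
      by (simp add: hmul_def algebra_simps sum.distrib sum_distrib_left)
    then show "hmul (\<lambda>u. hbas e1 u + s * hbas ex u) (\<lambda>u. hbas e1 u + t * hbas ey u) w
       = hbas e1 w + t * hbas ey w + s * hbas ex w + s * t * hbas exy w"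
      by (simp add: hmul_hbas e1_def ex_def ey_def exy_def bmul_grp)
  qed
  show ?thesis unfolding fjk_def e
    by (cases j; cases k; cases a; cases b; cases c) (simp_all add: e1_def ex_def ey_def exy_def hbas_def)
qed

lemma hmul_z_eval: "hmul (\<lambda>v. fjk j k v + s * fjk j' k' v) (hbas ez) (a, b, c)
   = (if c then fjk j k (a, b, False) + s * fjk j' k' (a, b, False) else (0::'a::field_char_0))"
proof -
  have "hmul f (hbas ez) w = (\<Sum>u\<in>UNIV. f u * bmul u ez w)" for f :: "hb \<Rightarrow> 'a" and w
    by (simp add: hmul_def mult.assoc sum_hbas flip: sum_distrib_left)
  then show ?thesis
    by (cases a; cases b; cases c)
     (simp_all add: sum_hb ez_def bmul_grp fjk_eval, simp_all add: hbas_def)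
qed

lemma co_Wm:
  "co (Wm im b1 b2) (a, b, c) 0 0 = (if c then (1 - im * b1 * (sg a * sg b)) / 4 else (0::'a::field_char_0))"
  "co (Wm im b1 b2) (a, b, c) 1 1 = (if c then (1 + im * b1 * (sg a * sg b)) / 4 else (0::'a::field_char_0))"
  "co (Wm im b1 b2) (a, b, c) 1 0 = (if c then (sg a + im * b1 * sg b) / 4 else (0::'a::field_char_0))"
  "co (Wm im b1 b2) (a, b, c) 0 1 = (if c then (sg a - im * b1 * sg b) / 4 else (0::'a::field_char_0))"
  unfolding Wm_def Let_def ydm.simps hmul_z_eval fjk_eval
  by (simp_all add: sg_def field_simps)

lemma dg_Mb_left:
  assumes "\<And>j l. j < ydim N \<Longrightarrow> l < ydim N \<Longrightarrow> act N g l j = (if l = j then c j else 0)"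
  shows "dg (Mb b g) N (\<lambda>i j. c j)"
proof -
  have "cx (Mb b g) N 0 j l 0 = act N g l j" for j l
  proof -
    have "cx (Mb b g) N 0 j l 0 = (\<Sum>u\<in>UNIV. hbas g u * act N u l j)"
      unfolding cx_def by (rule sum.cong) (auto simp: Mb_def hbas_def)
    then show ?thesis by (simp add: sum_hbas)
  qed
  then show ?thesis using assms by (simp add: dg_def diagc_def)
qed

lemma dg_Mpair_left:
  assumes "\<And>j l. j < ydim N \<Longrightarrow> l < ydim N \<Longrightarrow> act N g1 l j = (if l = j then c1 j else 0)"
    and "\<And>j l. j < ydim N \<Longrightarrow> l < ydim N \<Longrightarrow> act N g2 l j = (if l = j then c2 j else 0)"
  shows "dg (Mpair g1 g2) N (\<lambda>i j. if i = 0 then c1 j else c2 j)"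
proof -
  have "cx (Mpair g1 g2) N i j l k = (if i = k then act N (if i = 0 then g1 else g2) l j else 0)"
    if "i < 2" "k < 2" for i j l k
  proof -
    have "cx (Mpair g1 g2) N i j l k = (\<Sum>u\<in>UNIV. hbas (if i = 0 then g1 else g2) u * (if i = k then act N u l j else 0))"
      unfolding cx_def using that by (intro sum.cong) (auto simp: Mpair_def hbas_def less_2_cases_iff)
    then show ?thesis by (simp add: sum_hbas)
  qed
  then show ?thesis using assms by (auto simp: dg_def diagc_def less_2_cases_iff)
qed

lemma dg_Mb_Mb: "dg (Mb b (c, d, False)) (Mb b' g) (\<lambda>i j. (if c then b' * b' else 1) * (if d then b' * b' else 1))"
  by (rule dg_Mb_left) (simp add: act_Mb)

lemma dg_Mb_Mpair: "dg (Mb b (c, d, False)) (Mpair g1 g2) (\<lambda>i j. if j = 0 then sg d else sg c)"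
  by (rule dg_Mb_left) (simp add: act_Mpair)

lemma dg_Mb_Wm: "dg (Mb b (c, d, False)) (Wm im b1 b2) (\<lambda>i j. if j = 0 then 1 else sg c * sg d)"
  by (rule dg_Mb_left) (simp add: act_Wm)

lemma dg_Mpair_Mb: "dg (Mpair (c, d, False) (c', d', False)) (Mb b g)
   (\<lambda>i j. if i = 0 then (if c then b * b else 1) * (if d then b * b else 1) else (if c' then b * b else 1) * (if d' then b * b else 1))"
  by (rule dg_Mpair_left) (simp_all add: act_Mb)

lemma dg_Mpair_Mpair: "dg (Mpair (c, d, False) (c', d', False)) (Mpair g1 g2)
   (\<lambda>i j. if i = 0 then (if j = 0 then sg d else sg c) else (if j = 0 then sg d' else sg c'))"
  by (rule dg_Mpair_left) (simp_all add: act_Mpair)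

text \<open>The coaction of \<open>Wm\<close> mixes its two basis vectors, but x^a y^b acts on
  \<open>Mb\<close> by (-1)^(a+b), and summing the mixed coefficients against this character gives
  0. The braiding is thus diagonal.\<close>

lemma dg_Wm_Mb:
  assumes "b * b = -1" "b1 * b1 = (1::'a::field_char_0)" "im * im = -1"
  shows "dg (Wm im b1 b2) (Mb b g) (\<lambda>i j. if i = 0 then - (im * b1 * b) else im * b1 * b)"
  using assms unfolding dg_def diagc_def
  by (auto simp: less_2_cases_iff cx_def sum_hb act_Mb co_Wm co_Wm[unfolded One_nat_def] field_simps)

lemma dg_Wm_Wm:
  assumes "im * im = (-1::'a::field_char_0)"
  shows "dg (Wm im b1 (-1)) (Wm im b2 (-1)) (\<lambda>i j. if j = 0 then -1 else if i = 0 then b1 * b2 else - (b1 * b2))"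
proof -
  have "im * (im * x) = - x" for x using assms by (simp flip: mult.assoc)
  then show ?thesis using assms unfolding dg_def diagc_def
    by (auto simp: less_2_cases_iff cx_def sum_hb act_Wm co_Wm co_Wm[unfolded One_nat_def] field_simps)
qed

lemma dg_dsum:
  assumes "dg A A qaa" "dg A B qab" "dg B A qba" "dg B B qbb"
  shows "dg (dsum A B) (dsum A B) (\<lambda>i j. if i < ydim A
     then (if j < ydim A then qaa i j else qab i (j - ydim A))
     else (if j < ydim A then qba (i - ydim A) j else qbb (i - ydim A) (j - ydim A)))"
  by (rule dg_cong[OF dg_dsum_left[OF dg_dsum_right[OF assms(1,2)] dg_dsum_right[OF assms(3,4)]]]) simp

section \<open>Pairs of simple modules with infinite-dimensional Nichols algebra\<close>

lemmas gdefs = ex_def ey_def exy_def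

text \<open>All three products q_ij q_ji are -1, a triangle. For \<open>ex\<close> with
  \<open>Mpair exy ex\<close>, or \<open>ey\<close> with \<open>Mpair ey exy\<close>, the
  one-dimensional vertex is linked to neither of the other two.\<close>

lemma not_nfin_Mb_Mpair:
  fixes b :: "'a::field_char_0"
  assumes "b * b = -1"
  shows "\<not> nfin (dsum (Mb b ey) (Mpair exy ex))" "\<not> nfin (dsum (Mb b ex) (Mpair ey exy))"
  unfolding gdefs
  by (rule not_nfin_dg[OF dg_dsum[OF dg_Mb_Mb dg_Mb_Mpair dg_Mpair_Mb dg_Mpair_Mpair]];
      use assms in \<open>simp add: numeral_3_eq_3[symmetric]\<close>; intro not_fin_triangle; simp)+

text \<open>The same basis vector in the two copies gives the product (-1)(-1) = 1, different ones
  give -1. The four vertices therefore form the cycle 0, 1, 2, 3.\<close>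

lemma not_nfin_Mpair_Mpair:
  "\<not> nfin (dsum (Mpair exy ex) (Mpair exy ex) :: 'a::field_char_0 ydm)"
  "\<not> nfin (dsum (Mpair ey exy) (Mpair ey exy) :: 'a::field_char_0 ydm)"
  unfolding gdefs
  by (rule not_nfin_dg[OF dg_dsum[OF dg_Mpair_Mpair dg_Mpair_Mpair dg_Mpair_Mpair dg_Mpair_Mpair]];
      simp; intro not_fin_square; simp)+

text \<open>The sign of \<open>im * b1 * b\<close> decides whether the one-dimensional vertex is
  linked to both vectors of \<open>Wm\<close> or to none. The value 1 produces a triangle.\<close>

lemma not_nfin_Mb_Wm:
  fixes b im b1 :: "'a::field_char_0"
  assumes b: "b * b = -1" and im: "im * im = -1" and b1: "b1 * b1 = 1" and b1b: "im * b1 * b = 1"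
    and g: "g = ex \<or> g = ey"
  shows "\<not> nfin (dsum (Mb b g) (Wm im b1 (-1)))"
proof -
  have 1: "\<not> nfin (dsum (Mb b (c, \<not> c, False)) (Wm im b1 (-1)))" for c
    by (rule not_nfin_dg[OF dg_dsum[OF dg_Mb_Mb dg_Mb_Wm dg_Wm_Mb[OF b b1 im] dg_Wm_Wm[OF im]]],
      simp add: numeral_3_eq_3[symmetric], intro conjI impI; rule not_fin_triangle)
      (use assms in \<open>auto simp: sg_def\<close>)
  show ?thesis using g 1[of True] 1[of False] by (auto simp: gdefs)
qed

lemma not_nfin_Wm_Wm:
  fixes im b1 :: "'a::field_char_0"
  assumes im: "im * im = -1" and b1: "b1 * b1 = 1"
  shows "\<not> nfin (dsum (Wm im b1 (-1)) (Wm im b1 (-1)))"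
  by (rule not_nfin_dg[OF dg_dsum[OF dg_Wm_Wm[OF im] dg_Wm_Wm[OF im] dg_Wm_Wm[OF im] dg_Wm_Wm[OF im]]],
       simp, rule not_fin_square) (use b1 in simp_all)

text \<open>The standard basis is already diagonalizing, so \<open>ident\<close> serves as base
  change. With all \<open>q i i = -1\<close>, Cartan entries -1 and 0 mean products -1 and
  1.\<close>

lemma cartan_type_dg:
  assumes dg: "dg M M q" and d: "ydim M = m + 2 * k"
    and q: "\<And>i. i < ydim M \<Longrightarrow> q i i = -1"
    and qq: "\<And>i j. i < j \<Longrightarrow> j < ydim M \<Longrightarrow>
       q i j * q j i = (if m \<le> i \<and> (i - m) div 2 = (j - m) div 2 then -1 else 1)"
  shows "cartan_type (M :: 'a::field_char_0 ydm) m k"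
proof -
  let ?d = "ydim M"
  have id: "meq ?d (mmul ?d ident ident) ident"
    unfolding meq_iff_tr tr_mmul idm_def[symmetric] by simp
  have "(\<Sum>a<?d. \<Sum>b<?d. ident a i * ident b j * cb M a b l n) = q i j * ident l j * ident n i"
    if "i < ?d" "j < ?d" "l < ?d" "n < ?d" for i j l n
  proof -
    have 1: "(\<Sum>b<?d. ident a i * ident b j * cb M a b l n)
        = (if j < ?d then (if a = i then cb M i j l n else 0) else 0)" for a
      by (rule sum_single) (auto simp: ident_def)
    show ?thesis using that dg by (simp add: 1) (auto simp: dg_def cx_def cb_def diagc_def ident_def)
  qed
  moreover have "q i j * q j i = q i i powi cartanAA m i j" if "i < ?d" "j < ?d" "i \<noteq> j" for i j
  proof -
    have "q i j * q j i = (if m \<le> i \<and> m \<le> j \<and> (i - m) div 2 = (j - m) div 2 then -1 else 1)"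
    proof (cases "i < j")
      case True
      then show ?thesis using qq[of i j] that by auto
    next
      case False
      then show ?thesis using qq[of j i] that by (auto simp: mult.commute)
    qed
    then show ?thesis using q[of i] that by (simp add: cartanAA_def)
  qed
  ultimately show ?thesis
    unfolding cartan_type_def diag_cartan_def using d q id
    by (intro conjI exI[of _ ident] exI[of _ q]) (auto simp: q)
qed

text \<open>\<open>D\<close> gathers the one-dimensional summands. They are unlinked among each
  other since (-1)(-1) = 1, and unlinked from \<open>S\<close> since the same sign
  \<open>f j\<close> occurs in both directions; \<open>S\<close> alone supplies the A2
  component.\<close>

lemma cartan_type_dsum:
  assumes D: "dg D D (\<lambda>_ _. -1)" and DS: "dg D S (\<lambda>i j. f j)" and SD: "dg S D (\<lambda>i j. f i)"
    and S: "dg S S q" "ydim S = 2" and f: "f 0 * f 0 = 1" "f (Suc 0) * f (Suc 0) = 1"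
    and q: "q 0 0 = -1" "q (Suc 0) (Suc 0) = -1" "q 0 (Suc 0) * q (Suc 0) 0 = -1"
    and n: "n = ydim D"
  shows "cartan_type (dsum D S :: 'a::field_char_0 ydm) n 1"
proof (rule cartan_type_dg[OF dg_dsum[OF D DS SD S(1)]])
  let ?q = "\<lambda>i j. if i < ydim D then if j < ydim D then -1 else f (j - ydim D)
      else if j < ydim D then f (i - ydim D) else q (i - ydim D) (j - ydim D)"
  fix i
  show "?q i i = -1" if "i < ydim (dsum D S)"
    using that S(2) q by (auto simp: less_Suc_eq dest!: le_Suc_ex)
  fix j assume ij: "i < j" "j < ydim (dsum D S)"
  have "j < n \<or> j = n \<or> j = Suc n" using ij S(2) n by auto
  then show "?q i j * ?q j i = (if n \<le> i \<and> (i - n) div 2 = (j - n) div 2 then -1 else 1)"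
    using ij f q n by (auto simp: less_Suc_eq)
qed (simp add: S n)

section \<open>Braiding matrices of the seven families\<close>

lemma dg_const: "dg N1 N (\<lambda>_ _. c) \<Longrightarrow> dg N2 N (\<lambda>_ _. c) \<Longrightarrow> dg (dsum N1 N2) N (\<lambda>_ _. c)"
  "dg N N1 (\<lambda>_ _. c) \<Longrightarrow> dg N N2 (\<lambda>_ _. c) \<Longrightarrow> dg N (dsum N1 N2) (\<lambda>_ _. c)"
  using dg_dsum_left[of N1 N "\<lambda>_ _. c" N2 "\<lambda>_ _. c"] dg_dsum_right[of N N1 "\<lambda>_ _. c" N2 "\<lambda>_ _. c"] by simp_all

lemma dg_fun: "dg N1 N (\<lambda>_ j. f j) \<Longrightarrow> dg N2 N (\<lambda>_ j. f j) \<Longrightarrow> dg (dsum N1 N2) N (\<lambda>_ j. f j)"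
  "dg N N1 (\<lambda>i _. f i) \<Longrightarrow> dg N N2 (\<lambda>i _. f i) \<Longrightarrow> dg N (dsum N1 N2) (\<lambda>i _. f i)"
  using dg_dsum_left[of N1 N "\<lambda>_ j. f j" N2 "\<lambda>_ j. f j"] dg_dsum_right[of N N1 "\<lambda>i _. f i" N2 "\<lambda>i _. f i"] by simp_all

lemma dg_Mb_Mb':
  assumes "b' * b' = -1" "g = ex \<or> g = ey"
  shows "dg (Mb b g) (Mb b' g') (\<lambda>_ _. -1 :: 'a::field_char_0)"
  using assms dg_Mb_Mb[of b True False b' g'] dg_Mb_Mb[of b False True b' g'] by (auto simp: gdefs)

lemma dg_dpows2:
  fixes n1 n2 :: nat
  assumes "\<And>g g'. g \<in> {(b1, g1), (b2, g2)} \<Longrightarrow> g' \<in> {(b1, g1), (b2, g2)} \<Longrightarrow>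
      dg (Mb (fst g) (snd g)) (Mb (fst g') (snd g')) (\<lambda>_ _. -1)"
    and "dg (Mb b1 g1) S (\<lambda>i j. f j)" "dg (Mb b2 g2) S (\<lambda>i j. f j)"
    and "dg S (Mb b1 g1) (\<lambda>i j. f i)" "dg S (Mb b2 g2) (\<lambda>i j. f i)"
  defines "D \<equiv> dsum (dpow (Mb b1 g1) n1) (dpow (Mb b2 g2) n2)"
  shows "dg D D (\<lambda>_ _. -1)" "dg D S (\<lambda>i j. f j)" "dg S D (\<lambda>i j. f i)"
proof -
  show "dg D D (\<lambda>_ _. -1)" unfolding D_def
    by (intro dg_const dg_dpow_left[where c = "\<lambda>_. -1"] dg_dpow_right[where c = "\<lambda>_. -1"])
      (use assms(1)[of "(b1, g1)" "(b1, g1)"] assms(1)[of "(b1, g1)" "(b2, g2)"]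
        assms(1)[of "(b2, g2)" "(b1, g1)"] assms(1)[of "(b2, g2)" "(b2, g2)"] in simp_all)
  show "dg D S (\<lambda>i j. f j)" unfolding D_def
    by (rule dg_fun; rule dg_dpow_left; fact)
  show "dg S D (\<lambda>i j. f i)" unfolding D_def
    by (rule dg_fun; rule dg_dpow_right; fact)
qed

lemma less_4: "i < 4 \<longleftrightarrow> i = 0 \<or> i = 1 \<or> i = 2 \<or> i = (3::nat)" and less_3: "i < 3 \<longleftrightarrow> i = 0 \<or> i = 1 \<or> i = (2::nat)"
  by auto

context
  fixes im :: "'a::field_char_0"
  assumes im: "im * im = -1"
begin

lemma im': "(- im) * (- im) = -1"
  using im by simp

lemma cartan_Omega1: "cartan_type (Omega1 im n1 n2 n3 n4) (n1 + n2 + n3 + n4) 0"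
proof (rule cartan_type_dg)
  show "dg (Omega1 im n1 n2 n3 n4) (Omega1 im n1 n2 n3 n4) (\<lambda>_ _. -1)"
    unfolding Omega1_def
    by (intro dg_const dg_dpow_left[where c = "\<lambda>_. -1"] dg_dpow_right[where c = "\<lambda>_. -1"])
      (rule dg_Mb_Mb'; simp add: im)+
qed (simp_all add: Omega1_def)

lemma cartan_Omega2: "cartan_type (Omega2 im n1 n2) (n1 + n2) 1"
proof -
  let ?f = "\<lambda>j::nat. if j = 0 then 1 else -1 :: 'a"
  have 1: "dg (Mb b ex) (Mpair exy ex) (\<lambda>i j. ?f j)" for b
    unfolding gdefs by (rule dg_cong[OF dg_Mb_Mpair]) auto
  have 2: "dg (Mpair exy ex) (Mb b ex) (\<lambda>i j. ?f i)" if "b * b = -1" for b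
    unfolding gdefs by (rule dg_cong[OF dg_Mpair_Mb]) (auto simp: that)
  show ?thesis unfolding Omega2_def
    by (rule cartan_type_dsum[where f = ?f, OF dg_dpows2[where f = ?f and S = "Mpair exy ex"]
        dg_Mpair_Mpair[of True True True False, folded gdefs]])
      (use 1 2[OF im] 2[OF im'] in \<open>auto intro: dg_Mb_Mb' simp: im\<close>)
qed

lemma cartan_Omega3: "cartan_type (Omega3 im n1 n2) (n1 + n2) 1"
proof -
  let ?f = "\<lambda>j::nat. if j = 0 then -1 else 1 :: 'a"
  have 1: "dg (Mb b ey) (Mpair ey exy) (\<lambda>i j. ?f j)" for b
    unfolding gdefs by (rule dg_cong[OF dg_Mb_Mpair]) auto
  have 2: "dg (Mpair ey exy) (Mb b ey) (\<lambda>i j. ?f i)" if "b * b = -1" for b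
    unfolding gdefs by (rule dg_cong[OF dg_Mpair_Mb]) (auto simp: that)
  show ?thesis unfolding Omega3_def
    by (rule cartan_type_dsum[where f = ?f, OF dg_dpows2[where f = ?f and S = "Mpair ey exy"]
        dg_Mpair_Mpair[of False True True True, folded gdefs]])
      (use 1 2[OF im] 2[OF im'] in \<open>auto intro: dg_Mb_Mb' simp: im\<close>)
qed

text \<open>The sign of \<open>bb\<close> is opposite to the one in \<open>not_nfin_Mb_Wm\<close>,
  so the one-dimensional summands stay unlinked from \<open>Wm\<close>.\<close>

lemma cartan_dsum_Wm:
  assumes b: "b * b = -1" and b1: "b1 * b1 = 1" and bb: "im * b1 * b = -1"
  shows "cartan_type (dsum (dsum (dpow (Mb b ex) n1) (dpow (Mb b ey) n2)) (Wm im b1 (-1))) (n1 + n2) 1"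
proof -
  let ?f = "\<lambda>j::nat. if j = 0 then 1 else -1 :: 'a"
  have 1: "dg (Mb b ex) (Wm im b1 (-1)) (\<lambda>i j. ?f j)" "dg (Mb b ey) (Wm im b1 (-1)) (\<lambda>i j. ?f j)"
    unfolding gdefs by (rule dg_cong[OF dg_Mb_Wm]; auto)+
  have 2: "dg (Wm im b1 (-1)) (Mb b g) (\<lambda>i j. ?f i)" for g
    by (rule dg_cong[OF dg_Wm_Mb[OF b b1 im]]) (auto simp: bb)
  show ?thesis
    by (rule cartan_type_dsum[where f = ?f, OF dg_dpows2[where f = ?f and S = "Wm im b1 (-1)"] dg_Wm_Wm[OF im]])
      (use 1 2 in \<open>auto intro: dg_Mb_Mb' simp: b b1\<close>)
qed

lemma cartan_Omega4: "cartan_type (Omega4 im n1 n2) (n1 + n2) 1"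
  unfolding Omega4_def by (rule cartan_dsum_Wm) (simp_all add: im)

lemma cartan_Omega5: "cartan_type (Omega5 im n1 n2) (n1 + n2) 1"
  unfolding Omega5_def by (rule cartan_dsum_Wm) (simp_all add: im)

lemma cartan_Omega6: "cartan_type (Omega6 :: 'a ydm) 0 2"
  unfolding Omega6_def gdefs
  by (rule cartan_type_dg[OF dg_dsum[OF dg_Mpair_Mpair dg_Mpair_Mpair dg_Mpair_Mpair dg_Mpair_Mpair]])
    (auto simp: less_4 less_3 less_2_cases_iff)

lemma cartan_Omega7: "cartan_type (Omega7 im) 0 2"
  unfolding Omega7_def
  by (rule cartan_type_dg[OF dg_dsum[OF dg_Wm_Wm[OF im] dg_Wm_Wm[OF im] dg_Wm_Wm[OF im] dg_Wm_Wm[OF im]]])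
    (auto simp: less_4 less_3 less_2_cases_iff)

end

section \<open>Idempotents of the Drinfeld double\<close>

text \<open>Products are kept nested to the right; an equation for \<open>A * B\<close> becomes a
  rule that also rewrites inside longer products.\<close>

lemma tail: "A * B = C \<Longrightarrow> A * (B * D) = C * (D::'a::semigroup_mult)"
  by (simp flip: mult.assoc)

context yd_module
begin

text \<open>The operator by which the idempotent \<open>fjk a b\<close> of H8 acts on
  \<open>M\<close>.\<close>

definition "fb a b = sc (1/4) (I + sc (sg a) X + sc (sg b) Y + sc (sg a * sg b) (X * Y))"

lemmas XY_tails = XX[THEN tail] YY[THEN tail] XY[symmetric] XY[symmetric, THEN tail]

lemma I_tail: "I * (opr M g * A) = opr M g * A"
  by (simp flip: mult.assoc)

lemma I_G [simp]: "I * G a b = G a b" "G a b * I = G a b"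
  by (simp_all add: G_def)

lemma I_KJPQ [simp]: "I * K = K" "K * I = K" "I * J = J" "J * I = J" "I * P = P" "P * I = P" "I * Q = Q" "Q * I = Q"
  by (simp_all add: K_def J_def P_def Q_def distrib_left distrib_right left_diff_distrib right_diff_distrib)

lemma I_fb [simp]: "I * fb a b = fb a b" "fb a b * I = fb a b"
  by (simp_all add: fb_def distrib_left distrib_right mult.assoc I_tail)

lemma XY_fb: "X * fb a b = sc (sg a) (fb a b)" "Y * fb a b = sc (sg b) (fb a b)"
  "fb a b * X = sc (sg a) (fb a b)" "fb a b * Y = sc (sg b) (fb a b)"
  unfolding fb_def by (cases a; cases b; simp add: distrib_left distrib_right left_diff_distrib right_diff_distrib
    mult.assoc XY_tails XX YY sc_simps; rule fmat_eqI; simp)+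

lemma fb_fb: "fb a b * fb c d = (if a = c \<and> b = d then fb a b else 0)"
  by (subst (2) fb_def, cases a; cases b; cases c; cases d; simp add: distrib_left right_diff_distrib XY_fb
    XY_fb[THEN tail] sc_simps fmat.scale_left_distrib[symmetric] fmat.scale_left_diff_distrib[symmetric])

lemma Z_fb: "Z * fb a b = fb b a * Z"
  unfolding fb_def by (simp add: distrib_left distrib_right mult.assoc ZX ZY ZX[THEN tail] ZY[THEN tail] XY mult.commute[of "sg b"])
    (simp add: XY flip: mult.assoc)

text \<open>The scalar is -1 for \<open>True\<close>, \<open>True\<close> and 1 otherwise. Hence the
  eigenvalues of z are square roots of -1 on the image of \<open>fb True True\<close> and signs on
  that of \<open>fb False False\<close>.\<close>

lemma ZZ_fb: "Z * (Z * fb a b) = sc ((1 + sg a + sg b - sg a * sg b) / 2) (fb a b)"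
  by (simp add: ZZ[THEN tail] distrib_right left_diff_distrib XY_fb mult.assoc sc_simps)
    (rule fmat_eqI, simp add: field_simps)

lemma sum_fb: "fb False False + fb False True + fb True False + fb True True = I"
  unfolding fb_def by (rule fmat_eqI) (simp add: field_simps)

lemma G_fb: "G c d * fb a b = fb a b * G c d"
  unfolding fb_def by (simp add: distrib_left distrib_right mult.assoc G_X G_Y G_X[THEN tail] G_Y[THEN tail])

lemma KJ_fb: "K * fb a b = fb a b * K" "J * fb a b = fb a b * J" "P * fb a b = fb (\<not> a) (\<not> b) * P"
  unfolding fb_def by (simp_all add: distrib_left distrib_right left_diff_distrib mult.assoc KJPQ_X KJPQ_X[THEN tail] sc_simps)

text \<open>The twist in the coproduct of z makes its effect on degrees depend on the eigenvalues of
  x and y: coordinates are exchanged and then shifted by \<open>(a, b)\<close>.\<close>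

lemma GZ_fb: "G c d * (Z * fb a b) = Z * (G (d \<noteq> b) (c \<noteq> a) * fb a b)"
proof -
  have r: "X * (Z * A) = Z * (Y * A)" "Y * (Z * A) = Z * (X * A)" for A
    by (simp_all add: ZX ZY flip: mult.assoc)
  have Gr: "X * (G p q * A) = G p q * (X * A)" "Y * (G p q * A) = G p q * (Y * A)" for p q A
    by (simp_all add: G_X G_Y flip: mult.assoc)
  show ?thesis
    by (cases c; cases d; cases a; cases b;
      simp add: G_def C_Z[THEN tail], simp only: G_def[symmetric];
      simp add: distrib_left distrib_right left_diff_distrib right_diff_distrib mult.assoc r Gr XY_fb; rule fmat_eqI; simp)
qed

lemma C_GKJPQ: "C a b c = (if c then sc (1/4) (K + sc (sg a) P + sc (sg b) Q + sc (sg a * sg b) J) else G a b)"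
  by (cases a; cases b; cases c)
    (auto intro!: fmat_eqI simp: G_def K_def J_def P_def Q_def field_simps)

lemma C_G: "opr M (GC u) * G a b = (if u = (a, b, False) then G a b else 0)"
  by (cases u) (auto simp: C_GKJPQ G_G G_K distrib_right left_diff_distrib)

text \<open>A nonzero column of \<open>e\<close> would be a vector v with c(v \<otimes> v) = v
  \<otimes> v, spanning a line with infinite-dimensional Nichols algebra.\<close>

lemma kill:
  assumes "nfin M" "I * e = e"
    and br: "\<And>p x y. (\<Sum>u\<in>UNIV. ent (opa M u * (e * eu p 0)) x 0 * ent (opr M (GC u) * (e * eu p 0)) y 0)
       = ent (e * eu p 0) x 0 * ent (e * eu p 0) y 0"
  shows "e = 0"
proof (rule ccontr)
  assume "e \<noteq> 0"
  then obtain i p where ip: "ent e i p \<noteq> 0" by (metis fmat_eqI ent_ring(1))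
  have "nichols_fin 1 (diagc (\<lambda>_ _. 1::'a))"
  proof (rule nfin_embed_diag[OF assms(1), where V = "\<lambda>_. e * eu p 0" and W = "\<lambda>_. sc (1 / ent e i p) (eu 0 i)"])
    show "I * (e * eu p 0) = e * eu p 0" using assms(2) by (simp flip: mult.assoc)
    show "sc (1 / ent e i p) (eu 0 i) * (e * eu p 0) = idm 1"
      using ip by (intro fmat_eqI) auto
  qed (use br in simp)
  then show False using not_fin_unit[of "\<lambda>_ _. 1::'a"] by simp
qed

text \<open>A vector in the image has degree x^a y^b, and this group-like acts on it by the sign
  determined by a c + b d. The second assumption says exactly that the sign is 1.\<close>

lemma kill_G:
  assumes "nfin M" "(a \<and> c) = (b \<and> d)"
  shows "G a b * fb c d = 0"
proof (rule kill[OF assms(1)])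
  fix p x y
  let ?v = "G a b * fb c d * eu p 0"
  have C: "opr M (GC u) * ?v = sc (hbas (a, b, False) u) ?v" for u
    by (simp add: C_G[THEN tail] mult.assoc hbas_def)
  have o: "opa M (a, b, False) * ?v = ?v"
  proof -
    define v where "v = ?v"
    have X: "X * v = sc (sg c) v" "Y * v = sc (sg d) v"
      by (simp_all add: v_def G_X[symmetric, THEN tail] G_Y[symmetric, THEN tail] mult.assoc XY_fb[THEN tail])
    have "I * v = v" by (simp add: v_def flip: mult.assoc)
    then have "opa M (a, b, False) * v = v"
      using assms(2) by (cases a; cases b; cases c; cases d) (simp_all add: opa_def X mult.assoc)
    then show ?thesis by (simp add: v_def)
  qed
  have "(\<Sum>u\<in>UNIV. ent (opa M u * ?v) x 0 * ent (opr M (GC u) * ?v) y 0)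
     = (\<Sum>u\<in>UNIV. hbas (a, b, False) u * (ent (opa M u * ?v) x 0 * ent ?v y 0))"
    unfolding C by (simp only: ent_sc mult.left_commute)
  also have "\<dots> = ent ?v x 0 * ent ?v y 0" unfolding sum_hbas o ..
  finally show "(\<Sum>u\<in>UNIV. ent (opa M u * ?v) x 0 * ent (opr M (GC u) * ?v) y 0) = ent ?v x 0 * ent ?v y 0" .
qed (simp flip: mult.assoc)

text \<open>On \<open>w\<close> the element x^a y^b z acts as \<open>Z\<close> times a character of
  (a, b). Summation over a and b is then a Fourier transform of the coaction coefficients and
  selects one of \<open>K\<close>, \<open>P\<close>, \<open>Q\<close>, \<open>J\<close>.\<close>

lemma braid_K:
  assumes v: "K * v = v" and w: "fb c d * (Z * w) = Z * w"
  shows "(\<Sum>u\<in>UNIV. ent (opa M u * w) x 0 * ent (opr M (GC u) * v) y 0)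
    = ent (Z * w) x 0 * ent ((if c then if d then J else P else if d then Q else K) * v) y 0"
proof -
  have Gv: "G a b * v = 0" for a b using v G_K(1)[of a b] by (metis mult.assoc mult_zero_left)
  have XY: "X * (Z * w) = sc (sg c) (Z * w)" "Y * (Z * w) = sc (sg d) (Z * w)"
    using w XY_fb by (metis sc_mult_left mult.assoc)+
  show ?thesis
    by (cases c; cases d)
     (simp_all add: sum_hb C_GKJPQ opa_simps Gv distrib_right mult.assoc XY, simp_all add: v field_simps)
qed

text \<open>On this part z squares to 1, and by \<open>braid_K\<close> a vector with z-eigenvalue 1
  braids trivially with itself. So only the eigenvalue -1 can remain.\<close>

lemma kill_K_plus:
  assumes "nfin M"
  shows "Z * (K * fb False False) = - (K * fb False False)"
proof -
  let ?f = "fb False False"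
  define e where "e = K * ?f + Z * (K * ?f)"
  have fe: "Z * (K * A) = K * (Z * A)" for A using KJPQ_Z(1) by (simp flip: mult.assoc)
  have Ze: "Z * e = e" and Ke: "K * e = e" and fbe: "?f * e = e"
    by (simp_all add: e_def distrib_left fe ZZ_fb fb_fb KJ_fb(1)[symmetric, THEN tail] Z_fb[symmetric, THEN tail]
       KJPQ KJPQ[THEN tail] mult.assoc)
  have "e = 0"
  proof (rule kill[OF assms])
    show "I * e = e" using Ke I_KJPQ(1) by (metis mult.assoc)
    fix p x y
    have 1: "Z * (e * A) = e * A" "K * (e * A) = e * A" "?f * (e * A) = e * A" for A
      by (simp_all add: Ze Ke fbe flip: mult.assoc)
    show "(\<Sum>u\<in>UNIV. ent (opa M u * (e * eu p 0)) x 0 * ent (opr M (GC u) * (e * eu p 0)) y 0)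
       = ent (e * eu p 0) x 0 * ent (e * eu p 0) y 0"
      by (subst braid_K[where c = False and d = False]) (simp_all only: 1, simp_all only: 1 if_False)
  qed
  then show ?thesis unfolding e_def by (simp add: eq_neg_iff_add_eq_0 add.commute)
qed

text \<open>On the span of \<open>v\<close> and \<open>p = P v\<close> the braiding is not diagonal: it sends \<open>v \<otimes> v\<close> to a multiple of
  \<open>p \<otimes> p\<close> and vice versa. Exchanging the roles of \<open>v\<close> and \<open>p\<close> at every second tensor position, with
  signs of period 4, turns it into a diagonal braiding of affine type \<open>A\<^sub>1\<close>.\<close>

lemma not_nfin_of_vec:
  fixes v :: "'a fmat"
  assumes v: "v \<noteq> 0" "v * eu 0 0 = v" "K * v = v" "fb False True * v = v" "J * v = sc (- j) v"
    and l: "P * (Z * v) = sc l v" "l * l = j" and j: "j * j = -1"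
  shows "\<not> nfin M"
proof
  assume fin: "nfin M"
  have l0: "l \<noteq> 0" using l(2) j by auto
  define p where "p = P * v"
  have Iv: "I * v = v" using v(3) by (metis I_KJPQ(1) mult.assoc)
  have Pp: "P * p = v" using v(3) by (simp add: p_def KJPQ[THEN tail])
  have Kp: "K * p = p" by (simp add: p_def KJPQ[THEN tail])
  have Jp: "J * p = sc j p"
  proof -
    have "J * p = - (P * (J * v))" by (simp add: p_def KJPQ[THEN tail])
    then show ?thesis by (simp add: v(5) p_def)
  qed
  have Qv: "Q * v = sc j p" using Jp by (simp add: p_def flip: KJPQ(8) mult.assoc)
  have Qp: "Q * p = sc (- j) v"
  proof -
    have "Q * p = J * (P * p)" by (simp flip: KJPQ(8) mult.assoc)
    then show ?thesis by (simp add: Pp v(5))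
  qed
  have Zv: "Z * v = sc l p"
  proof -
    have "K * (Z * v) = Z * v" using v(3) KJPQ_Z(1) by (metis mult.assoc)
    then have "Z * v = P * (P * (Z * v))" by (simp add: KJPQ(7)[THEN tail])
    then show ?thesis by (simp add: l(1) p_def)
  qed
  have ZZv: "Z * (Z * v) = v"
  proof -
    have "Z * (Z * fb False True) = fb False True" using ZZ_fb[of False True] by simp
    then have "Z * (Z * (fb False True * v)) = fb False True * v" by (metis mult.assoc)
    then show ?thesis by (simp only: v(4))
  qed
  have Zp: "Z * p = sc (1 / l) v"
  proof -
    have "v = sc l (Z * p)" using ZZv Zv by simp
    then have "sc (1 / l) v = sc (1 / l) (sc l (Z * p))" by simp
    then show ?thesis using l0 by simp
  qed
  have fp: "fb True False * p = p"
    using v(4) by (simp add: p_def KJ_fb(3)[of False True, simplified, symmetric, THEN tail]) (simp add: mult.assoc)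
  have pe: "p * eu 0 0 = p" using v(2) by (simp add: p_def mult.assoc)
  have fv: "fb False True * v = v" by (rule v)
  \<comment> \<open>\<open>?br a b\<close> lists the coordinates of c(a \<otimes> b), the acted-on
    vector \<open>b\<close> coming out in front.\<close>
  let ?br = "\<lambda>a b x y. \<Sum>u\<in>UNIV. ent (opa M u * b) x 0 * ent (opr M (GC u) * a) y 0"
  have br: "?br v v x y = l * ent p x 0 * ent p y 0" "?br v p x y = l * ent v x 0 * ent p y 0"
    "?br p v x y = l * ent p x 0 * ent v y 0" "?br p p x y = - l * ent v x 0 * ent v y 0" for x y
  proof -
    have a: "fb True False * (Z * v) = Z * v" "fb False True * (Z * p) = Z * p"
      by (simp_all add: Zv Zp fp fv)
    show "?br v v x y = l * ent p x 0 * ent p y 0"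
      unfolding braid_K[OF v(3) a(1)] by (simp add: Zv flip: p_def)
    show "?br v p x y = l * ent v x 0 * ent p y 0"
      unfolding braid_K[OF v(3) a(2)] using l0 by (simp add: Zp Qv flip: l(2))
    show "?br p v x y = l * ent p x 0 * ent v y 0"
      unfolding braid_K[OF Kp a(1)] by (simp add: Zv Pp)
    show "?br p p x y = - l * ent v x 0 * ent v y 0"
      unfolding braid_K[OF Kp a(2)] using l0 by (simp add: Zp Qp flip: l(2))
  qed
  obtain i where i: "ent v i 0 \<noteq> 0"
  proof -
    obtain i k where "ent v i k \<noteq> 0" using v(1) by (metis fmat_eqI ent_ring(1))
    moreover have "ent v i k = (if k = 0 then ent v i 0 else 0)" using v(2) by (metis ent_mult_eu)
    ultimately show thesis using that by (metis (full_types))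
  qed
  \<comment> \<open>The functional dual to \<open>v\<close>: half of \<open>K + sc j J\<close>
    projects to the eigenvalue \<open>- j\<close> of \<open>J\<close>, keeping \<open>v\<close> and
    killing \<open>p\<close>. Since \<open>P\<close> exchanges \<open>v\<close> and
    \<open>p\<close>, \<open>\<phi> * P\<close> is dual to \<open>p\<close>.\<close>
  define \<phi> where "\<phi> = sc (1 / ent v i 0) (eu 0 i * sc (1/2) (K + sc j J))"
  define \<psi> where "\<psi> = \<phi> * P"
  have \<phi>v: "\<phi> * v = eu 0 0"
  proof -
    have "sc (1/2) (K + sc j J) * v = v"
      using j by (simp add: distrib_right v(3,5) sc_simps) (rule fmat_eqI, simp add: field_simps)
    then have "\<phi> * v = sc (1 / ent v i 0) (eu 0 i * (v * eu 0 0))"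
      unfolding \<phi>_def sc_mult_left mult.assoc v(2) by (simp only: sc_mult_left mult.assoc)
    also have "\<dots> = eu 0 0" by (rule fmat_eqI) (use i in auto)
    finally show ?thesis .
  qed
  have \<phi>p: "\<phi> * p = 0"
  proof -
    have "sc (1/2) (K + sc j J) * p = 0"
      using j by (simp add: distrib_right Kp Jp)
    then show ?thesis by (simp add: \<phi>_def mult.assoc)
  qed
  have \<psi>: "\<psi> * p = eu 0 0" "\<psi> * v = 0"
    using \<phi>v \<phi>p Pp by (simp_all add: \<psi>_def mult.assoc p_def)
  \<comment> \<open>The sign changes exactly when leaving an odd position and absorbs there the
    minus sign by which c(p \<otimes> p) differs from c(v \<otimes> v).\<close>
  define s :: "nat \<Rightarrow> 'a" where "s t = (if t mod 4 < 2 then 1 else -1)" for t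
  have ss: "s t * s t = 1" for t by (simp add: s_def)
  have sSuc: "s (Suc t) = (if even t then s t else - s t)" for t
  proof -
    have "t mod 4 = 0 \<or> t mod 4 = 1 \<or> t mod 4 = 2 \<or> t mod 4 = 3" by auto
    moreover have "even t \<longleftrightarrow> even (t mod 4)" by (simp add: dvd_mod_iff)
    ultimately show ?thesis by (auto simp: s_def mod_Suc)
  qed
  define A where "A t = (if even t then v else p)" for t :: nat
  define B where "B t = (if even t then p else v)" for t :: nat
  define V where "V t = sc (s t) (A t) + B t * eu 0 1" for t
  define W where "W t = sc (s t) (eu 0 0 * (if even t then \<phi> else \<psi>)) + eu 1 0 * (if even t then \<psi> else \<phi>)" for t
  \<comment> \<open>One sign cannot be absorbed and ends up in the entry (1, 0). It makes the
    product of all four entries equal to -l^4 = 1, as affine type A1 requires.\<close>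
  define q :: "nat \<Rightarrow> nat \<Rightarrow> 'a" where "q a b = (if a = 1 \<and> b = 0 then - l else l)" for a b
  have AB: "A t * eu 0 0 = A t" "B t * eu 0 0 = B t" for t using v(2) pe by (auto simp: A_def B_def)
  have V0: "ent (D * V t) x 0 = s t * ent (D * A t) x 0" and V1: "ent (D * V t) x (Suc 0) = ent (D * B t) x 0"
    for D t x
  proof -
    have e: "ent (D * A t) x b = (if b = 0 then ent (D * A t) x 0 else 0)" for b
      using AB(1)[of t] by (metis ent_mult_eu mult.assoc)
    have "D * V t = sc (s t) (D * A t) + D * B t * eu 0 1" by (simp add: V_def distrib_left mult.assoc)
    then show "ent (D * V t) x 0 = s t * ent (D * A t) x 0" "ent (D * V t) x (Suc 0) = ent (D * B t) x 0"
      using e[of "Suc 0"] by simp_all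
  qed
  have V0': "ent (V t) x 0 = s t * ent (A t) x 0" and V1': "ent (V t) x (Suc 0) = ent (B t) x 0" for t x
  proof -
    have "I * p = p" by (metis I_KJPQ(1) Kp mult.assoc)
    then have "I * V t = V t" "I * A t = A t" "I * B t = B t" using Iv
      by (auto simp: V_def A_def B_def distrib_left simp flip: mult.assoc)
    then show "ent (V t) x 0 = s t * ent (A t) x 0" "ent (V t) x (Suc 0) = ent (B t) x 0"
      using V0[of I t x] V1[of I t x] by simp_all
  qed
  have "nichols_fin 2 (diagc q)"
  proof (rule nfin_embed_diag[OF fin, where V = V and W = W])
    fix t
    have "I * p = p" by (metis I_KJPQ(1) Kp mult.assoc)
    then show "I * V t = V t" using Iv
      by (auto simp: V_def A_def B_def distrib_left simp flip: mult.assoc)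
    have m: "(if even t then \<phi> else \<psi>) * A t = eu 0 0" "(if even t then \<psi> else \<phi>) * A t = 0"
      "(if even t then \<phi> else \<psi>) * B t = 0" "(if even t then \<psi> else \<phi>) * B t = eu 0 0"
      using \<phi>v \<phi>p \<psi> by (auto simp: A_def B_def)
    have "W t * V t = eu 0 0 + eu 1 1"
      by (simp add: V_def W_def distrib_left distrib_right mult.assoc m m[THEN tail] ss del: One_nat_def)
    also have "\<dots> = idm 2" by (rule fmat_eqI) (auto simp: less_2_cases_iff)
    finally show "W t * V t = idm 2" .
    fix a b x y :: nat assume "a < 2" "b < 2"
    then have ab: "a = 0 \<and> b = 0 \<or> a = 0 \<and> b = Suc 0 \<or> a = Suc 0 \<and> b = 0 \<or> a = Suc 0 \<and> b = Suc 0" by auto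
    have br': "?br (A t) (A (Suc t)) x y = l * ent (A t) x 0 * ent (A (Suc t)) y 0"
      "?br (B t) (B (Suc t)) x y = l * ent (B t) x 0 * ent (B (Suc t)) y 0"
      "?br (A t) (B (Suc t)) x y = (if even t then l else - l) * ent (B t) x 0 * ent (A (Suc t)) y 0"
      "?br (B t) (A (Suc t)) x y = (if even t then - l else l) * ent (A t) x 0 * ent (B (Suc t)) y 0"
      unfolding A_def B_def by (auto simp: br)
    have pull: "(\<Sum>u\<in>UNIV. (c * f u) * (c' * g u)) = c * c' * (\<Sum>u\<in>UNIV. f u * (g u :: 'a))"
      "(\<Sum>u\<in>UNIV. (c * f u) * g u) = c * (\<Sum>u\<in>UNIV. f u * (g u :: 'a))"
      "(\<Sum>u\<in>UNIV. f u * (c' * g u)) = c' * (\<Sum>u\<in>UNIV. f u * (g u :: 'a))" for c c' and f g :: "hb \<Rightarrow> 'a"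
      by (simp_all add: sum_distrib_left mult_ac)
    show "(\<Sum>u\<in>UNIV. ent (opa M u * V (Suc t)) x b * ent (opr M (GC u) * V t) y a)
        = q a b * ent (V t) x b * ent (V (Suc t)) y a"
      using ab ss[of t]
      by (elim disjE conjE; simp only: V0 V1 V0' V1' pull br'; auto simp: q_def sSuc)
  qed
  moreover have "\<not> nichols_fin 2 (diagc q)"
  proof (rule not_fin_affine_A1)
    have "q 0 0 * q 0 1 * (q 1 0 * q 1 1) = - ((l * l) * (l * l))" by (simp add: q_def)
    then show "q 0 0 * q 0 1 * (q 1 0 * q 1 1) = 1" by (simp add: l j)
    have "q 0 1 * q 1 0 = - j" by (simp add: q_def l)
    then show "q 0 1 * q 1 0 \<noteq> 1" using j by (metis minus_equation_iff mult_minus1_right one_neq_neg_one mult.commute mult_1)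
  qed
  ultimately show False by simp
qed

section \<open>Splitting off the isotypic components\<close>

lemma G_C: "G a b * opr M (GC u) = (if u = (a, b, False) then G a b else 0)"
  by (cases u) (auto simp: C_GKJPQ G_G G_K distrib_left right_diff_distrib)

lemma ZZ_fb_tail: "Z * (Z * (fb a b * D)) = sc ((1 + sg a + sg b - sg a * sg b) / 2) (fb a b * D)"
  using ZZ_fb[of a b] by (metis mult.assoc sc_mult_left)

text \<open>On the image of \<open>A\<close> one has z^2 = -1, and \<open>e\<close> projects to the
  eigenvalue \<open>\<beta>\<close> of z; the block has size 1. The product identities serve for the
  orthogonality of the two signs of \<open>\<beta>\<close>.\<close>

lemma split_Mb:
  fixes a :: bool
  assumes b: "\<beta> * \<beta> = -1"
  defines "A \<equiv> G a (\<not> a) * fb True True"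
  defines "e \<equiv> sc (1/2) (A - sc \<beta> (Z * A))"
  shows "\<exists>n. split M e (dpow (Mb \<beta> (a, \<not> a, False)) n)" and "e * A = e" "A * e = e"
    and "(Z * A) * A = Z * A" "A * (Z * A) = Z * A" "A * A = A" "(Z * A) * (Z * A) = - A"
proof -
  have XA: "X * A = - A" "A * X = - A" "Y * A = - A" "A * Y = - A"
    by (simp_all add: A_def G_X[symmetric, THEN tail] G_Y[symmetric, THEN tail] mult.assoc XY_fb sc_simps)
  have AZ: "A * Z = Z * A"
    using GZ_fb[of a "\<not> a" True True] Z_fb[of True True] by (simp add: A_def mult.assoc)
  have ZZA: "Z * (Z * A) = - A"
    unfolding A_def G_fb by (simp add: ZZ_fb_tail)
  have AA: "A * A = A"
  proof -
    have "A * A = (G a (\<not> a) * fb True True) * (fb True True * G a (\<not> a))" by (simp add: A_def flip: G_fb)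
    also have "\<dots> = G a (\<not> a) * (fb True True * G a (\<not> a))" by (simp add: mult.assoc fb_fb[THEN tail])
    also have "\<dots> = A" by (simp add: A_def G_G[THEN tail] flip: G_fb)
    finally show ?thesis .
  qed
  have CA: "opr M (GC u) * A = (if u = (a, \<not> a, False) then A else 0)" for u
    by (simp add: A_def C_G[THEN tail])
  have AC: "A * opr M (GC u) = (if u = (a, \<not> a, False) then A else 0)" for u
    by (simp add: A_def G_fb G_C mult.assoc)
  have IA: "I * A = A" "A * I = A" by (simp_all add: A_def mult.assoc) (simp flip: mult.assoc)
  have C0: "opr M (GC u) * (Z * A) = (if u = (a, \<not> a, False) then Z * A else 0)" for u
    unfolding AZ[symmetric] mult.assoc[symmetric] CA by simp
  show ZA: "(Z * A) * A = Z * A" "A * (Z * A) = Z * A" by (simp_all add: mult.assoc AA AZ[THEN tail])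
  show "A * A = A" "(Z * A) * (Z * A) = - A" by (simp_all add: AA ZZA AZ[THEN tail] mult.assoc)
  show eA: "e * A = e" "A * e = e"
    by (simp_all add: e_def left_diff_distrib right_diff_distrib AA ZA mult.assoc)
  have ee: "e * e = e"
  proof -
    have "(A - sc \<beta> (Z * A)) * (A - sc \<beta> (Z * A)) = sc 2 (A - sc \<beta> (Z * A))"
      using b by (simp add: left_diff_distrib right_diff_distrib AA AZ[THEN tail] ZZA mult.assoc)
        (rule fmat_eqI, simp add: algebra_simps)
    then show ?thesis by (simp add: e_def)
  qed
  have "\<exists>n. split M (\<Sum>i<ydim (Mb \<beta> (a, \<not> a, False)). (\<lambda>_. e) i * (\<lambda>_. e) i) (dpow (Mb \<beta> (a, \<not> a, False)) n)"
  proof (rule split_simple[where E = e])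
    show "I * e = e" "e * I = e"
      using IA eA by (metis mult.assoc)+
    have r: "X * (Z * A) = Z * (Y * A)" "Y * (Z * A) = Z * (X * A)"
      by (simp_all add: ZX ZY flip: mult.assoc)
    show "opr M g * e = (\<Sum>k<ydim (Mb \<beta> (a, \<not> a, False)). sc (gmat (Mb \<beta> (a, \<not> a, False)) g k i) e)"
      if "i < ydim (Mb \<beta> (a, \<not> a, False))" for i g
      using b by (cases g)
       (simp_all add: Mb_def e_def right_diff_distrib XA r CA C0 ZZA sc_simps, (auto intro!: fmat_eqI simp: field_simps)?)
    show "e * opr M g = (\<Sum>k<ydim (Mb \<beta> (a, \<not> a, False)). sc (gmat (Mb \<beta> (a, \<not> a, False)) g i k) e)"
      if "i < ydim (Mb \<beta> (a, \<not> a, False))" for i g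
      using b by (cases g)
       (simp_all add: Mb_def e_def left_diff_distrib XA mult.assoc AC AZ ZZA sc_simps, (auto intro!: fmat_eqI simp: field_simps)?)
  qed (auto simp: ee)
  then show "\<exists>n. split M e (dpow (Mb \<beta> (a, \<not> a, False)) n)" by (simp add: ee)
qed

text \<open>z exchanges the images of \<open>A c d\<close> and \<open>B d (\<not> c)\<close> and
  squares to 1 there. So \<open>A\<close>, \<open>Z * A\<close> is the first column and
  \<open>A\<close>, \<open>A * Z\<close> the first row of a 2 by 2 system of matrix units.\<close>

lemma split_Mpair:
  defines "A \<equiv> \<lambda>c d. G c d * fb False True" and "B \<equiv> \<lambda>c d. G c d * fb True False"
  shows "\<exists>n. split M (A c d + B d (\<not> c)) (dpow (Mpair (c, d, False) (d, \<not> c, False)) n)"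
proof -
  let ?A = "A c d" and ?B = "B d (\<not> c)" and ?S = "Mpair (c, d, False) (d, \<not> c, False) :: 'a ydm"
  define g1 where "g1 = (c, d, False)"
  define g2 where "g2 = (d, \<not> c, False)"
  have ne: "g1 \<noteq> g2" by (auto simp: g1_def g2_def)
  have S: "?S = Mpair g1 g2" by (simp add: g1_def g2_def)
  have XA: "X * ?A = ?A" "?A * X = ?A" "Y * ?A = - ?A" "?A * Y = - ?A"
    by (simp_all add: A_def G_X[symmetric, THEN tail] G_Y[symmetric, THEN tail] mult.assoc XY_fb sc_simps)
  have BZ: "?B * Z = Z * ?A"
    using GZ_fb[of d "\<not> c" False True] Z_fb[of False True] by (simp add: A_def B_def mult.assoc)
  have ZZA: "Z * (Z * ?A) = ?A"
    unfolding A_def G_fb by (simp add: ZZ_fb_tail)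
  have ZZB: "Z * (Z * ?B) = ?B"
    unfolding B_def G_fb by (simp add: ZZ_fb_tail)
  have AZ: "?A * Z = Z * ?B"
  proof -
    have "Z * (?B * Z) = ?A" by (simp add: BZ ZZA)
    then have "?A * Z = Z * (?B * (Z * Z))" by (metis mult.assoc)
    moreover have "?B * (Z * Z) = ?B"
    proof -
      have "fb True False * (Z * Z) = Z * (Z * fb True False)"
        by (metis Z_fb mult.assoc)
      then show ?thesis by (simp add: B_def mult.assoc ZZ_fb)
    qed
    ultimately show ?thesis by simp
  qed
  have AA: "?A * ?A = ?A"
  proof -
    have "?A * ?A = (G c d * fb False True) * (fb False True * G c d)" by (simp add: A_def flip: G_fb)
    also have "\<dots> = G c d * (fb False True * G c d)" by (simp add: mult.assoc fb_fb[THEN tail])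
    also have "\<dots> = ?A" by (simp add: A_def G_G[THEN tail] flip: G_fb)
    finally show ?thesis .
  qed
  have BA: "?B * ?A = 0" "?A * ?B = 0"
    unfolding A_def B_def G_fb by (simp_all add: mult.assoc G_fb[THEN tail] fb_fb[THEN tail])
  have CA: "opr M (GC u) * ?A = (if u = g1 then ?A else 0)" for u
    by (simp add: A_def C_G[THEN tail] g1_def)
  have AC: "?A * opr M (GC u) = (if u = g1 then ?A else 0)" for u
    by (simp add: A_def G_fb G_C mult.assoc g1_def)
  have CB: "opr M (GC u) * ?B = (if u = g2 then ?B else 0)" for u
    by (simp add: B_def C_G[THEN tail] g2_def)
  have BC: "?B * opr M (GC u) = (if u = g2 then ?B else 0)" for u
    by (simp add: B_def G_fb G_C mult.assoc g2_def)
  have IA: "I * ?A = ?A" "?A * I = ?A" by (simp_all add: A_def mult.assoc) (simp flip: mult.assoc)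
  have r: "X * (Z * D) = Z * (Y * D)" "Y * (Z * D) = Z * (X * D)" for D
    by (simp_all add: ZX ZY flip: mult.assoc)
  have AZX: "?A * (Z * X) = - (?A * Z)" "?A * (Z * Y) = ?A * Z" "?A * (Z * Z) = ?A"
    by (simp_all add: ZX ZY XA[THEN tail]) (simp_all add: AZ BZ ZZA flip: mult.assoc, simp add: mult.assoc BZ ZZA)
  have IZ: "I * (Z * D) = Z * D" for D by (simp flip: mult.assoc)
  have CZA: "opr M (GC u) * (Z * ?A) = (if u = g2 then Z * ?A else 0)" for u
    by (simp add: CB[THEN tail] flip: BZ)
  have AZC: "?A * (Z * opr M (GC u)) = (if u = g2 then ?A * Z else 0)" for u
  proof -
    have "?A * (Z * opr M (GC u)) = Z * (?B * opr M (GC u))" using AZ by (simp flip: mult.assoc)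
    then show ?thesis by (simp add: BC AZ)
  qed
  have "\<exists>n. split M (\<Sum>i<ydim ?S. (if i = 0 then ?A else Z * ?A) * (if i = 0 then ?A else ?A * Z)) (dpow ?S n)"
  proof (rule split_simple[where E = ?A])
    show "I * (if i = 0 then ?A else Z * ?A) = (if i = 0 then ?A else Z * ?A)" for i :: nat
      by (simp add: IA IZ)
    show "(if i = 0 then ?A else ?A * Z) * I = (if i = 0 then ?A else ?A * Z)" for i :: nat
      by (simp add: IA mult.assoc)
    show "(if i = 0 then ?A else Z * ?A) * ?A = (if i = 0 then ?A else Z * ?A)" for i :: nat
      by (simp add: AA mult.assoc)
    show "?A * (if i = 0 then ?A else ?A * Z) = (if i = 0 then ?A else ?A * Z)" for i :: nat
      by (simp add: AA flip: mult.assoc)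
    show "(if i = 0 then ?A else ?A * Z) * (if k = 0 then ?A else Z * ?A) = (if i = k then ?A else 0)"
      if "i < ydim ?S" "k < ydim ?S" for i k
    proof -
      have "?A * (Z * ?A) = 0" "?A * (Z * (Z * ?A)) = ?A"
        by (simp_all add: AZ[THEN tail] BA AA ZZA mult.assoc)
      then show ?thesis using that by (auto simp: AA mult.assoc less_2_cases_iff)
    qed
    show "opr M g * (if i = 0 then ?A else Z * ?A) = (\<Sum>k<ydim ?S. sc (gmat ?S g k i) (if k = 0 then ?A else Z * ?A))"
      if "i < ydim ?S" for i g
      using that ne unfolding S by (cases g) (auto simp: Mpair_def lessThan_2 less_2_cases_iff XA r ZZA CA CZA)
    show "(if i = 0 then ?A else ?A * Z) * opr M g = (\<Sum>k<ydim ?S. sc (gmat ?S g i k) (if k = 0 then ?A else ?A * Z))"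
      if "i < ydim ?S" for i g
      using that ne unfolding S by (cases g) (auto simp: Mpair_def lessThan_2 less_2_cases_iff XA AZX mult.assoc AC AZC)
  qed simp
  moreover have "(\<Sum>i<ydim ?S. (if i = 0 then ?A else Z * ?A) * (if i = 0 then ?A else ?A * Z)) = ?A + ?B"
  proof -
    have "(Z * ?A) * (?A * Z) = ?B"
      by (simp add: mult.assoc AA[THEN tail]) (simp add: AZ ZZB)
    then show ?thesis by (simp add: lessThan_2 AA)
  qed
  ultimately show ?thesis by simp
qed

text \<open>\<open>E j\<close> projects to the eigenvalue \<open>- j\<close> of \<open>J\<close>. On
  its \<open>fb False False\<close> part z is -1 by \<open>neg\<close>; \<open>P\<close> carries
  this part to the \<open>fb True True\<close> part of \<open>E (- j)\<close>, where z becomes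
  \<open>j\<close>. Column and row of the block are obtained by multiplying with
  \<open>P\<close>.\<close>

lemma split_Wm:
  assumes j: "im * b1 = j" "b1 * b1 = 1" "im * im = -1" and neg: "Z * (K * fb False False) = - (K * fb False False)"
  defines "E \<equiv> \<lambda>j. sc (1/2) (K + sc j J)"
  shows "\<exists>n. split M (E j * fb False False + E (- j) * fb True True) (dpow (Wm im b1 (-1)) n)"
proof -
  let ?S = "Wm im b1 (-1)"
  define A where "A = E j * fb False False"
  have jj: "j * j = -1"
  proof -
    have "j * j = (im * im) * (b1 * b1)" by (simp add: mult_ac flip: j(1))
    then show ?thesis using j by simp
  qed
  have XA: "X * A = A" "A * X = A" "Y * A = A" "A * Y = A"
    by (simp_all add: A_def E_def distrib_left distrib_right mult.assoc XY_fb KJPQ_X(1,2,4,5)[symmetric, THEN tail])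
  have KA: "K * A = A" "A * K = A"
    by (simp_all add: A_def E_def distrib_left distrib_right mult.assoc KJPQ[THEN tail] KJ_fb[symmetric])
  have JA: "J * A = sc (- j) A" "A * J = sc (- j) A"
    using jj by (simp_all add: A_def E_def distrib_left distrib_right mult.assoc KJPQ[THEN tail] KJ_fb[symmetric])
      (auto intro!: fmat_eqI simp: field_simps)
  have fA: "fb False False * A = A" "A * fb False False = A"
    by (simp_all add: A_def E_def distrib_left distrib_right mult.assoc KJ_fb[symmetric, THEN tail] fb_fb)
  have AA: "A * A = A"
  proof -
    have "A * A = sc (1/2) (A * K + sc j (A * J)) * fb False False"
      by (subst (2) A_def) (simp add: E_def distrib_left distrib_right mult.assoc)
    also have "\<dots> = A" using jj by (simp add: KA JA distrib_right fA) (rule fmat_eqI, simp)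
    finally show ?thesis .
  qed
  have ZXY: "X * (Y * (Z * D)) = Z * (X * (Y * D))" for D
  proof -
    have "X * (Z * D) = Z * (Y * D)" "Y * (Z * D) = Z * (X * D)" for D
      by (simp_all add: ZX ZY flip: mult.assoc)
    moreover have "Y * (X * D) = X * (Y * D)" by (simp add: XY flip: mult.assoc)
    ultimately show ?thesis by simp
  qed
  have JZ: "J * (Z * D) = X * (Y * (Z * (J * D)))" for D
    using KJPQ_Z(2)[THEN tail, of D] by (simp add: mult.assoc)
  have XYJ: "X * (Y * (J * fb False False)) = J * fb False False"
    by (simp add: KJ_fb XY_fb[THEN tail])
  have ZJ: "Z * (J * fb False False) = - (J * fb False False)"
  proof -
    have "J * (Z * (K * fb False False)) = - (J * fb False False)" by (simp add: neg KJPQ[THEN tail])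
    then show ?thesis by (simp add: JZ ZXY KJPQ[THEN tail] XYJ)
  qed
  have ZA: "Z * A = - A"
    by (simp add: A_def E_def distrib_left distrib_right neg ZJ) (rule fmat_eqI, simp add: field_simps)
  have AZ: "A * Z = - A"
  proof -
    have "A * Z = E j * (Z * fb False False)" by (simp add: A_def mult.assoc Z_fb)
    also have "\<dots> = - A"
      by (simp add: A_def E_def distrib_right JZ ZXY XYJ ZJ KJPQ_Z(1)[THEN tail] mult.assoc neg)
        (rule fmat_eqI, simp add: field_simps)
    finally show ?thesis .
  qed
  have PP: "P * (P * A) = A" "A * (P * P) = A" by (simp_all add: KJPQ KA KJPQ[THEN tail])
  have APA: "A * (P * A) = 0"
  proof -
    have "fb False False * (P * A) = P * (fb True True * A)"
      using KJ_fb(3)[of True True] by (simp flip: mult.assoc)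
    also have "\<dots> = P * (fb True True * (fb False False * A))" by (simp only: fA)
    finally have "fb False False * (P * A) = 0" by (simp add: fb_fb[THEN tail])
    then have "A * (fb False False * (P * A)) = 0" by simp
    then show ?thesis by (simp add: fA(2)[THEN tail])
  qed
  have JPA: "J * (P * A) = sc j (P * A)"
  proof -
    have "J * (P * A) = - (P * (J * A))" by (simp add: KJPQ[THEN tail])
    then show ?thesis by (simp add: JA)
  qed
  have APJ: "A * (P * J) = sc j (A * P)"
  proof -
    have "A * (P * J) = - ((A * J) * P)" by (simp add: KJPQ mult.assoc)
    then show ?thesis by (simp add: JA)
  qed
  have QA: "Q * A = sc j (P * A)" "Q * (P * A) = sc (- j) A" "A * Q = sc (- j) (A * P)" "A * (P * Q) = sc j A"
  proof -
    show "Q * A = sc j (P * A)" "Q * (P * A) = sc (- j) A"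
      unfolding KJPQ(8)[symmetric] mult.assoc by (simp_all add: JPA PP JA)
    show "A * Q = sc (- j) (A * P)"
      unfolding KJPQ(8)[symmetric] mult.assoc[symmetric] JA by simp
    have "A * (P * Q) = (A * (P * J)) * P" unfolding KJPQ(8)[symmetric] mult.assoc ..
    then show "A * (P * Q) = sc j A" by (simp add: APJ PP mult.assoc)
  qed
  have XPA: "X * (P * A) = - (P * A)" "Y * (P * A) = - (P * A)" "A * (P * X) = - (A * P)" "A * (P * Y) = - (A * P)"
  proof -
    have "X * P = - (P * X)" "Y * P = - (P * Y)" using KJPQ_X by simp_all
    then show "X * (P * A) = - (P * A)" "Y * (P * A) = - (P * A)" by (simp_all add: XA flip: mult.assoc) (simp_all add: mult.assoc XA)
  qed (simp_all add: KJPQ_X XA[THEN tail])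
  have ZPA: "Z * (P * A) = sc j (P * A)"
  proof -
    have "Q * (Z * A) = - (Z * (P * A))"
    proof -
      have "Q * (Z * A) = J * (P * (Z * A))" by (simp add: mult.assoc flip: KJPQ(8))
      also have "\<dots> = J * (Z * (Q * A))" by (simp add: KJPQ_Z(3)[THEN tail] mult.assoc)
      also have "\<dots> = Z * (X * (Y * (J * (Q * A))))" by (simp add: JZ ZXY)
      also have "\<dots> = - (Z * (P * A))" using jj by (simp add: QA JPA XPA)
      finally show ?thesis .
    qed
    then show ?thesis by (simp add: ZA QA)
  qed
  have APZ: "A * (P * Z) = sc j (A * P)"
    using QA by (simp add: KJPQ_Z AZ[THEN tail])
  have GA: "G a b * A = 0" "A * G a b = 0" "G a b * (P * A) = 0" "A * (P * G a b) = 0" for a b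
    by (simp_all add: G_K G_K[THEN tail] A_def E_def distrib_left distrib_right mult.assoc flip: G_fb)
  have CA: "C a b c * A = (if c then sc ((1 - j * (sg a * sg b)) / 4) A + sc ((sg a + j * sg b) / 4) (P * A) else 0)"
    "C a b c * (P * A) = (if c then sc ((sg a - j * sg b) / 4) A + sc ((1 + j * (sg a * sg b)) / 4) (P * A) else 0)"
    "A * C a b c = (if c then sc ((1 - j * (sg a * sg b)) / 4) A + sc ((sg a - j * sg b) / 4) (A * P) else 0)"
    "A * (P * C a b c) = (if c then sc ((sg a + j * sg b) / 4) A + sc ((1 + j * (sg a * sg b)) / 4) (A * P) else 0)" for a b c
    by (simp_all add: C_GKJPQ GA distrib_left distrib_right KA JA QA JPA APJ PP KJPQ(5) KJPQ(4)[THEN tail])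
      (auto intro!: fmat_eqI simp: field_simps)
  have IA: "I * A = A" "A * I = A" "I * (P * A) = P * A"
    by (metis KA I_KJPQ mult.assoc)+
  have "\<exists>n. split M (\<Sum>i<ydim ?S. (if i = 0 then A else P * A) * (if i = 0 then A else A * P)) (dpow ?S n)"
  proof (rule split_simple[where E = A])
    show "I * (if i = 0 then A else P * A) = (if i = 0 then A else P * A)" for i :: nat
      by (simp add: IA)
    show "(if i = 0 then A else A * P) * I = (if i = 0 then A else A * P)" for i :: nat
      by (simp add: IA mult.assoc)
    show "(if i = 0 then A else P * A) * A = (if i = 0 then A else P * A)" for i :: nat
      by (simp add: AA mult.assoc)
    show "A * (if i = 0 then A else A * P) = (if i = 0 then A else A * P)" for i :: nat
      by (simp add: AA flip: mult.assoc)
    show "(if i = 0 then A else A * P) * (if k = 0 then A else P * A) = (if i = k then A else 0)"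
      if "i < ydim ?S" "k < ydim ?S" for i k
      using that by (auto simp: AA PP APA mult.assoc less_2_cases_iff)
    have az: "az ?S 0 0 = -1" "az ?S 0 (Suc 0) = 0" "az ?S (Suc 0) 0 = 0" "az ?S (Suc 0) (Suc 0) = j"
      "ax ?S 0 0 = 1" "ax ?S 0 (Suc 0) = 0" "ax ?S (Suc 0) 0 = 0" "ax ?S (Suc 0) (Suc 0) = -1"
      "ay ?S 0 0 = 1" "ay ?S 0 (Suc 0) = 0" "ay ?S (Suc 0) 0 = 0" "ay ?S (Suc 0) (Suc 0) = -1"
      using j(1) by (simp_all add: Wm_def)
    note co = co_Wm[of im b1 "-1", unfolded j(1)] co_Wm[of im b1 "-1", unfolded j(1) One_nat_def]
    show "opr M g * (if i = 0 then A else P * A) = (\<Sum>k<ydim ?S. sc (gmat ?S g k i) (if k = 0 then A else P * A))"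
      if "i < ydim ?S" for i g
    proof (cases g)
      case (GC u)
      then show ?thesis using that by (cases u) (auto simp: lessThan_2 less_2_cases_iff CA co)
    qed (use that in \<open>auto simp: lessThan_2 less_2_cases_iff XA XPA ZA ZPA az\<close>)
    show "(if i = 0 then A else A * P) * opr M g = (\<Sum>k<ydim ?S. sc (gmat ?S g i k) (if k = 0 then A else A * P))"
      if "i < ydim ?S" for i g
    proof (cases g)
      case (GC u)
      then show ?thesis using that by (cases u) (auto simp: lessThan_2 less_2_cases_iff CA co mult.assoc)
    qed (use that in \<open>auto simp: lessThan_2 less_2_cases_iff XA XPA AZ APZ az mult.assoc\<close>)
  qed simp
  moreover have "(\<Sum>i<ydim ?S. (if i = 0 then A else P * A) * (if i = 0 then A else A * P))
      = E j * fb False False + E (- j) * fb True True"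
  proof -
    have "(P * A) * (A * P) = P * (A * P)" by (simp add: mult.assoc AA[THEN tail])
    also have "\<dots> = P * (E j * (P * fb True True))"
      using KJ_fb(3)[of True True] by (simp add: A_def mult.assoc)
    also have "\<dots> = E (- j) * fb True True"
    proof -
      have "P * (J * (P * D)) = - (J * D)" for D
        by (simp add: KJPQ(9)[THEN tail] mult.assoc flip: KJPQ(8)) (simp add: KJPQ(7)[THEN tail] KJPQ(3)[THEN tail])
      then show ?thesis by (simp add: E_def distrib_left distrib_right left_diff_distrib KJPQ[THEN tail] mult.assoc)
    qed
    finally show ?thesis by (simp add: lessThan_2 AA) (simp add: A_def)
  qed
  ultimately show ?thesis by simp
qed

end

section \<open>The classification\<close>

text \<open>On vectors of the (False, True) part with \<open>J\<close>-eigenvalue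
  \<open>- j\<close>, the square of \<open>P * Z\<close> is the scalar \<open>j\<close>. A square
  root of \<open>j\<close> gives an eigenvector of \<open>P * Z\<close>, which is what
  \<open>not_nfin_of_vec\<close> forbids.\<close>

lemma (in yd_module) kill_mixed:
  fixes im :: 'a
  assumes fin: "nfin M" and im: "im * im = -1" and root: "\<And>j. \<exists>l::'a. l * l = j"
  shows "K * fb False True = 0" "K * fb True False = 0"
proof -
  show *: "K * fb False True = 0"
  proof (rule ccontr)
    assume "K * fb False True \<noteq> 0"
    moreover have "K = sc (1/2) (K + sc im J) + sc (1/2) (K + sc (- im) J)"
      by (rule fmat_eqI) (simp add: field_simps)
    ultimately obtain j where j: "j = im \<or> j = - im" and ne: "sc (1/2) (K + sc j J) * fb False True \<noteq> 0"
      by (metis distrib_right add.right_neutral)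
    have jj: "j * j = -1" using j im by auto
    obtain i p where "ent (sc (1/2) (K + sc j J) * fb False True) i p \<noteq> 0"
      using ne by (metis fmat_eqI ent_ring(1))
    then have "ent (sc (1/2) (K + sc j J) * fb False True * eu p 0) i 0 \<noteq> 0" by simp
    moreover define w where "w = sc (1/2) (K + sc j J) * fb False True * eu p 0"
    ultimately have w0: "w \<noteq> 0" by (metis ent_ring(1))
    have we: "w * eu 0 0 = w" by (simp add: w_def mult.assoc)
    have Kw: "K * w = w" by (simp add: w_def distrib_left distrib_right KJPQ[THEN tail] mult.assoc)
    have fw: "fb False True * w = w"
      by (simp add: w_def distrib_left distrib_right mult.assoc KJ_fb(1,2)[symmetric, THEN tail] fb_fb[THEN tail])
    have Jw: "J * w = sc (- j) w"
      using jj by (simp add: w_def distrib_left distrib_right KJPQ[THEN tail] mult.assoc)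
        (rule fmat_eqI, simp add: field_simps)
    have Xw: "X * w = w" "Y * w = - w"
      using XY_fb(1,2)[of False True, THEN tail, of w] by (simp_all add: fw)
    have r: "X * (Z * D) = Z * (Y * D)" "Y * (Z * D) = Z * (X * D)" for D
      by (simp_all add: ZX ZY flip: mult.assoc)
    have JZ: "J * (Z * D) = X * (Y * (Z * (J * D)))" for D
      using KJPQ_Z(2)[THEN tail, of D] by (simp add: mult.assoc)
    have KZ: "K * (Z * D) = Z * (K * D)" for D using KJPQ_Z(1)[THEN tail, of D] by (simp add: mult.assoc)
    have JZw: "J * (Z * w) = sc j (Z * w)" by (simp add: JZ Jw r Xw)
    have ZZw: "Z * (Z * w) = w" using ZZ_fb_tail[of False True w] by (simp add: fw)
    define u where "u = P * (Z * w)"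
    have Ku: "K * u = u" by (simp add: u_def KJPQ[THEN tail])
    have fZw: "fb True False * (Z * w) = Z * w"
    proof -
      have "fb True False * (Z * w) = Z * (fb False True * w)" using Z_fb[of False True] by (simp flip: mult.assoc)
      then show ?thesis by (simp add: fw)
    qed
    have fu: "fb False True * u = u"
    proof -
      have "fb False True * u = P * (fb True False * (Z * w))"
        using KJ_fb(3)[of True False] by (simp add: u_def flip: mult.assoc)
      then show ?thesis by (simp add: fZw u_def)
    qed
    have Ju: "J * u = sc (- j) u"
    proof -
      have "J * u = - (P * (J * (Z * w)))" by (simp add: u_def KJPQ[THEN tail])
      then show ?thesis by (simp add: JZw u_def)
    qed
    have PZu: "P * (Z * u) = sc j w"
    proof -
      have "P * (Z * u) = Z * (Q * (P * (Z * w)))" using KJPQ_Z(3)[THEN tail, of u] by (simp add: u_def mult.assoc)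
      also have "Q * (P * (Z * w)) = J * (K * (Z * w))" by (simp add: KJPQ[THEN tail] mult.assoc flip: KJPQ(8))
      finally show ?thesis by (simp add: KZ Kw JZw ZZw)
    qed
    have ue: "u * eu 0 0 = u" using we by (simp add: u_def mult.assoc)
    obtain l where l: "l * l = j" using root by blast
    show False
    \<comment> \<open>From (PZ - l)(PZ + l) w = 0: either PZ w + l w is an eigenvector for
      \<open>l\<close>, or \<open>w\<close> itself is one for \<open>- l\<close>.\<close>
    proof (cases "u + sc l w = 0")
      case True
      then have "P * (Z * w) = sc (- l) w" by (simp add: u_def eq_neg_iff_add_eq_0)
      then show False
        using not_nfin_of_vec[OF w0 we Kw fw Jw _ _ jj, of "- l"] l fin by simp
    next
      case False
      let ?v = "u + sc l w"
      have 1: "?v * eu 0 0 = ?v" "K * ?v = ?v" "fb False True * ?v = ?v" "J * ?v = sc (- j) ?v"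
        by (simp_all add: distrib_left distrib_right ue we Ku Kw fu fw Ju Jw sc_simps mult.commute)
      have "P * (Z * ?v) = sc l ?v"
        by (simp add: distrib_left PZu sc_simps l flip: u_def)
      then show False
        using not_nfin_of_vec[OF False 1 _ l jj] fin by simp
    qed
  qed
  \<comment> \<open>\<open>P\<close> exchanges the two mixed parts and is invertible on the image of
    \<open>K\<close>.\<close>
  have "P * (K * fb False True) * P = P * (P * fb True False)"
    using KJ_fb(3)[of True False] by (simp add: mult.assoc KJPQ(5)[THEN tail])
  also have "\<dots> = K * fb True False" by (simp add: KJPQ(7)[THEN tail])
  finally show "K * fb True False = 0" by (simp add: *)
qed

section \<open>Multiplicities of the simple summands\<close>

lemma split_idem: "split M e N \<Longrightarrow> e * e = e"
  unfolding split_def morph_def by (metis mult.assoc)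

lemma split_0: "split M e N \<Longrightarrow> ydim N = 0 \<Longrightarrow> e = 0"
proof -
  assume "split M e N" "ydim N = 0"
  then obtain P R where "e = P * R" "P * idn N = P" by (auto simp: split_def morph_def)
  moreover have "idn N = 0" using \<open>ydim N = 0\<close> by (auto intro!: fmat_eqI simp: idn_def)
  ultimately show "e = 0" by simp
qed

lemma split_dpow_1: "split M e (dpow S (Suc 0)) \<Longrightarrow> split M e S"
  using split_dsumD[of M e yd0 S] split_0[of M _ yd0] by fastforce

lemma split_dpow_Suc:
  assumes "split M e (dpow S (Suc n))"
  obtains g where "split M g S" "e * g = g" "g * e = g"
proof -
  obtain e1 g where "e = e1 + g" "split M g S" "e1 * g = 0" "g * e1 = 0"
    using split_dsumD[of M e "dpow S n" S] assms by auto
  then show ?thesis using that[of g] split_idem[of M g S] by (simp add: distrib_left distrib_right)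
qed

text \<open>One copy is taken from each component; idempotents below \<open>e\<close> and
  \<open>e'\<close> inherit orthogonality, so the sum of the two copies is again a summand of
  \<open>M\<close>.\<close>

lemma nfin_dsum_of_split:
  assumes fin: "nfin M" and "split M e (dpow S m)" "split M e' (dpow S' n)" "m \<noteq> 0" "n \<noteq> 0"
    and orth: "e * e' = 0" "e' * e = 0"
  shows "nfin (dsum S S')"
proof -
  obtain g where g: "split M g S" "e * g = g" "g * e = g"
    using assms by (metis not0_implies_Suc split_dpow_Suc)
  obtain g' where g': "split M g' S'" "e' * g' = g'" "g' * e' = g'"
    using assms by (metis not0_implies_Suc split_dpow_Suc)
  have "g * g' = 0" "g' * g = 0" using g g' orth by (metis mult.assoc mult_zero_left mult_zero_right)+
  then show ?thesis using nfin_split[OF split_dsum[OF g(1) g'(1)] fin] by simp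
qed

lemma nfin_dsum_self_of_split:
  assumes fin: "nfin M" and "split M e (dpow S n)" "n \<ge> 2"
  shows "nfin (dsum S S)"
proof -
  obtain m where n: "n = Suc (Suc m)" using assms by (metis add_2_eq_Suc le_Suc_ex)
  obtain e1 g where e1: "split M e1 (dpow S (Suc m))" and g: "split M g S" "e1 * g = 0" "g * e1 = 0"
    using split_dsumD[of M e "dpow S (Suc m)" S] assms n by auto
  have "split M g (dpow S (Suc 0))"
    using split_dsum[OF split_yd0 g(1)] by simp
  then show ?thesis using nfin_dsum_of_split[OF fin e1 _ _ _ g(2,3)] by blast
qed

definition simples :: "'a::field_char_0 \<Rightarrow> 'a ydm list" where
  "simples im = [Mb im ex, Mb (- im) ex, Mb im ey, Mb (- im) ey, Mpair exy ex, Mpair ey exy, Wm im 1 (-1), Wm im (-1) (-1)]"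

lemma less_8: "i < 8 \<longleftrightarrow> i = 0 \<or> i = 1 \<or> i = 2 \<or> i = 3 \<or> i = 4 \<or> i = 5 \<or> i = 6 \<or> i = (7::nat)"
  by auto

lemma (in yd_module) decomposition:
  fixes im :: 'a
  assumes fin: "nfin M" and im: "im * im = -1" and root: "\<And>j. \<exists>l::'a. l * l = j"
  obtains e n where "\<And>i. i < 8 \<Longrightarrow> split M (e i) (dpow (simples im ! i) (n i))"
    and "\<And>i j. i < 8 \<Longrightarrow> j < 8 \<Longrightarrow> i \<noteq> j \<Longrightarrow> e i * e j = 0"
    and "e 0 + e 1 + e 2 + e 3 + e 4 + e 5 + e 6 + e (7::nat) = I"
proof -
  have im': "(- im) * (- im) = -1" using im by simp
  note kG = kill_G[OF fin] and kM = kill_mixed[OF fin im root] and kP = kill_K_plus[OF fin]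
  let ?A = "\<lambda>a. G a (\<not> a) * fb True True"
  let ?eM = "\<lambda>\<beta> a. sc (1/2) (?A a - sc \<beta> (Z * ?A a))"
  let ?E = "\<lambda>j. sc (1/2) (K + sc j J)"
  let ?c2 = "G True True * fb False True + G True False * fb True False"
  let ?c3 = "G False True * fb False True + G True True * fb True False"
  let ?W = "\<lambda>j. ?E j * fb False False + ?E (- j) * fb True True"
  \<comment> \<open>Coarse idempotents. \<open>e 0\<close>, \<open>e 1\<close> lie in one cell and
    \<open>e 2\<close>, \<open>e 3\<close> in another, told apart only by the eigenvalue of z.
    Different cells are orthogonal, which settles most products \<open>e i * e j\<close>.\<close>
  define c where c_def: "c i = [?A True, ?A True, ?A False, ?A False, ?c2, ?c3, ?W im, ?W (- im)] ! i" for i :: nat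
  define e where "e i = [?eM im True, ?eM (- im) True, ?eM im False, ?eM (- im) False, ?c2, ?c3, ?W im, ?W (- im)] ! i" for i :: nat
  have "\<exists>n. split M (e i) (dpow (simples im ! i) n)" if "i < 8" for i
    using that split_Mb(1)[OF im, of True] split_Mb(1)[OF im', of True] split_Mb(1)[OF im, of False]
      split_Mb(1)[OF im', of False] split_Mpair[of True True] split_Mpair[of False True]
      split_Wm[of im 1 im, OF _ _ im kP] split_Wm[of im "-1" "- im", OF _ _ im kP]
    unfolding less_8 by (elim disjE) (simp_all add: e_def simples_def ex_def ey_def exy_def)
  then obtain n where n: "\<And>i. i < 8 \<Longrightarrow> split M (e i) (dpow (simples im ! i) (n i))" by metis
  have r: "fb a b * (G c d * D) = G c d * (fb a b * D)" "fb a b * (K * D) = K * (fb a b * D)"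
    "fb a b * (J * D) = J * (fb a b * D)" for a b c d D
    by (simp_all add: G_fb KJ_fb flip: mult.assoc)
  define a1 a2 a3 a4 w1 w2 where cells: "a1 = ?A True" "a2 = ?A False" "a3 = ?c2" "a4 = ?c3" "w1 = ?W im" "w2 = ?W (- im)"
  note ring = cells distrib_left distrib_right left_diff_distrib right_diff_distrib mult.assoc r fb_fb fb_fb[THEN tail]
      G_G[THEN tail] G_K G_K[THEN tail] KJPQ[THEN tail]
  have p: "a1 * a2 = 0" "a2 * a1 = 0" "a1 * a3 = 0" "a3 * a1 = 0" "a1 * a4 = 0" "a4 * a1 = 0"
    "a2 * a3 = 0" "a3 * a2 = 0" "a2 * a4 = 0" "a4 * a2 = 0" "a3 * a4 = 0" "a4 * a3 = 0"
    by (simp_all add: ring)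
  have pw: "a * w = 0" "w * a = 0" if "a \<in> {a1, a2, a3, a4}" "w \<in> {w1, w2}" for a w
    using that by (auto simp: ring)
  have ww: "w1 * w2 = 0" "w2 * w1 = 0"
  proof -
    have "im * (im * x) = - x" for x using im by (simp flip: mult.assoc)
    then show "w1 * w2 = 0" "w2 * w1 = 0" using im
      by (simp_all add: ring) (auto intro!: fmat_eqI simp: field_simps)
  qed
  have c_cells: "c i = [a1, a1, a2, a2, a3, a4, w1, w2] ! i" for i
    by (simp add: c_def cells)
  have cc: "c i * c j = 0" if "i < 8" "j < 8" "i div 2 \<noteq> j div 2 \<or> (i \<noteq> j \<and> i \<ge> 4)" for i j
    using that unfolding less_8 c_cells by (elim disjE) (simp_all add: p pw ww)
  have ec: "e i * c i = e i" "c i * e i = e i" if "i < 8" for i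
  proof -
    have "e i * c i = e i \<and> c i * e i = e i" if "i < 4"
      using that split_Mb(2,3)[OF im, of True] split_Mb(2,3)[OF im', of True] split_Mb(2,3)[OF im, of False]
      split_Mb(2,3)[OF im', of False] unfolding less_4 by (elim disjE) (simp_all add: e_def c_def)
    moreover have "e i * c i = e i \<and> c i * e i = e i" if "\<not> i < 4"
    proof -
      have "e i = c i" using \<open>i < 8\<close> that unfolding less_8 by (elim disjE) (simp_all add: e_def c_def)
      then show ?thesis using split_idem[OF n[OF \<open>i < 8\<close>]] by simp
    qed
    ultimately show "e i * c i = e i" "c i * e i = e i" by (cases "i < 4"; simp)+
  qed
  have two: "?eM im a * ?eM (- im) a = 0" "?eM (- im) a * ?eM im a = 0" for a
  proof -
    have "im * (im * x) = - x" for x using im by (simp flip: mult.assoc)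
    then show "?eM im a * ?eM (- im) a = 0" "?eM (- im) a * ?eM im a = 0" using im
      by (simp_all add: left_diff_distrib right_diff_distrib distrib_left distrib_right split_Mb(4-7)[OF im])
        (auto intro!: fmat_eqI simp: field_simps)
  qed
  have orth: "e i * e j = 0" if "i < 8" "j < 8" "i \<noteq> j" for i j
  proof (cases "i div 2 \<noteq> j div 2 \<or> (i \<noteq> j \<and> i \<ge> 4)")
    case True
    have "e i * e j = e i * (c i * c j) * e j" using ec that by (metis mult.assoc)
    then show ?thesis using cc[OF that(1,2) True] by simp
  next
    case False
    then have "(i = 0 \<and> j = 1) \<or> (i = 1 \<and> j = 0) \<or> (i = 2 \<and> j = 3) \<or> (i = 3 \<and> j = 2)"
      using that unfolding less_8 by (elim disjE) simp_all
    then show ?thesis using two[of True] two[of False] by (elim disjE conjE) (simp_all add: e_def)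
  qed
  have "e 0 + e 1 + e 2 + e 3 + e 4 + e 5 + e 6 + e 7
     = ?A True + ?A False + ?c2 + ?c3 + K * fb False False + K * fb True True"
    by (simp add: e_def distrib_right) (rule fmat_eqI, simp add: field_simps)
  \<comment> \<open>Of the twenty products of the expansion, \<open>kG\<close> removes ten of the
    sixteen with a \<open>G\<close>, and \<open>kM\<close> removes two of the four with
    \<open>K\<close>.\<close>
  also have "\<dots> = (G False False + G True False + G False True + G True True + K)
      * (fb False False + fb False True + fb True False + fb True True)"
    by (simp add: distrib_left distrib_right kG kM)
  also have "\<dots> = I" by (simp add: sum_G_K sum_fb)
  finally show thesis using that n orth by blast
qed

theorem classification:
  fixes im :: "'a::{alg_closed_field, field_char_0}" and M :: "'a ydm"
  assumes im: "im * im = -1"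
    and hyp: "\<forall>b1\<in>{1, -1::'a}. \<not> nfin (dsum (Mpair exy ex) (Wm im b1 (-1))) \<and>
               \<not> nfin (dsum (Mpair ey exy) (Wm im b1 (-1)))"
    and yd: "is_yd M" and dim: "ydim M \<ge> 1" and fin: "nfin M"
  shows "(\<exists>n1 n2 n3 n4. n1 + n2 + n3 + n4 \<ge> 1 \<and> yd_iso M (Omega1 im n1 n2 n3 n4))
          \<or> (\<exists>n1 n2. yd_iso M (Omega2 im n1 n2))
          \<or> (\<exists>n1 n2. yd_iso M (Omega3 im n1 n2))
          \<or> (\<exists>n1 n2. yd_iso M (Omega4 im n1 n2))
          \<or> (\<exists>n1 n2. yd_iso M (Omega5 im n1 n2))
          \<or> yd_iso M Omega6
          \<or> yd_iso M (Omega7 im)"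
proof -
  interpret yd_module M by standard (rule yd)
  have root: "\<exists>l::'a. l * l = j" for j
    using nth_root_exists[of 2 j] by (auto simp: power2_eq_square)
  obtain e n where s: "\<And>i. i < 8 \<Longrightarrow> split M (e i) (dpow (simples im ! i) (n i))"
    and o: "\<And>i j. i < 8 \<Longrightarrow> j < 8 \<Longrightarrow> i \<noteq> j \<Longrightarrow> e i * e j = 0"
    and sum: "e 0 + e 1 + e 2 + e 3 + e 4 + e 5 + e 6 + e (7::nat) = I"
    using decomposition[OF fin im root] by blast
  have e0: "e i = 0" if "i < 8" "n i = 0" for i
    using s[OF that(1)] split_0 that(2) by fastforce
  have s1: "split M (e i) (simples im ! i)" if "i < 8" "n i = 1" for i
    using s[OF that(1)] that(2) by (simp add: split_dpow_1)
  have ne: "n i = 0 \<or> n j = 0" if "i < 8" "j < 8" "i \<noteq> j" "\<not> nfin (dsum (simples im ! i) (simples im ! j))" for i j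
    using nfin_dsum_of_split[OF fin s[OF that(1)] s[OF that(2)]] that o by blast
  have le1: "n i = 0 \<or> n i = 1" if "i < 8" "\<not> nfin (dsum (simples im ! i) (simples im ! i))" for i
    using nfin_dsum_self_of_split[OF fin s[OF that(1)]] that(2) by linarith
  have n1: "n 4 = 0 \<or> n 4 = 1" "n 5 = 0 \<or> n 5 = 1" "n 6 = 0 \<or> n 6 = 1" "n 7 = 0 \<or> n 7 = 1"
    by (rule le1; simp add: simples_def not_nfin_Mpair_Mpair not_nfin_Wm_Wm im)+
  \<comment> \<open>Here the assumed infinite dimension of the mixed sums of \<open>Mpair\<close>
    and \<open>Wm\<close> enters.\<close>
  have n46: "n 4 = 0 \<or> n 6 = 0" "n 4 = 0 \<or> n 7 = 0" "n 5 = 0 \<or> n 6 = 0" "n 5 = 0 \<or> n 7 = 0"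
    using hyp by (intro ne; simp add: simples_def)+
  have n24: "n 2 = 0 \<or> n 4 = 0" "n 3 = 0 \<or> n 4 = 0" "n 0 = 0 \<or> n 5 = 0" "n 1 = 0 \<or> n 5 = 0"
    by (rule ne; simp add: simples_def not_nfin_Mb_Mpair im)+
  have n16: "n 1 = 0 \<or> n 6 = 0" "n 3 = 0 \<or> n 6 = 0" "n 0 = 0 \<or> n 7 = 0" "n 2 = 0 \<or> n 7 = 0"
    by (rule ne; simp add: simples_def; rule not_nfin_Mb_Wm; simp add: im)+
  have S: "split M (e 0) (dpow (Mb im ex) (n 0))" "split M (e 1) (dpow (Mb (- im) ex) (n 1))"
    "split M (e 2) (dpow (Mb im ey) (n 2))" "split M (e 3) (dpow (Mb (- im) ey) (n 3))"
    "n 4 = 1 \<Longrightarrow> split M (e 4) (Mpair exy ex)" "n 5 = 1 \<Longrightarrow> split M (e 5) (Mpair ey exy)"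
    "n 6 = 1 \<Longrightarrow> split M (e 6) (Wm im 1 (-1))" "n 7 = 1 \<Longrightarrow> split M (e 7) (Wm im (-1) (-1))"
    using s[of 0] s[of 1] s[of 2] s[of 3] s1[of 4] s1[of 5] s1[of 6] s1[of 7] by (simp_all add: simples_def)
  note [simp] = distrib_left distrib_right o e0
  \<comment> \<open>The multiplicities of the four two-dimensional simples, each 0 or 1, determine
    the family; those of the one-dimensional simples become its parameters.\<close>
  consider (6) "n 4 = 1" "n 5 = 1" | (2) "n 4 = 1" "n 5 = 0" | (3) "n 4 = 0" "n 5 = 1"
    | (7) "n 4 = 0" "n 5 = 0" "n 6 = 1" "n 7 = 1" | (4) "n 4 = 0" "n 5 = 0" "n 6 = 1" "n 7 = 0"
    | (5) "n 4 = 0" "n 5 = 0" "n 6 = 0" "n 7 = 1" | (1) "n 4 = 0" "n 5 = 0" "n 6 = 0" "n 7 = 0"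
    using n1 by metis
  then show ?thesis
  proof cases
    case 6
    then have z: "n 0 = 0" "n 1 = 0" "n 2 = 0" "n 3 = 0" "n 6 = 0" "n 7 = 0" using n24 n46 by auto
    have "split M (e 4 + e 5) Omega6" unfolding Omega6_def
      by (intro split_dsum S 6) simp_all
    then show ?thesis using sum z by (auto intro: split_iso)
  next
    case 2
    then have z: "n 2 = 0" "n 3 = 0" "n 6 = 0" "n 7 = 0" using n24 n46 by auto
    have "split M (e 0 + e 1 + e 4) (Omega2 im (n 0) (n 1))" unfolding Omega2_def
      by (intro split_dsum S 2) simp_all
    then have "yd_iso M (Omega2 im (n 0) (n 1))" using sum z 2 by (auto intro: split_iso)
    then show ?thesis by blast
  next
    case 3
    then have z: "n 0 = 0" "n 1 = 0" "n 6 = 0" "n 7 = 0" using n24 n46 by auto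
    have "split M (e 2 + e 3 + e 5) (Omega3 im (n 2) (n 3))" unfolding Omega3_def
      by (intro split_dsum S 3) simp_all
    then have "yd_iso M (Omega3 im (n 2) (n 3))" using sum z 3 by (auto intro: split_iso)
    then show ?thesis by blast
  next
    case 7
    then have z: "n 0 = 0" "n 1 = 0" "n 2 = 0" "n 3 = 0" using n16 by auto
    have "split M (e 6 + e 7) (Omega7 im)" unfolding Omega7_def
      by (intro split_dsum S 7) simp_all
    then show ?thesis using sum z 7 by (auto intro: split_iso)
  next
    case 4
    then have z: "n 1 = 0" "n 3 = 0" using n16 by auto
    have "split M (e 0 + e 2 + e 6) (Omega4 im (n 0) (n 2))" unfolding Omega4_def
      by (intro split_dsum S 4) simp_all
    then have "yd_iso M (Omega4 im (n 0) (n 2))" using sum z 4 by (auto intro: split_iso)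
    then show ?thesis by blast
  next
    case 5
    then have z: "n 0 = 0" "n 2 = 0" using n16 by auto
    have "split M (e 1 + e 3 + e 7) (Omega5 im (n 1) (n 3))" unfolding Omega5_def
      by (intro split_dsum S 5) simp_all
    then have "yd_iso M (Omega5 im (n 1) (n 3))" using sum z 5 by (auto intro: split_iso)
    then show ?thesis by blast
  next
    case 1
    have "split M (e 0 + e 1 + e 2 + e 3) (Omega1 im (n 0) (n 1) (n 2) (n 3))" unfolding Omega1_def
      by (intro split_dsum S) simp_all
    then have iso: "yd_iso M (Omega1 im (n 0) (n 1) (n 2) (n 3))" using sum 1 by (auto intro: split_iso)
    then have "n 0 + n 1 + n 2 + n 3 \<ge> 1" using dim by (simp add: yd_iso_def Omega1_def)
    then show ?thesis using iso by blast
  qed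
qed

theorem theoremA:
  fixes im :: "'a::{alg_closed_field, field_char_0}"
  assumes im_sq: "im * im = -1"
    and hyp: "\<forall>b1\<in>{1, -1::'a}.
               \<not> nfin (dsum (Mpair exy ex) (Wm im b1 (-1))) \<and>
               \<not> nfin (dsum (Mpair ey exy) (Wm im b1 (-1)))"
  shows "(\<forall>M::'a ydm. is_yd M \<and> ydim M \<ge> 1 \<and> nfin M \<longrightarrow>
            (\<exists>n1 n2 n3 n4. n1 + n2 + n3 + n4 \<ge> 1 \<and> yd_iso M (Omega1 im n1 n2 n3 n4))
          \<or> (\<exists>n1 n2. yd_iso M (Omega2 im n1 n2))
          \<or> (\<exists>n1 n2. yd_iso M (Omega3 im n1 n2))
          \<or> (\<exists>n1 n2. yd_iso M (Omega4 im n1 n2))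
          \<or> (\<exists>n1 n2. yd_iso M (Omega5 im n1 n2))
          \<or> yd_iso M Omega6
          \<or> yd_iso M (Omega7 im))
       \<and> (\<forall>n1 n2 n3 n4. n1 + n2 + n3 + n4 \<ge> 1 \<longrightarrow>
            cartan_type (Omega1 im n1 n2 n3 n4) (n1 + n2 + n3 + n4) 0)
       \<and> (\<forall>n1 n2. cartan_type (Omega2 im n1 n2) (n1 + n2) 1)
       \<and> (\<forall>n1 n2. cartan_type (Omega3 im n1 n2) (n1 + n2) 1)
       \<and> (\<forall>n1 n2. cartan_type (Omega4 im n1 n2) (n1 + n2) 1)
       \<and> (\<forall>n1 n2. cartan_type (Omega5 im n1 n2) (n1 + n2) 1)
       \<and> cartan_type (Omega6 :: 'a ydm) 0 2
       \<and> cartan_type (Omega7 im) 0 2"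
  using classification[OF im_sq hyp] cartan_Omega1[OF im_sq] cartan_Omega2[OF im_sq] cartan_Omega3[OF im_sq]
    cartan_Omega4[OF im_sq] cartan_Omega5[OF im_sq] cartan_Omega6[OF im_sq] cartan_Omega7[OF im_sq]
  by (intro conjI allI impI) blast+

end
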